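(* In the nonparametric instrumental variable model, suppose Assumptions N1--N6 (listed in the context) hold. Suppose: (i) if a truncated prior (uniform or truncated normal) is used, assuming $q_n^2B_n^2=o(n^{1/(3d+2)})$, $$q_n^2B_n^2\Bigl(\frac{k_n^{3d/2}}{\sqrt n}+\frac1{k_n}\Bigr)=o(\varphi(\eta_{q_n}^2));$$ (ii) if the thin-tail prior with $r>6d+4$ is used, assuming $q_n=o(n^{1/(6d+4)-1/r})$, $$n^{2/(r-2)}q_n^{2r/(r-2)}\Bigl(\frac{k_n^{3d/2}}{\sqrt n}+\frac1{k_n}\Bigr)^{r/(r-2)}=o(\varphi(\eta_{q_n}^2)).$$ Then for any $\varepsilon>0$, $$P\bigl(d(g_b,\Theta_I)>\varepsilon\mid X^n\bigr)=o_p(1).$$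
   Context: Model: $Y=g_0(X)+\epsilon$ with $E(\epsilon\mid W)=0$, $W\in[0,1]^d$ ($d$ fixed), $X$ possibly correlated with $\epsilon$. $\mathcal H=L^2(X)=\{g:E[g(X)^2]<\infty\}$, $\langle g_1,g_2\rangle_X=E[g_1(X)g_2(X)]$, $\|g\|_s^2=E[g(X)^2]$. $G(g)=E_W\{[E(Y-g(X)\mid W)]^2\}$; $\Theta_I=\{g\in L^2(X):G(g)=0\}$ is nonempty (not necessarily a singleton). $\|g\|_w^2=E_W\{(E(g(X)\mid W))^2\}$. $d(g_1,\Theta_I)=\inf_{g\in\Theta_I}\|g_1-g\|_s$. Sieve: $\phi_1,\phi_2,\ldots$ orthonormal basis functions of $L^2(X)$, integers $q_n\to\infty$, $\mathcal H_n=\mathrm{span}\{\phi_1,\ldots,\phi_{q_n}\}$, $g_b=\sum_{i=1}^{q_n}b_i\phi_i$, $b\in\mathbb R^{q_n}$; $B_n\to\infty$. Posterior: data $X^n=\{(Y_i,X_i,W_i)\}_{i=1}^n$. For integers $k_n\to\infty$, $[0,1]^d$ is partitioned into the $k_n^d$ cubes $R^n_j$ of the form $\prod_{l=1}^d[\frac{i_l-1}{k_n},\frac{i_l}{k_n}]$, $i_l\in\{1,\ldots,k_n\}$. $\hat v_j=\frac1n\sum_iI_{(W_i\in R_j^n)}$ and $\bar G(g)=\sum_{j=1}^{k_n^d}\bigl(\frac1n\sum_{i=1}^n(Y_i-g(X_i))I_{(W_i\in R_j^n)}\bigr)^2\hat v_j^{-1}$ (terms with $\hat v_j=0$ read as $0$).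 The quasi-posterior is $P(g_b\mid X^n)\propto\pi(b)\exp(-\frac n2\bar G(g_b))$. Priors on $b\in\mathbb R^{q_n}$: uniform $\pi(b)\propto\prod_iI(|b_i|\le B_n)$; truncated normal: i.i.d. coordinates $N(0,\sigma^2)$ (fixed $\sigma^2>0$) conditioned on $|b_i|\le B_n$; thin-tail with fixed $r,\beta>0$: $\pi(b)=r\|b\|^{r-q_n}\beta^re^{-\beta^r\|b\|^r}/S_{q_n}$, with $\|b\|$ Euclidean norm and $S_{q_n}$ the area of the $(q_n-1)$-dimensional unit sphere. Assumptions: N1: the data are i.i.d. N2: $k_n^{-d}=O(\min_{j\le k_n^d}P(W\in R_j^n))$ and $\max_{j\le k_n^d}P(W\in R_j^n)=O(k_n^{-d})$. N3: there is $C>0$ such that for all $i=1,\ldots,q_n$: (i) $\sup_wE(Y^2\mid W=w)<C$, $\sup_wE(\phi_i(X)^2\mid W=w)<C$; (ii) $w\mapsto E(Y\mid W=w)$ is Lipschitz on $[0,1]^d$; (iii) $|E(\phi_i(X)\mid W=w_1)-E(\phi_i(X)\mid W=w_2)|\le C\|w_1-w_2\|$ for all $w_1,w_2\in[0,1]^d$. N4: there exist $g_0\in\Theta_I$, $g^*_{q_n}=\sum_{i=1}^{q_n}b_i^*\phi_i$ with $\sum_{i=1}^\infty b_i^{*2}<\infty$, and a positive sequence $\{\eta_j\}_{j\ge1}$ strictly decreasing to zero such that $\|g^*_{q_n}-g_0\|_s=O(\eta_{q_n})$ as $q_n\to\infty$ ($g^*_{q_n}$ is chosen to be the projection of $g_0$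 onto $\mathcal H_n$). N5: the joint distribution of $(Y,X,W)$ is absolutely continuous with respect to Lebesgue measure and, with $f_{XW},f_X,f_W$ the densities of $(X,W)$, $X$, $W$, $\iint\bigl(\frac{f_{XW}(x,w)}{f_X(x)f_W(w)}\bigr)^2f_X(x)f_W(w)\,dx\,dw<\infty$. N6: there is a continuous increasing function $\varphi(\cdot)>0$ with $\lim_{t\to0^+}\varphi(t)=0$ such that, for $\{g_0,g^*_{q_n},\{\eta_j\}\}$ as in N4 and some constants $C_1,C_2>0$: (i) $\|g-g_0\|_w^2\ge C_1\sum_{j=1}^\infty\varphi(\eta_j^2)|\langle g-g_0,\phi_j\rangle_X|^2$ for all $g\in L^2(X)$; (ii) $\|g^*_{q_n}-g_0\|_w^2\le C_2\sum_j\varphi(\eta_j^2)|\langle g_0-g^*_{q_n},\phi_j\rangle_X|^2$. *)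

theory Defs
  imports "HOL-Probability.Probability" "HOL-Library.Landau_Symbols"
begin

text \<open>
  One observation is a triple \<open>(Y, X, W)\<close>. The regressor \<open>X\<close> lives in an arbitrary Euclidean
  space \<open>'x\<close>, the instrument \<open>W\<close> in \<open>real ^ 'd\<close>, so that \<open>d = CARD('d)\<close>. Population
  quantities are taken with respect to the joint law \<open>P\<close> of one observation.
\<close>

type_synonym ('x, 'd) obs = "real \<times> 'x \<times> (real, 'd) vec"

definition outcome :: "('x, 'd) obs \<Rightarrow> real" where
  "outcome z = fst z"

definition regressor :: "('x, 'd) obs \<Rightarrow> 'x" where
  "regressor z = fst (snd z)"

definition instrument :: "('x, 'd) obs \<Rightarrow> (real, 'd) vec" where
  "instrument z = snd (snd z)"

definition cond_W ::
  "('x::euclidean_space, 'd::finite) obs measure \<Rightarrow> (('x, 'd) obs \<Rightarrow> real) \<Rightarrow> ('x, 'd) obs \<Rightarrow> real"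
  where "cond_W P V = real_cond_exp P (vimage_algebra (space P) instrument borel) V"

text \<open>
  \<open>m\<close> is a version of \<open>w \<mapsto> E(V | W = w)\<close>. Integrability of \<open>V\<close> is required because
  \<^const>\<open>real_cond_exp\<close> is only meaningful for integrable functions.
\<close>

definition regression_on_W ::
  "('x::euclidean_space, 'd::finite) obs measure \<Rightarrow> (('x, 'd) obs \<Rightarrow> real)
     \<Rightarrow> ((real, 'd) vec \<Rightarrow> real) \<Rightarrow> bool"
  where "regression_on_W P V m \<longleftrightarrow>
    integrable P V \<and> m \<in> borel_measurable borel \<and>
    (AE z in P. cond_W P V z = m (instrument z))"

definition L2X :: "('x::euclidean_space, 'd::finite) obs measure \<Rightarrow> ('x \<Rightarrow> real) set" where
  "L2X P = {g \<in> borel_measurable borel. integrable P (\<lambda>z. (g (regressor z))\<^sup>2)}"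

definition innerX ::
  "('x::euclidean_space, 'd::finite) obs measure \<Rightarrow> ('x \<Rightarrow> real) \<Rightarrow> ('x \<Rightarrow> real) \<Rightarrow> real" where
  "innerX P g h = (\<integral>z. g (regressor z) * h (regressor z) \<partial>P)"

definition norm_s ::
  "('x::euclidean_space, 'd::finite) obs measure \<Rightarrow> ('x \<Rightarrow> real) \<Rightarrow> real" where
  "norm_s P g = sqrt (\<integral>z. (g (regressor z))\<^sup>2 \<partial>P)"

definition norm_w ::
  "('x::euclidean_space, 'd::finite) obs measure \<Rightarrow> ('x \<Rightarrow> real) \<Rightarrow> real" where
  "norm_w P g = sqrt (\<integral>z. (cond_W P (\<lambda>u. g (regressor u)) z)\<^sup>2 \<partial>P)"

definition G_crit ::
  "('x::euclidean_space, 'd::finite) obs measure \<Rightarrow> ('x \<Rightarrow> real) \<Rightarrow> real" where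
  "G_crit P g = (\<integral>z. (cond_W P (\<lambda>u. outcome u - g (regressor u)) z)\<^sup>2 \<partial>P)"

definition Theta_I :: "('x::euclidean_space, 'd::finite) obs measure \<Rightarrow> ('x \<Rightarrow> real) set" where
  "Theta_I P = {g \<in> L2X P. G_crit P g = 0}"

definition dist_Theta ::
  "('x::euclidean_space, 'd::finite) obs measure \<Rightarrow> ('x \<Rightarrow> real) \<Rightarrow> real" where
  "dist_Theta P g1 = (INF g\<in>Theta_I P. norm_s P (\<lambda>x. g1 x - g x))"

definition npiv_model :: "('x::euclidean_space, 'd::finite) obs measure \<Rightarrow> bool" where
  "npiv_model P \<longleftrightarrow>
    prob_space P \<and> sets P = sets borel \<and>
    (AE z in P. instrument z \<in> cbox 0 1) \<and>
    (\<exists>g\<in>L2X P. \<exists>\<epsilon>. integrable P \<epsilon> \<and>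
       (AE z in P. outcome z = g (regressor z) + \<epsilon> z) \<and>
       (AE z in P. cond_W P \<epsilon> z = 0))"

text \<open>Basis functions, coefficients and the sequence \<open>\<eta>\<close> are indexed from 1; index 0 is unused.\<close>

definition orthonormal_basis_L2X ::
  "('x::euclidean_space, 'd::finite) obs measure \<Rightarrow> (nat \<Rightarrow> 'x \<Rightarrow> real) \<Rightarrow> bool" where
  "orthonormal_basis_L2X P \<phi> \<longleftrightarrow>
    (\<forall>i\<ge>1. \<phi> i \<in> L2X P) \<and>
    (\<forall>i\<ge>1. \<forall>j\<ge>1. innerX P (\<phi> i) (\<phi> j) = (if i = j then 1 else 0)) \<and>
    (\<forall>g\<in>L2X P.
       (\<lambda>N. norm_s P (\<lambda>x. g x - (\<Sum>j=1..N. innerX P g (\<phi> j) * \<phi> j x))) \<longlonglongrightarrow> 0)"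

definition sieve_fun :: "(nat \<Rightarrow> 'x \<Rightarrow> real) \<Rightarrow> nat \<Rightarrow> (nat \<Rightarrow> real) \<Rightarrow> 'x \<Rightarrow> real" where
  "sieve_fun \<phi> q b x = (\<Sum>i=1..q. b i * \<phi> i x)"

text \<open>The cubes are indexed by multi-indices in \<open>{1..k}\<^sup>d\<close> instead of \<open>1, \<dots>, k\<^sup>d\<close>.\<close>

definition cell_indices :: "nat \<Rightarrow> ('d::finite \<Rightarrow> nat) set" where
  "cell_indices k = {j. \<forall>l. j l \<in> {1..k}}"

definition cell :: "nat \<Rightarrow> ('d::finite \<Rightarrow> nat) \<Rightarrow> (real, 'd) vec set" where
  "cell k j = cbox (\<chi> l. (real (j l) - 1) / real k) (\<chi> l. real (j l) / real k)"

definition v_hat ::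
  "nat \<Rightarrow> nat \<Rightarrow> (nat \<Rightarrow> ('x::euclidean_space, 'd::finite) obs) \<Rightarrow> ('d \<Rightarrow> nat) \<Rightarrow> real" where
  "v_hat n k z j = (1 / real n) * (\<Sum>i<n. indicator (cell k j) (instrument (z i)))"

text \<open>Cells with \<open>v_hat = 0\<close> contribute 0 because \<open>inverse 0 = 0\<close>.\<close>

definition G_bar ::
  "nat \<Rightarrow> nat \<Rightarrow> (nat \<Rightarrow> ('x::euclidean_space, 'd::finite) obs) \<Rightarrow> ('x \<Rightarrow> real) \<Rightarrow> real" where
  "G_bar n k z g =
    (\<Sum>j\<in>cell_indices k.
       ((1 / real n) * (\<Sum>i<n. (outcome (z i) - g (regressor (z i)))
                              * indicator (cell k j) (instrument (z i))))\<^sup>2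
       * inverse (v_hat n k z j))"

text \<open>
  Coefficient vectors in \<open>\<real>\<^sup>q\<close> are functions on \<open>{1..q}\<close>, with Lebesgue measure the
  \<open>q\<close>-fold product of \<^term>\<open>lborel :: real measure\<close>.
\<close>

definition lebesgue_coeff :: "nat \<Rightarrow> (nat \<Rightarrow> real) measure" where
  "lebesgue_coeff q = Pi\<^sub>M {1..q} (\<lambda>_. lborel)"

definition quasi_posterior ::
  "((nat \<Rightarrow> real) \<Rightarrow> real) \<Rightarrow> (nat \<Rightarrow> 'x \<Rightarrow> real) \<Rightarrow> nat \<Rightarrow> nat \<Rightarrow> nat
     \<Rightarrow> (nat \<Rightarrow> ('x::euclidean_space, 'd::finite) obs) \<Rightarrow> (nat \<Rightarrow> real) set \<Rightarrow> real" where
  "quasi_posterior \<pi> \<phi> q k n z A =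
    (\<integral>b. indicator A b * (\<pi> b * exp (- (real n / 2) * G_bar n k z (sieve_fun \<phi> q b)))
       \<partial>lebesgue_coeff q)
    / (\<integral>b. \<pi> b * exp (- (real n / 2) * G_bar n k z (sieve_fun \<phi> q b)) \<partial>lebesgue_coeff q)"

text \<open>
  Prior families; \<open>Truncated_Normal \<sigma>\<close> has variance \<open>\<sigma>\<^sup>2\<close>, and \<open>Thin_Tail r \<beta>\<close> does not
  depend on the truncation point.
\<close>

datatype prior_family = Uniform | Truncated_Normal real | Thin_Tail real real

definition sphere_area :: "nat \<Rightarrow> real" where
  "sphere_area q = 2 * pi powr (real q / 2) / Gamma (real q / 2)"

fun prior_density :: "prior_family \<Rightarrow> nat \<Rightarrow> real \<Rightarrow> (nat \<Rightarrow> real) \<Rightarrow> real" where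
  "prior_density Uniform q B b =
     (\<Prod>i=1..q. indicator {t. \<bar>t\<bar> \<le> B} (b i) / (2 * B))"
| "prior_density (Truncated_Normal \<sigma>) q B b =
     (\<Prod>i=1..q. indicator {t. \<bar>t\<bar> \<le> B} (b i) * normal_density 0 \<sigma> (b i)
        / measure (density lborel (\<lambda>t. ennreal (normal_density 0 \<sigma> t))) {t. \<bar>t\<bar> \<le> B})"
| "prior_density (Thin_Tail r \<beta>) q B b =
     r * (L2_set b {1..q}) powr (r - real q) * \<beta> powr r
       * exp (- (\<beta> powr r) * (L2_set b {1..q}) powr r) / sphere_area q"

fun valid_prior :: "prior_family \<Rightarrow> bool" where
  "valid_prior Uniform \<longleftrightarrow> True"
| "valid_prior (Truncated_Normal \<sigma>) \<longleftrightarrow> \<sigma> > 0"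
| "valid_prior (Thin_Tail r \<beta>) \<longleftrightarrow> r > 0 \<and> \<beta> > 0"

fun truncated_prior :: "prior_family \<Rightarrow> bool" where
  "truncated_prior Uniform \<longleftrightarrow> True"
| "truncated_prior (Truncated_Normal \<sigma>) \<longleftrightarrow> True"
| "truncated_prior (Thin_Tail r \<beta>) \<longleftrightarrow> False"

definition iid_sample ::
  "'o measure \<Rightarrow> (nat \<Rightarrow> 'o \<Rightarrow> ('x::euclidean_space, 'd::finite) obs)
     \<Rightarrow> ('x, 'd) obs measure \<Rightarrow> bool" where
  "iid_sample M Z P \<longleftrightarrow>
    prob_space M \<and> prob_space.indep_vars M (\<lambda>_. borel) Z UNIV \<and> (\<forall>i. distr M borel (Z i) = P)"

definition cell_prob ::
  "('x::euclidean_space, 'd::finite) obs measure \<Rightarrow> nat \<Rightarrow> ('d \<Rightarrow> nat) \<Rightarrow> real" where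
  "cell_prob P k j = measure P {z \<in> space P. instrument z \<in> cell k j}"

definition balanced_cells ::
  "('x::euclidean_space, 'd::finite) obs measure \<Rightarrow> (nat \<Rightarrow> nat) \<Rightarrow> bool" where
  "balanced_cells P k \<longleftrightarrow>
    (\<lambda>n. 1 / real (k n) ^ CARD('d)) \<in> O(\<lambda>n. Min (cell_prob P (k n) ` cell_indices (k n))) \<and>
    (\<lambda>n. Max (cell_prob P (k n) ` cell_indices (k n))) \<in> O(\<lambda>n. 1 / real (k n) ^ CARD('d))"

text \<open>
  Conditional moments are determined only up to null sets of the law of \<open>W\<close>; the pointwise
  bounds and Lipschitz conditions are imposed on some version.
\<close>

definition regular_cond_moments ::
  "('x::euclidean_space, 'd::finite) obs measure \<Rightarrow> (nat \<Rightarrow> 'x \<Rightarrow> real) \<Rightarrow> (nat \<Rightarrow> nat) \<Rightarrow> bool" where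
  "regular_cond_moments P \<phi> q \<longleftrightarrow>
    (\<exists>C>0.
      (\<exists>m. regression_on_W P (\<lambda>z. (outcome z)\<^sup>2) m \<and> (\<forall>w\<in>cbox 0 1. m w < C)) \<and>
      (\<exists>m L. regression_on_W P outcome m \<and> L-lipschitz_on (cbox 0 1) m) \<and>
      (\<forall>n. \<forall>i\<in>{1..q n}.
        (\<exists>m. regression_on_W P (\<lambda>z. (\<phi> i (regressor z))\<^sup>2) m \<and> (\<forall>w\<in>cbox 0 1. m w < C)) \<and>
        (\<exists>m. regression_on_W P (\<lambda>z. \<phi> i (regressor z)) m \<and>
             (\<forall>w1\<in>cbox 0 1. \<forall>w2\<in>cbox 0 1. \<bar>m w1 - m w2\<bar> \<le> C * norm (w1 - w2)))))"

text \<open>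
  The second and third conditions say that \<open>g\<^sup>*\<^bsub>q\<^esub> = sieve_fun \<phi> q bstar\<close> is the orthogonal
  projection of \<open>g0\<close> onto the span of \<open>\<phi> 1, \<dots>, \<phi> q\<close>, with square-summable coefficients.
\<close>

definition sieve_approximation ::
  "('x::euclidean_space, 'd::finite) obs measure \<Rightarrow> (nat \<Rightarrow> 'x \<Rightarrow> real) \<Rightarrow> (nat \<Rightarrow> nat)
     \<Rightarrow> ('x \<Rightarrow> real) \<Rightarrow> (nat \<Rightarrow> real) \<Rightarrow> (nat \<Rightarrow> real) \<Rightarrow> bool" where
  "sieve_approximation P \<phi> q g0 bstar \<eta> \<longleftrightarrow>
    g0 \<in> Theta_I P \<and>
    (\<forall>n. \<forall>i\<in>{1..q n}. innerX P (\<lambda>x. g0 x - sieve_fun \<phi> (q n) bstar x) (\<phi> i) = 0) \<and>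
    summable (\<lambda>i. (bstar (Suc i))\<^sup>2) \<and>
    (\<forall>j\<ge>1. 0 < \<eta> j \<and> \<eta> (Suc j) < \<eta> j) \<and> \<eta> \<longlonglongrightarrow> 0 \<and>
    (\<lambda>n. norm_s P (\<lambda>x. sieve_fun \<phi> (q n) bstar x - g0 x)) \<in> O(\<lambda>n. \<eta> (q n))"

definition square_integrable_density_ratio ::
  "('x::euclidean_space, 'd::finite) obs measure \<Rightarrow> bool" where
  "square_integrable_density_ratio P \<longleftrightarrow>
    absolutely_continuous lborel P \<and>
    (\<exists>fXW fX fW.
      (\<forall>x w. 0 \<le> fXW (x, w)) \<and> (\<forall>x. 0 \<le> fX x) \<and> (\<forall>w. 0 \<le> fW w) \<and>
      distributed P lborel (\<lambda>z. (regressor z, instrument z)) (\<lambda>u. ennreal (fXW u)) \<and>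
      distributed P lborel regressor (\<lambda>x. ennreal (fX x)) \<and>
      distributed P lborel instrument (\<lambda>w. ennreal (fW w)) \<and>
      (\<integral>\<^sup>+x. (\<integral>\<^sup>+w. ennreal ((fXW (x, w) / (fX x * fW w))\<^sup>2 * fX x * fW w) \<partial>lborel) \<partial>lborel) < \<infinity>)"

definition link_condition ::
  "('x::euclidean_space, 'd::finite) obs measure \<Rightarrow> (nat \<Rightarrow> 'x \<Rightarrow> real) \<Rightarrow> (nat \<Rightarrow> nat)
     \<Rightarrow> ('x \<Rightarrow> real) \<Rightarrow> (nat \<Rightarrow> real) \<Rightarrow> (nat \<Rightarrow> real) \<Rightarrow> (real \<Rightarrow> real) \<Rightarrow> bool" where
  "link_condition P \<phi> q g0 bstar \<eta> varphi \<longleftrightarrow>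
    continuous_on {0<..} varphi \<and> mono_on {0<..} varphi \<and> (\<forall>t>0. varphi t > 0) \<and>
    (varphi \<longlongrightarrow> 0) (at_right 0) \<and>
    (\<exists>C1>0. \<forall>g\<in>L2X P.
      (norm_w P (\<lambda>x. g x - g0 x))\<^sup>2 \<ge>
        C1 * (\<Sum>j. varphi ((\<eta> (Suc j))\<^sup>2) * \<bar>innerX P (\<lambda>x. g x - g0 x) (\<phi> (Suc j))\<bar>\<^sup>2)) \<and>
    (\<exists>C2>0. \<forall>n.
      (norm_w P (\<lambda>x. sieve_fun \<phi> (q n) bstar x - g0 x))\<^sup>2 \<le>
        C2 * (\<Sum>j. varphi ((\<eta> (Suc j))\<^sup>2)
                   * \<bar>innerX P (\<lambda>x. g0 x - sieve_fun \<phi> (q n) bstar x) (\<phi> (Suc j))\<bar>\<^sup>2))"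

text \<open>\<open>T n = o\<^sub>p(1)\<close>; measurability is included since \<^const>\<open>measure\<close> is 0 on non-measurable sets.\<close>

definition op_one :: "'o measure \<Rightarrow> (nat \<Rightarrow> 'o \<Rightarrow> real) \<Rightarrow> bool" where
  "op_one M T \<longleftrightarrow>
    (\<forall>n. T n \<in> borel_measurable M) \<and>
    (\<forall>\<delta>>0. (\<lambda>n. measure M {\<omega> \<in> space M. \<bar>T n \<omega>\<bar> > \<delta>}) \<longlonglongrightarrow> 0)"

end

theory Submission
  imports Defs
begin

text \<open>
  Write \<open>g\<^sub>b\<close> for the sieve function with coefficients \<open>b\<close>, \<open>G(g)\<close> for the population criterion and
  \<open>\<lambda>\<^sub>n\<close> for the value of \<open>varphi\<close> at the square of \<open>\<eta>\<^bsub>q\<^esub>\<close>, \<open>q = q\<^sub>n\<close>. The posterior charges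
  \<open>{b. dist_Theta P (g\<^sub>b) > \<epsilon>}\<close> negligibly because the criterion separates this set from \<open>b\<^sup>*\<close> on the
  scale \<open>\<lambda>\<^sub>n\<close>, sampling errors are of smaller order than \<open>\<lambda>\<^sub>n\<close>, and the weight \<open>exp(- n G/2)\<close> turns a
  gap of order \<open>\<lambda>\<^sub>n\<close> into a factor \<open>exp(- c n \<lambda>\<^sub>n)\<close> that beats every cost caused by the prior.

  Separation. Since \<open>E(Y - g\<^sub>0(X) | W) = 0\<close>, \<open>G(g)\<close> is the squared weak norm of \<open>g - g\<^sub>0\<close>. The lower
  link inequality gives \<open>G(g\<^sub>b) \<ge> C\<^sub>1 \<lambda>\<^sub>n |b - b\<^sup>*|\<^sup>2\<close>, and by Pythagoras \<open>|b - b\<^sup>*|\<^sup>2\<close> is at least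
  \<open>\<epsilon>\<^sup>2/2\<close> on the set in question once the sieve bias is small. In the other direction
  \<open>G(g\<^sub>b) \<le> 2 |b - b\<^sup>*|\<^sup>2 + o(\<lambda>\<^sub>n)\<close>: conditioning is a contraction, and the upper link inequality bounds
  the squared weak norm of the sieve bias by \<open>\<lambda>\<^sub>n\<close> times its squared strong norm, up to a constant
  (\<open>weak_norm_lower\<close>, \<open>sieve_pythagoras\<close>, \<open>weak_norm_upper\<close>).

  Sampling error. The residual \<open>Y - g\<^sub>b(X)\<close> is linear in \<open>(1, -b)\<close>, so on \<open>{b. |b\<^sub>i| \<le> R}\<close> the
  difference between the sample and population criteria is at most \<open>R\<^sup>2\<close> times a random variable that
  does not involve \<open>b\<close>. Its fluctuation part has expectation \<open>O(q\<^sup>2 k\<^sup>d / \<surd>n)\<close> by the variance of a sample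
  mean in each cube, and its deterministic part, the replacement of conditional means by cube averages, is
  \<open>O(q\<^sup>2/k\<^sup>2)\<close> by the Lipschitz condition (\<open>uniform_criterion_bound\<close>, \<open>fluctuation_expectation\<close>,
  \<open>population_criterion_bias\<close>, \<open>criterion_concentration\<close>).

  Prior. Up to factors \<open>exp(O(q log n))\<close> a cube of radius of order \<open>\<surd>(\<lambda>\<^sub>n/q)\<close> around \<open>b\<^sup>*\<close> has prior mass one,
  and the rate conditions force \<open>n \<lambda>\<^sub>n \<ge> q \<surd>n\<close>, which dominates \<open>q log n\<close>. A truncated prior lives on
  \<open>{b. |b\<^sub>i| \<le> B\<^sub>n}\<close>. For the thin-tail prior the choice \<open>R\<^sub>n = m (n \<lambda>\<^sub>n)\<^bsup>1/r\<^esup>\<close> makes the mass outside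
  \<open>{b. |b\<^sub>i| \<le> R\<^sub>n}\<close> smaller than \<open>exp(- n \<lambda>\<^sub>n)\<close> up to such factors, and the thin-tail rate condition,
  raised to the power \<open>(r - 2)/r\<close>, says exactly that
  \<open>q\<^sup>2 R\<^sub>n\<^sup>2 (k\<^bsup>3d/2\<^esup>/\<surd>n + 1/k) = o(\<lambda>\<^sub>n)\<close>, so the sampling error stays under control on that cube
  (\<open>truncated_prior_admissible\<close>, \<open>thin_tail_prior_admissible\<close>).

  The three parts meet in \<open>posterior_ratio_bound\<close>, which bounds the posterior mass by
  \<open>exp(O(q log n)) (exp(- n (c - \<tau>) \<lambda>\<^sub>n/2) + exp(- n \<lambda>\<^sub>n)) exp(5 n \<tau> \<lambda>\<^sub>n/2)\<close> with \<open>\<tau>\<close> small compared with \<open>c\<close>.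
\<close>

section \<open>Conditional expectation given the instrument\<close>

lemma outcome_measurable [measurable]: "outcome \<in> borel_measurable (borel :: ('x::euclidean_space, 'd::finite) obs measure)"
  unfolding outcome_def[abs_def] by (intro borel_measurable_continuous_onI continuous_intros)

lemma regressor_measurable [measurable]: "regressor \<in> borel_measurable (borel :: ('x::euclidean_space, 'd::finite) obs measure)"
  unfolding regressor_def[abs_def] by (intro borel_measurable_continuous_onI continuous_intros)

lemma instrument_measurable [measurable]: "instrument \<in> borel_measurable (borel :: ('x::euclidean_space, 'd::finite) obs measure)"
  unfolding instrument_def[abs_def] by (intro borel_measurable_continuous_onI continuous_intros)

lemma cell_borel [measurable]: "cell k j \<in> sets borel"
  unfolding cell_def by simp

locale observation_law = prob_space P
  for P :: "('x::euclidean_space, 'd::finite) obs measure" +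
  assumes sets_law [measurable_cong]: "sets P = sets borel"
begin

lemma space_law [simp]: "space P = UNIV"
  using sets_eq_imp_space_eq[OF sets_law] by simp

sublocale instrument_algebra:
  finite_measure_subalgebra P "vimage_algebra (space P) instrument borel"
proof
  have "instrument \<in> measurable P borel" by measurable
  then show "subalgebra P (vimage_algebra (space P) instrument borel)"
    unfolding subalgebra_def by (intro conjI sets_image_in_sets) (simp_all del: space_law)
qed

lemma cond_W_integrable: "integrable P V \<Longrightarrow> integrable P (cond_W P V)"
  unfolding cond_W_def by (rule instrument_algebra.real_cond_exp_int)

lemma cond_W_measurable [measurable]: "cond_W P V \<in> borel_measurable P"
  unfolding cond_W_def by measurable

lemma cond_W_add:
  "integrable P U \<Longrightarrow> integrable P V \<Longrightarrow>
    AE z in P. cond_W P (\<lambda>z. U z + V z) z = cond_W P U z + cond_W P V z"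
  unfolding cond_W_def by (rule instrument_algebra.real_cond_exp_add)

lemma cond_W_diff:
  "integrable P U \<Longrightarrow> integrable P V \<Longrightarrow>
    AE z in P. cond_W P (\<lambda>z. U z - V z) z = cond_W P U z - cond_W P V z"
  unfolding cond_W_def by (rule instrument_algebra.real_cond_exp_diff)

lemma cond_W_cmult:
  "integrable P V \<Longrightarrow> AE z in P. cond_W P (\<lambda>z. c * V z) z = c * cond_W P V z"
  unfolding cond_W_def by (rule instrument_algebra.real_cond_exp_cmult)

text \<open>
  Both sides are integrals over the event \<open>instrument \<in> A\<close>, which belongs to the conditioning
  \<open>\<sigma>\<close>-algebra. It turns cube averages of \<open>V\<close> into cube averages of its regression function.
\<close>

lemma cond_W_integral_cell:
  assumes V: "integrable P V" and A: "A \<in> sets borel"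
  shows "(\<integral>z. V z * indicator A (instrument z) \<partial>P) = (\<integral>z. cond_W P V z * indicator A (instrument z) \<partial>P)"
proof -
  have "instrument -` A \<inter> space P \<in> sets (vimage_algebra (space P) instrument borel)"
    using A by (rule in_vimage_algebra)
  from instrument_algebra.real_cond_exp_intA[OF V this]
  have "(\<integral>z. indicator (instrument -` A \<inter> space P) z *\<^sub>R V z \<partial>P)
      = (\<integral>z. indicator (instrument -` A \<inter> space P) z *\<^sub>R cond_W P V z \<partial>P)"
    unfolding cond_W_def set_lebesgue_integral_def .
  moreover have "indicator (instrument -` A \<inter> space P) z *\<^sub>R f z = f z * indicator A (instrument z)"
    for f :: "('x, 'd) obs \<Rightarrow> real" and z
    by (simp add: indicator_def)
  ultimately show ?thesis by (simp only:)
qed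

lemma square_integrable_product:
  fixes U V :: "('x, 'd) obs \<Rightarrow> real"
  assumes "U \<in> borel_measurable P" "V \<in> borel_measurable P"
    and "integrable P (\<lambda>z. (U z)\<^sup>2)" "integrable P (\<lambda>z. (V z)\<^sup>2)"
  shows "integrable P (\<lambda>z. U z * V z)"
proof (rule Bochner_Integration.integrable_bound[where f = "\<lambda>z. (U z)\<^sup>2 + (V z)\<^sup>2"])
  show "integrable P (\<lambda>z. (U z)\<^sup>2 + (V z)\<^sup>2)" using assms by auto
  have "\<bar>s * t\<bar> \<le> s\<^sup>2 + t\<^sup>2" for s t :: real
    using sum_squares_bound[of "\<bar>s\<bar>" "\<bar>t\<bar>"] mult_nonneg_nonneg[of "\<bar>s\<bar>" "\<bar>t\<bar>"]
    by (simp add: abs_mult del: mult_nonneg_nonneg)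
  then show "AE z in P. norm (U z * V z) \<le> norm ((U z)\<^sup>2 + (V z)\<^sup>2)" by auto
  show "(\<lambda>z. U z * V z) \<in> borel_measurable P" using assms by auto
qed

lemma square_integrable_add:
  fixes U V :: "('x, 'd) obs \<Rightarrow> real"
  assumes "U \<in> borel_measurable P" "V \<in> borel_measurable P"
    and "integrable P (\<lambda>z. (U z)\<^sup>2)" "integrable P (\<lambda>z. (V z)\<^sup>2)"
  shows "integrable P (\<lambda>z. (U z + V z)\<^sup>2)"
  using assms square_integrable_product[OF assms] by (auto simp: power2_sum mult.assoc)

lemma square_integrable_sum:
  fixes \<psi> :: "nat \<Rightarrow> ('x, 'd) obs \<Rightarrow> real"
  assumes "finite A" "\<And>a. a \<in> A \<Longrightarrow> \<psi> a \<in> borel_measurable P"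
    and "\<And>a. a \<in> A \<Longrightarrow> integrable P (\<lambda>z. (\<psi> a z)\<^sup>2)"
  shows "(\<lambda>z. \<Sum>a\<in>A. c a * \<psi> a z) \<in> borel_measurable P \<and> integrable P (\<lambda>z. (\<Sum>a\<in>A. c a * \<psi> a z)\<^sup>2)"
  using assms
proof (induction A rule: finite_induct)
  case (insert x F)
  have "integrable P (\<lambda>z. (c x * \<psi> x z + (\<Sum>a\<in>F. c a * \<psi> a z))\<^sup>2)"
    by (rule square_integrable_add) (use insert in \<open>auto simp: power_mult_distrib\<close>)
  with insert show ?case by auto
qed auto

text \<open>Conditional Jensen for the square: conditioning on the instrument is an \<open>L\<^sup>2\<close> contraction.\<close>

lemma cond_W_contraction:
  assumes V: "V \<in> borel_measurable P" "integrable P (\<lambda>z. (V z)\<^sup>2)"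
  shows "integrable P (\<lambda>z. (cond_W P V z)\<^sup>2)"
    and "(\<integral>z. (cond_W P V z)\<^sup>2 \<partial>P) \<le> (\<integral>z. (V z)\<^sup>2 \<partial>P)"
proof -
  have int: "integrable P V" by (rule square_integrable_imp_integrable[OF V])
  have conv: "convex_on UNIV (\<lambda>t::real. t\<^sup>2)"
    by (rule convex_power2)
  show i: "integrable P (\<lambda>z. (cond_W P V z)\<^sup>2)"
    unfolding cond_W_def
    by (rule instrument_algebra.integrable_convex_cond_exp[OF int, where I = UNIV and q = "\<lambda>t. t\<^sup>2"])
      (use V conv in auto)
  have "AE z in P. (cond_W P V z)\<^sup>2 \<le> cond_W P (\<lambda>z. (V z)\<^sup>2) z"
    unfolding cond_W_def
    by (rule instrument_algebra.real_cond_exp_jensens_inequality(2)[OF int, where I = UNIV and q = "\<lambda>t. t\<^sup>2"])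
      (use V conv in auto)
  then have "(\<integral>z. (cond_W P V z)\<^sup>2 \<partial>P) \<le> (\<integral>z. cond_W P (\<lambda>z. (V z)\<^sup>2) z \<partial>P)"
    by (intro integral_mono_AE i cond_W_integrable V)
  also have "\<dots> = (\<integral>z. (V z)\<^sup>2 \<partial>P)"
    unfolding cond_W_def using V by (intro instrument_algebra.real_cond_exp_int)
  finally show "(\<integral>z. (cond_W P V z)\<^sup>2 \<partial>P) \<le> (\<integral>z. (V z)\<^sup>2 \<partial>P)" .
qed

text \<open>
  The sieve residual is a combination of finitely many regressands whose regression functions are
  given individually; this assembles a version of its own regression function.
\<close>

lemma cond_W_sum:
  assumes "finite A" "\<And>a. a \<in> A \<Longrightarrow> regression_on_W P (\<psi> a) (m a)"
  shows "integrable P (\<lambda>z. \<Sum>a\<in>A. c a * \<psi> a z) \<and>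
    (AE z in P. cond_W P (\<lambda>z. \<Sum>a\<in>A. c a * \<psi> a z) z = (\<Sum>a\<in>A. c a * m a (instrument z)))"
  using assms
proof (induction A rule: finite_induct)
  case empty
  have "AE z in P. cond_W P (\<lambda>z. 0 * (0::real)) z = 0 * cond_W P (\<lambda>z. 0) z"
    by (rule cond_W_cmult) simp
  then show ?case by simp
next
  case (insert x F)
  then have x: "integrable P (\<psi> x)" "AE z in P. cond_W P (\<psi> x) z = m x (instrument z)"
    by (auto simp: regression_on_W_def)
  have F: "integrable P (\<lambda>z. \<Sum>a\<in>F. c a * \<psi> a z)"
    "AE z in P. cond_W P (\<lambda>z. \<Sum>a\<in>F. c a * \<psi> a z) z = (\<Sum>a\<in>F. c a * m a (instrument z))"
    using insert by auto
  have cx: "integrable P (\<lambda>z. c x * \<psi> x z)" using x by simp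
  from cond_W_cmult[OF x(1), of "c x"] cond_W_add[OF cx F(1)] x(2) F(2)
  have "AE z in P. cond_W P (\<lambda>z. c x * \<psi> x z + (\<Sum>a\<in>F. c a * \<psi> a z)) z
     = c x * m x (instrument z) + (\<Sum>a\<in>F. c a * m a (instrument z))"
    by eventually_elim simp
  with insert.hyps cx F(1) show ?case by auto
qed

end

section \<open>The partition into cubes and the discretisation bias\<close>

lemma cell_indices_eq_PiE: "cell_indices k = (PiE UNIV (\<lambda>_. {1..k}) :: ('d::finite \<Rightarrow> nat) set)"
  by (auto simp: cell_indices_def PiE_def Pi_def)

lemma finite_cell_indices [simp]: "finite (cell_indices k :: ('d::finite \<Rightarrow> nat) set)"
  unfolding cell_indices_eq_PiE by (intro finite_PiE) auto

lemma card_cell_indices: "card (cell_indices k :: ('d::finite \<Rightarrow> nat) set) = k ^ CARD('d)"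
  unfolding cell_indices_eq_PiE by (subst card_PiE) auto

lemma mem_cell_iff:
  assumes "k \<ge> 1"
  shows "w \<in> cell k j \<longleftrightarrow> (\<forall>l. real (j l) - 1 \<le> real k * w $ l \<and> real k * w $ l \<le> real (j l))"
  using assms by (simp add: cell_def mem_box_cart field_simps)

lemma cell_subset_unit_cube:
  fixes j :: "'d::finite \<Rightarrow> nat"
  assumes "k \<ge> 1" "j \<in> cell_indices k"
  shows "cell k j \<subseteq> cbox 0 1"
proof
  fix w :: "(real, 'd) vec" assume "w \<in> cell k j"
  then have *: "real (j l) - 1 \<le> real k * w $ l \<and> real k * w $ l \<le> real (j l)" for l
    using mem_cell_iff[OF assms(1)] by blast
  have "0 \<le> w $ l \<and> w $ l \<le> 1" for l
  proof -
    have "1 \<le> j l" "j l \<le> k" using assms(2) by (auto simp: cell_indices_def)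
    then have "0 \<le> real k * w $ l" "real k * w $ l \<le> real k * 1"
      using *[of l] by linarith+
    moreover have "0 < real k" using assms(1) by simp
    ultimately show ?thesis by (simp only: mult_le_cancel_left_pos zero_le_mult_iff) auto
  qed
  then show "w \<in> cbox 0 1" by (simp add: mem_box_cart)
qed

text \<open>
  The bound by the \<open>\<ell>\<^sup>1\<close> norm costs a factor depending on the fixed dimension only.
\<close>

lemma cell_diameter:
  fixes w w' :: "(real, 'd::finite) vec"
  assumes "k \<ge> 1" "w \<in> cell k j" "w' \<in> cell k j"
  shows "norm (w - w') \<le> real CARD('d) / real k"
proof -
  have "\<bar>(w - w') $ l\<bar> \<le> 1 / real k" for l
  proof -
    have "real (j l) - 1 \<le> real k * w $ l \<and> real k * w $ l \<le> real (j l)"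
      "real (j l) - 1 \<le> real k * w' $ l \<and> real k * w' $ l \<le> real (j l)"
      using assms mem_cell_iff by blast+
    then have "\<bar>real k * (w $ l - w' $ l)\<bar> \<le> 1" by (auto simp: algebra_simps abs_le_iff)
    then have "real k * \<bar>w $ l - w' $ l\<bar> \<le> 1" by (simp only: abs_mult abs_of_nat)
    then show ?thesis using assms(1) by (simp add: field_simps)
  qed
  then have "(\<Sum>l\<in>UNIV. \<bar>(w - w') $ l\<bar>) \<le> (\<Sum>l\<in>(UNIV::'d set). 1 / real k)"
    by (intro sum_mono) auto
  then show ?thesis using norm_le_l1_cart[of "w - w'"] by simp
qed

text \<open>
  The only candidate for the index of the cube is the coordinatewise ceiling of \<open>k w\<close>; a second cube
  could contain \<open>w\<close> only if some \<open>k w\<^sub>l\<close> were an integer.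
\<close>

lemma sum_indicator_cells:
  fixes w :: "(real, 'd::finite) vec"
  assumes k: "k \<ge> 1" and w: "w \<in> cbox 0 1"
    and off: "\<And>l i. i \<le> k \<Longrightarrow> w $ l \<noteq> real i / real k"
  shows "(\<Sum>j\<in>cell_indices k. indicator (cell k j) w) = (1::real)"
proof -
  define j0 where "j0 l = nat \<lceil>real k * w $ l\<rceil>" for l
  have off': "real k * w $ l \<noteq> real i" if "i \<le> k" for l i
    using off[OF that, of l] k by (auto simp: field_simps)
  have w01: "0 \<le> real k * w $ l" "real k * w $ l \<le> real k" for l
    using w k by (auto simp: mem_box_cart mult_left_le)
  have j0: "j0 \<in> cell_indices k"
  proof -
    have "j0 l \<in> {1..k}" for l
    proof -
      have "0 < real k * w $ l" using off'[of 0 l] w01(1)[of l] by linarith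
      then have "0 < \<lceil>real k * w $ l\<rceil>" by simp
      moreover have "\<lceil>real k * w $ l\<rceil> \<le> int k" using w01(2)[of l] by (simp add: ceiling_le_iff)
      ultimately have "1 \<le> nat \<lceil>real k * w $ l\<rceil> \<and> nat \<lceil>real k * w $ l\<rceil> \<le> k" by linarith
      then show ?thesis by (simp only: j0_def atLeastAtMost_iff)
    qed
    then show ?thesis by (simp add: cell_indices_def)
  qed
  have "indicator (cell k j) w = (if j = j0 then 1 else 0::real)" if j: "j \<in> cell_indices k" for j
  proof -
    have "w \<in> cell k j \<longleftrightarrow> j = j0"
    proof
      assume "w \<in> cell k j"
      then have *: "real (j l) - 1 \<le> real k * w $ l \<and> real k * w $ l \<le> real (j l)" for l
        using mem_cell_iff[OF k] by blast
      have "j l = j0 l" for l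
      proof -
        have jl: "1 \<le> j l" "j l \<le> k" using j by (auto simp: cell_indices_def)
        then have "real (j l) - 1 \<noteq> real k * w $ l"
          using off'[of "j l - 1" l] by (fastforce simp: of_nat_diff)
        then have "real_of_int (int (j l)) - 1 < real k * w $ l" "real k * w $ l \<le> real_of_int (int (j l))"
          using *[of l] by auto
        then have "\<lceil>real k * w $ l\<rceil> = int (j l)" by (rule ceiling_unique)
        then show ?thesis by (simp add: j0_def)
      qed
      then show "j = j0" by auto
    next
      assume "j = j0"
      have jr: "real (j0 l) = of_int \<lceil>real k * w $ l\<rceil>" for l
        using w01(1)[of l] by (simp add: j0_def)
      then have "real (j0 l) - 1 \<le> real k * w $ l \<and> real k * w $ l \<le> real (j0 l)" for l
        unfolding jr[of l] by linarith
      then show "w \<in> cell k j" unfolding mem_cell_iff[OF k] \<open>j = j0\<close> by blast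
    qed
    then show ?thesis by (simp add: indicator_def)
  qed
  then have "(\<Sum>j\<in>cell_indices k. indicator (cell k j) w) = (\<Sum>j\<in>cell_indices k. if j = j0 then 1 else (0::real))"
    by (intro sum.cong) auto
  with j0 show ?thesis by simp
qed

text \<open>
  The cubes are closed, so neighbours overlap in faces; faces lie in hyperplanes of this kind.
\<close>

lemma AE_off_hyperplane:
  fixes l :: "'d::finite" and c :: real
  shows "AE w in lborel. w $ l \<noteq> c"
proof -
  have "negligible {w :: (real, 'd) vec. w \<bullet> axis l 1 = c}"
    by (intro negligible_standard_hyperplane) simp
  then have "{w :: (real, 'd) vec. w $ l = c} \<in> null_sets lebesgue"
    by (simp add: negligible_iff_null_sets cart_eq_inner_axis)
  moreover have "{w :: (real, 'd) vec. w $ l = c} \<in> sets lborel"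
    by simp
  ultimately have "{w :: (real, 'd) vec. w $ l = c} \<in> null_sets lborel"
    by (simp add: null_sets_completion_iff)
  then show ?thesis by (rule AE_I') auto
qed

context observation_law begin

text \<open>The instrument has a Lebesgue density, so it almost surely avoids the faces shared by cubes.\<close>

lemma AE_sum_indicator_cells:
  assumes k: "k \<ge> 1" and unit: "AE z in P. instrument z \<in> cbox 0 1"
    and dens: "distributed P lborel instrument f"
  shows "AE z in P. (\<Sum>j\<in>cell_indices k. indicator (cell k j) (instrument z)) = (1::real)"
proof -
  have "AE w in lborel. \<forall>l::'d. \<forall>i\<in>{..k}. (w :: (real, 'd) vec) $ l \<noteq> real i / real k"
    by (simp add: AE_all_countable AE_ball_countable AE_off_hyperplane)
  then have "AE w in density lborel f. \<forall>l::'d. \<forall>i\<in>{..k}. w $ l \<noteq> real i / real k"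
    using dens by (subst AE_density) (auto simp: distributed_def)
  then have "AE w in distr P lborel instrument. \<forall>l::'d. \<forall>i\<in>{..k}. w $ l \<noteq> real i / real k"
    by (simp only: distributed_distr_eq_density[OF dens])
  then have "AE z in P. \<forall>l::'d. \<forall>i\<in>{..k}. instrument z $ l \<noteq> real i / real k"
    by (rule AE_distrD[rotated]) (use dens in \<open>simp add: distributed_def\<close>)
  with unit show ?thesis
    by eventually_elim (intro sum_indicator_cells k, auto)
qed

lemma cell_prob_eq_integral: "cell_prob P k j = (\<integral>z. indicator (cell k j) (instrument z) \<partial>P)"
proof -
  have "{z \<in> space P. instrument z \<in> cell k j} \<in> sets P" by measurable
  then have "cell_prob P k j = (\<integral>z. indicator {z \<in> space P. instrument z \<in> cell k j} z \<partial>P)"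
    by (simp add: cell_prob_def)
  also have "\<dots> = (\<integral>z. indicator (cell k j) (instrument z) \<partial>P)"
    by (intro Bochner_Integration.integral_cong) (auto simp: indicator_def)
  finally show ?thesis .
qed

lemma integrable_times_cell:
  fixes V :: "('x, 'd) obs \<Rightarrow> real"
  assumes "integrable P V"
  shows "integrable P (\<lambda>z. V z * indicator (cell k j) (instrument z))"
  by (rule Bochner_Integration.integrable_bound[OF assms])
    (use assms in \<open>auto simp: indicator_def\<close>)

text \<open>
  Cauchy-Schwarz for \<open>V\<close> and the indicator of a cube, from the nonnegativity of
  \<open>E[(V - t)\<^sup>2; cube]\<close> at the cube average \<open>t\<close> of \<open>V\<close>.
\<close>

lemma cell_cauchy_schwarz:
  assumes V: "V \<in> borel_measurable P" "integrable P (\<lambda>z. (V z)\<^sup>2)" and v: "cell_prob P k j > 0"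
  shows "(\<integral>z. V z * indicator (cell k j) (instrument z) \<partial>P)\<^sup>2
    \<le> (\<integral>z. (V z)\<^sup>2 * indicator (cell k j) (instrument z) \<partial>P) * cell_prob P k j"
proof -
  let ?I = "\<lambda>z. indicator (cell k j) (instrument z) :: real"
  let ?v = "cell_prob P k j" and ?\<mu> = "\<integral>z. V z * ?I z \<partial>P" and ?s = "\<integral>z. (V z)\<^sup>2 * ?I z \<partial>P"
  have ints: "integrable P (\<lambda>z. V z * ?I z)" "integrable P (\<lambda>z. (V z)\<^sup>2 * ?I z)" "integrable P ?I"
    using integrable_times_cell[OF square_integrable_imp_integrable[OF V]]
      integrable_times_cell[OF V(2)] integrable_times_cell[of "\<lambda>_. 1"] by auto
  have "0 \<le> (\<integral>z. (V z - ?\<mu> / ?v)\<^sup>2 * ?I z \<partial>P)"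
    by (intro Bochner_Integration.integral_nonneg) auto
  also have "(\<lambda>z. (V z - ?\<mu> / ?v)\<^sup>2 * ?I z)
      = (\<lambda>z. (V z)\<^sup>2 * ?I z - 2 * (?\<mu> / ?v) * (V z * ?I z) + (?\<mu> / ?v)\<^sup>2 * ?I z)"
    by (auto simp: power2_diff algebra_simps)
  also have "(\<integral>z. \<dots> z \<partial>P) = ?s - 2 * (?\<mu> / ?v) * ?\<mu> + (?\<mu> / ?v)\<^sup>2 * ?v"
    using ints by (simp add: cell_prob_eq_integral)
  finally show ?thesis using v by (simp add: power2_eq_square field_simps)
qed

text \<open>
  Within one cube \<open>E[m\<^sup>2] - E[m]\<^sup>2/v\<close> is \<open>v\<close> times a conditional variance, hence at most \<open>v\<close>
  times the squared oscillation of \<open>m\<close>.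
\<close>

lemma cell_bias:
  assumes m: "m \<in> borel_measurable borel" and m2: "integrable P (\<lambda>z. (m (instrument z))\<^sup>2)"
    and v: "cell_prob P k j > 0"
    and osc: "\<And>w w'. w \<in> cell k j \<Longrightarrow> w' \<in> cell k j \<Longrightarrow> \<bar>m w - m w'\<bar> \<le> c"
  shows "\<bar>(\<integral>z. (m (instrument z))\<^sup>2 * indicator (cell k j) (instrument z) \<partial>P)
     - (\<integral>z. m (instrument z) * indicator (cell k j) (instrument z) \<partial>P)\<^sup>2 / cell_prob P k j\<bar>
     \<le> c\<^sup>2 * cell_prob P k j"
proof -
  note [measurable] = m
  let ?I = "\<lambda>z. indicator (cell k j) (instrument z) :: real"
  define v where "v = cell_prob P k j"
  define \<mu> where "\<mu> = (\<integral>z. m (instrument z) * ?I z \<partial>P)"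
  define s where "s = (\<integral>z. (m (instrument z))\<^sup>2 * ?I z \<partial>P)"
  have m1: "integrable P (\<lambda>z. m (instrument z))"
    by (rule square_integrable_imp_integrable[OF _ m2]) simp
  note ints = integrable_times_cell[OF m1, of k j] integrable_times_cell[OF m2, of k j]
  have I: "integrable P ?I"
    using integrable_times_cell[of "\<lambda>_. 1"] by simp
  have expand: "(\<lambda>z. (m (instrument z) - t)\<^sup>2 * ?I z) =
      (\<lambda>z. (m (instrument z))\<^sup>2 * ?I z - 2 * t * (m (instrument z) * ?I z) + t\<^sup>2 * ?I z)" for t
    by (auto simp: power2_diff algebra_simps)
  have centred: "(\<integral>z. (m (instrument z) - t)\<^sup>2 * ?I z \<partial>P) = s - 2 * t * \<mu> + t\<^sup>2 * v" for t
    unfolding expand s_def \<mu>_def v_def cell_prob_eq_integral using ints I by simp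
  have intc: "integrable P (\<lambda>z. (m (instrument z) - t)\<^sup>2 * ?I z)" for t
    unfolding expand using ints I by simp
  have vpos: "v > 0" using v by (simp add: v_def)
  have "\<mu>\<^sup>2 \<le> s * v"
    unfolding \<mu>_def s_def v_def by (rule cell_cauchy_schwarz[OF _ m2 v]) simp
  then have lower: "0 \<le> s - \<mu>\<^sup>2 / v" using vpos by (simp add: field_simps)
  \<comment> \<open>Centring at an arbitrary value of \<open>m\<close> in the cube bounds the variance from above.\<close>
  have "cell k j \<noteq> {}"
    using v by (auto simp: cell_prob_def)
  then obtain w0 where w0: "w0 \<in> cell k j" by auto
  have "(\<integral>z. (m (instrument z) - m w0)\<^sup>2 * ?I z \<partial>P) \<le> (\<integral>z. c\<^sup>2 * ?I z \<partial>P)"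
  proof (intro integral_mono intc)
    show "integrable P (\<lambda>z. c\<^sup>2 * ?I z)" using I by simp
    fix z
    have "(m (instrument z) - m w0)\<^sup>2 \<le> c\<^sup>2" if "instrument z \<in> cell k j"
      using osc[OF that w0] by (metis abs_ge_zero power2_abs power_mono)
    then show "(m (instrument z) - m w0)\<^sup>2 * ?I z \<le> c\<^sup>2 * ?I z"
      by (auto simp: indicator_def)
  qed
  then have "s - 2 * m w0 * \<mu> + (m w0)\<^sup>2 * v \<le> c\<^sup>2 * v"
    unfolding centred by (simp add: v_def cell_prob_eq_integral)
  moreover have "0 \<le> (\<mu> - m w0 * v)\<^sup>2 / v" using vpos by simp
  then have "0 \<le> \<mu>\<^sup>2 / v - 2 * m w0 * \<mu> + (m w0)\<^sup>2 * v"
    using vpos by (simp add: power2_diff power_mult_distrib field_simps power2_eq_square)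
  ultimately have "s - \<mu>\<^sup>2 / v \<le> c\<^sup>2 * v" by linarith
  with lower show ?thesis unfolding s_def \<mu>_def v_def by simp
qed

text \<open>
  Summing \<open>cell_bias\<close> over the cubes, whose probabilities add up to one: replacing \<open>E(V | W)\<close> by its
  cube averages changes the second moment by at most the square of the oscillation over a cube.
\<close>

lemma population_criterion_bias:
  assumes V: "V \<in> borel_measurable P" "integrable P (\<lambda>z. (V z)\<^sup>2)"
    and m: "m \<in> borel_measurable borel" "AE z in P. cond_W P V z = m (instrument z)"
    and lip: "\<And>w w'. w \<in> cbox 0 1 \<Longrightarrow> w' \<in> cbox 0 1 \<Longrightarrow> \<bar>m w - m w'\<bar> \<le> L * norm (w - w')"
    and L: "L \<ge> 0" and k: "k \<ge> 1"
    and part: "AE z in P. (\<Sum>j\<in>cell_indices k. indicator (cell k j) (instrument z)) = (1::real)"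
    and v: "\<And>j. j \<in> cell_indices k \<Longrightarrow> cell_prob P k j > 0"
  shows "\<bar>(\<integral>z. (cond_W P V z)\<^sup>2 \<partial>P)
     - (\<Sum>j\<in>cell_indices k. (\<integral>z. V z * indicator (cell k j) (instrument z) \<partial>P)\<^sup>2 / cell_prob P k j)\<bar>
     \<le> (L * (real CARD('d) / real k))\<^sup>2"
proof -
  note [measurable] = m(1) V(1)
  let ?I = "\<lambda>j z. indicator (cell k j) (instrument z) :: real"
  let ?c = "L * (real CARD('d) / real k)"
  have intV: "integrable P V" by (rule square_integrable_imp_integrable[OF V])
  have c2: "integrable P (\<lambda>z. (cond_W P V z)\<^sup>2)" by (rule cond_W_contraction(1)[OF V])
  have m2: "integrable P (\<lambda>z. (m (instrument z))\<^sup>2)"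
    by (rule integrable_cong_AE_imp[OF c2]) (use m(2) in auto)
  have "(\<integral>z. (cond_W P V z)\<^sup>2 \<partial>P) = (\<integral>z. (\<Sum>j\<in>cell_indices k. (m (instrument z))\<^sup>2 * ?I j z) \<partial>P)"
  proof (rule integral_cong_AE)
    show "AE z in P. (cond_W P V z)\<^sup>2 = (\<Sum>j\<in>cell_indices k. (m (instrument z))\<^sup>2 * ?I j z)"
      using m(2) part by eventually_elim (simp add: sum_distrib_left[symmetric])
  qed measurable
  also have "\<dots> = (\<Sum>j\<in>cell_indices k. \<integral>z. (m (instrument z))\<^sup>2 * ?I j z \<partial>P)"
    by (intro Bochner_Integration.integral_sum integrable_times_cell m2)
  finally have total: "(\<integral>z. (cond_W P V z)\<^sup>2 \<partial>P) = (\<Sum>j\<in>cell_indices k. \<integral>z. (m (instrument z))\<^sup>2 * ?I j z \<partial>P)" .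
  have mean: "(\<integral>z. V z * ?I j z \<partial>P) = (\<integral>z. m (instrument z) * ?I j z \<partial>P)" for j
  proof -
    have "(\<integral>z. V z * ?I j z \<partial>P) = (\<integral>z. cond_W P V z * ?I j z \<partial>P)"
      by (rule cond_W_integral_cell[OF intV]) simp
    also have "\<dots> = (\<integral>z. m (instrument z) * ?I j z \<partial>P)"
      by (rule integral_cong_AE) (use m(2) in auto)
    finally show ?thesis .
  qed
  have one: "(\<Sum>j\<in>cell_indices k. cell_prob P k j) = 1"
  proof -
    have I: "integrable P (?I j)" for j
      using integrable_times_cell[of "\<lambda>_. 1" k j] by simp
    have "(\<Sum>j\<in>cell_indices k. cell_prob P k j) = (\<integral>z. (\<Sum>j\<in>cell_indices k. ?I j z) \<partial>P)"
      unfolding cell_prob_eq_integral by (intro Bochner_Integration.integral_sum[symmetric] I)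
    also have "\<dots> = (\<integral>z. 1 \<partial>P)"
      by (rule integral_cong_AE) (use part in auto)
    finally show ?thesis using prob_space by simp
  qed
  have "\<bar>(\<integral>z. (cond_W P V z)\<^sup>2 \<partial>P) - (\<Sum>j\<in>cell_indices k. (\<integral>z. V z * ?I j z \<partial>P)\<^sup>2 / cell_prob P k j)\<bar>
     \<le> (\<Sum>j\<in>cell_indices k. \<bar>(\<integral>z. (m (instrument z))\<^sup>2 * ?I j z \<partial>P)
         - (\<integral>z. m (instrument z) * ?I j z \<partial>P)\<^sup>2 / cell_prob P k j\<bar>)"
    unfolding total mean sum_subtractf[symmetric] by (rule sum_abs)
  also have "\<dots> \<le> (\<Sum>j\<in>cell_indices k. ?c\<^sup>2 * cell_prob P k j)"
  proof (intro sum_mono cell_bias m(1) m2 v)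
    fix j :: "'d \<Rightarrow> nat" and w w'
    assume j: "j \<in> cell_indices k" and w: "w \<in> cell k j" "w' \<in> cell k j"
    have "\<bar>m w - m w'\<bar> \<le> L * norm (w - w')"
      using lip w cell_subset_unit_cube[OF k j] by blast
    also have "\<dots> \<le> ?c" using cell_diameter[OF k w] L by (intro mult_left_mono)
    finally show "\<bar>m w - m w'\<bar> \<le> ?c" .
  qed
  also have "\<dots> = ?c\<^sup>2" by (simp add: sum_distrib_left[symmetric] one)
  finally show ?thesis .
qed

end

section \<open>Uniform deviation of the sample criterion\<close>

text \<open>
  With \<open>V = 1\<close> this is the empirical cube frequency, with \<open>V = Y - g(X)\<close> the numerator in the sample
  criterion; a common form lets one variance bound serve both.
\<close>

definition cell_mean ::
  "nat \<Rightarrow> nat \<Rightarrow> (nat \<Rightarrow> ('x::euclidean_space, 'd::finite) obs) \<Rightarrow> (('x, 'd) obs \<Rightarrow> real) \<Rightarrow> ('d \<Rightarrow> nat) \<Rightarrow> real" where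
  "cell_mean n k z V j = (1 / real n) * (\<Sum>i<n. V (z i) * indicator (cell k j) (instrument (z i)))"

lemma v_hat_eq_cell_mean: "v_hat n k z j = cell_mean n k z (\<lambda>_. 1) j"
  by (simp add: v_hat_def cell_mean_def)

lemma G_bar_eq_cell_mean:
  "G_bar n k z g = (\<Sum>j\<in>cell_indices k.
     (cell_mean n k z (\<lambda>u. outcome u - g (regressor u)) j)\<^sup>2 * inverse (v_hat n k z j))"
  by (simp add: G_bar_def cell_mean_def)

lemma cell_mean_sum:
  "cell_mean n k z (\<lambda>u. \<Sum>a\<in>A. c a * \<psi> a u) j = (\<Sum>a\<in>A. c a * cell_mean n k z (\<psi> a) j)"
proof -
  have "(\<Sum>i<n. (\<Sum>a\<in>A. c a * \<psi> a (z i)) * indicator (cell k j) (instrument (z i)))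
      = (\<Sum>a\<in>A. \<Sum>i<n. c a * (\<psi> a (z i) * indicator (cell k j) (instrument (z i))))"
    by (subst sum.swap) (simp add: sum_distrib_right mult.assoc)
  then show ?thesis
    unfolding cell_mean_def by (simp only: sum_distrib_left mult.left_commute)
qed

lemma v_hat_nonneg: "v_hat n k z j \<ge> 0"
  by (simp add: v_hat_def sum_nonneg)

lemma G_bar_nonneg: "G_bar n k z g \<ge> 0"
  unfolding G_bar_def by (intro sum_nonneg mult_nonneg_nonneg) (auto simp: v_hat_nonneg)

text \<open>
  The effect on \<open>\<mu>\<^sup>2/v\<close> of errors \<open>x\<close> in \<open>\<mu>\<close> and \<open>y\<close> in \<open>v\<close>. The condition
  \<open>|\<mu>| \<le> K v\<close> reflects that \<open>\<mu>\<close> is an integral over a set of mass \<open>v\<close>; it makes the first-order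
  contributions \<open>x\<close> and \<open>y\<close> appear without a factor \<open>1/v\<close>.
\<close>

lemma self_normalised_square_perturbation:
  fixes v :: real
  assumes v: "v > 0" and vh: "vh \<ge> v / 2" and x: "\<bar>mh - \<mu>\<bar> \<le> x" and K: "\<bar>\<mu>\<bar> \<le> K * v"
    and y: "\<bar>vh - v\<bar> \<le> y" and K0: "K \<ge> 0"
  shows "\<bar>mh\<^sup>2 * inverse vh - \<mu>\<^sup>2 / v\<bar> \<le> 2 * x\<^sup>2 / v + 4 * K * x + 2 * K\<^sup>2 * y"
proof -
  have vh0: "vh > 0" using v vh by linarith
  have inv: "inverse vh \<le> 2 / v"
    using v vh vh0 by (simp add: field_simps)
  have x0: "x \<ge> 0" using x by linarith
  have "mh\<^sup>2 - \<mu>\<^sup>2 = (mh - \<mu>)\<^sup>2 + 2 * \<mu> * (mh - \<mu>)"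
    by (simp add: power2_eq_square algebra_simps)
  then have "\<bar>mh\<^sup>2 - \<mu>\<^sup>2\<bar> \<le> \<bar>mh - \<mu>\<bar>\<^sup>2 + 2 * \<bar>\<mu>\<bar> * \<bar>mh - \<mu>\<bar>"
    using abs_triangle_ineq[of "(mh - \<mu>)\<^sup>2" "2 * \<mu> * (mh - \<mu>)"] by (simp add: abs_mult)
  also have "\<dots> \<le> x\<^sup>2 + 2 * (K * v) * x"
    using x K x0 K0 v by (intro add_mono mult_mono power_mono) auto
  finally have a: "\<bar>mh\<^sup>2 - \<mu>\<^sup>2\<bar> * inverse vh \<le> (x\<^sup>2 + 2 * (K * v) * x) * (2 / v)"
    using inv vh0 x0 K0 v by (intro mult_mono) auto
  have "inverse vh - 1 / v = (v - vh) / v * inverse vh"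
    using v vh0 by (simp add: field_simps)
  then have "\<bar>inverse vh - 1 / v\<bar> = \<bar>vh - v\<bar> / v * inverse vh"
    using v vh0 by (simp add: abs_mult abs_minus_commute)
  also have "\<dots> \<le> y / v * (2 / v)"
    using inv v y vh0 by (intro mult_mono divide_right_mono) auto
  finally have "\<mu>\<^sup>2 * \<bar>inverse vh - 1 / v\<bar> \<le> (K * v)\<^sup>2 * (y / v * (2 / v))"
    using power_mono[OF K, of 2] by (intro mult_mono) auto
  then have b: "\<mu>\<^sup>2 * \<bar>inverse vh - 1 / v\<bar> \<le> 2 * K\<^sup>2 * y"
    using v by (simp add: power2_eq_square field_simps)
  have "mh\<^sup>2 * inverse vh - \<mu>\<^sup>2 / v = (mh\<^sup>2 - \<mu>\<^sup>2) * inverse vh + \<mu>\<^sup>2 * (inverse vh - 1 / v)"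
    by (simp add: algebra_simps)
  then have "\<bar>mh\<^sup>2 * inverse vh - \<mu>\<^sup>2 / v\<bar> \<le> \<bar>mh\<^sup>2 - \<mu>\<^sup>2\<bar> * inverse vh + \<mu>\<^sup>2 * \<bar>inverse vh - 1 / v\<bar>"
    using abs_triangle_ineq[of "(mh\<^sup>2 - \<mu>\<^sup>2) * inverse vh" "\<mu>\<^sup>2 * (inverse vh - 1 / v)"] vh0
    by (simp add: abs_mult)
  also have "\<dots> \<le> (x\<^sup>2 + 2 * (K * v) * x) * (2 / v) + 2 * K\<^sup>2 * y" using a b by linarith
  also have "\<dots> = 2 * x\<^sup>2 / v + 4 * K * x + 2 * K\<^sup>2 * y" using v by (simp add: field_simps)
  finally show ?thesis .
qed

context observation_law begin

definition cell_deviation where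
  "cell_deviation n k z V j = \<bar>cell_mean n k z V j - (\<integral>u. V u * indicator (cell k j) (instrument u) \<partial>P)\<bar>"

text \<open>
  The bound of \<open>self_normalised_square_perturbation\<close> summed over the cubes, for coefficients of
  modulus at most one: the deviations of the \<open>q + 1\<close> regressands are added up, and
  \<open>K = (q + 1) \<surd>C\<close>. A radius \<open>R\<close> of the coefficients only contributes a factor \<open>R\<^sup>2\<close>.
\<close>

definition fluctuation where
  "fluctuation n k q C z \<psi> = (\<Sum>j\<in>cell_indices k.
      2 * (\<Sum>a\<le>q. cell_deviation n k z (\<psi> a) j)\<^sup>2 / cell_prob P k j
      + 4 * (real (q + 1) * sqrt C) * (\<Sum>a\<le>q. cell_deviation n k z (\<psi> a) j)
      + 2 * (real (q + 1) * sqrt C)\<^sup>2 * cell_deviation n k z (\<lambda>_. 1) j)"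

text \<open>
  The right-hand side depends on the coefficients through their maximal modulus \<open>R\<close> alone. Uniformity
  over the cube \<open>{c. |c\<^sub>a| \<le> R}\<close> is thus a consequence of linearity of the residual in \<open>c\<close>, and no
  covering argument is involved.
\<close>

lemma uniform_criterion_bound:
  fixes \<psi> :: "nat \<Rightarrow> ('x, 'd) obs \<Rightarrow> real"
  assumes \<psi>: "\<And>a. a \<le> q \<Longrightarrow> \<psi> a \<in> borel_measurable P" "\<And>a. a \<le> q \<Longrightarrow> integrable P (\<lambda>u. (\<psi> a u)\<^sup>2)"
    and second: "\<And>a j. a \<le> q \<Longrightarrow> j \<in> cell_indices k \<Longrightarrow>
        (\<integral>u. (\<psi> a u)\<^sup>2 * indicator (cell k j) (instrument u) \<partial>P) \<le> C * cell_prob P k j"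
    and m: "\<And>a. a \<le> q \<Longrightarrow> regression_on_W P (\<psi> a) (m a)"
    and lip: "\<And>a w w'. a \<le> q \<Longrightarrow> w \<in> cbox 0 1 \<Longrightarrow> w' \<in> cbox 0 1 \<Longrightarrow> \<bar>m a w - m a w'\<bar> \<le> L * norm (w - w')"
    and L: "L \<ge> 0" and C: "C \<ge> 0" and k: "k \<ge> 1"
    and part: "AE z in P. (\<Sum>j\<in>cell_indices k. indicator (cell k j) (instrument z)) = (1::real)"
    and v: "\<And>j. j \<in> cell_indices k \<Longrightarrow> cell_prob P k j > 0"
    and vh: "\<And>j. j \<in> cell_indices k \<Longrightarrow> v_hat n k z j \<ge> cell_prob P k j / 2"
    and c: "\<And>a. a \<le> q \<Longrightarrow> \<bar>c a\<bar> \<le> R"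
  shows "\<bar>(\<Sum>j\<in>cell_indices k. (cell_mean n k z (\<lambda>u. \<Sum>a\<le>q. c a * \<psi> a u) j)\<^sup>2 * inverse (v_hat n k z j))
      - (\<integral>u. (cond_W P (\<lambda>u. \<Sum>a\<le>q. c a * \<psi> a u) u)\<^sup>2 \<partial>P)\<bar>
      \<le> R\<^sup>2 * (fluctuation n k q C z \<psi> + (real (q + 1) * L * (real CARD('d) / real k))\<^sup>2)"
proof -
  define V where "V = (\<lambda>u. \<Sum>a\<le>q. c a * \<psi> a u)"
  define mm where "mm w = (\<Sum>a\<le>q. c a * m a w)" for w
  let ?I = "\<lambda>j u. indicator (cell k j) (instrument u) :: real"
  let ?\<mu> = "\<lambda>V j. \<integral>u. V u * ?I j u \<partial>P"
  let ?S = "\<lambda>j. \<Sum>a\<le>q. cell_deviation n k z (\<psi> a) j"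
  let ?Q = "real (q + 1)"
  have R0: "R \<ge> 0" using c[of 0] by force
  have V: "V \<in> borel_measurable P" "integrable P (\<lambda>u. (V u)\<^sup>2)"
    using square_integrable_sum[of "{..q}" \<psi> c] \<psi> unfolding V_def by auto
  have mean_V: "?\<mu> V j = (\<Sum>a\<le>q. c a * ?\<mu> (\<psi> a) j)" for j
  proof -
    have int: "integrable P (\<lambda>u. \<psi> a u * ?I j u)" if "a \<le> q" for a
      by (rule integrable_times_cell[OF square_integrable_imp_integrable[OF \<psi>[OF that]]])
    have "?\<mu> V j = (\<integral>u. (\<Sum>a\<le>q. c a * (\<psi> a u * ?I j u)) \<partial>P)"
      unfolding V_def by (simp add: sum_distrib_right mult.assoc)
    also have "\<dots> = (\<Sum>a\<le>q. c a * ?\<mu> (\<psi> a) j)"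
      using int by (subst Bochner_Integration.integral_sum) auto
    finally show ?thesis .
  qed
  have per_cell: "\<bar>(cell_mean n k z V j)\<^sup>2 * inverse (v_hat n k z j) - (?\<mu> V j)\<^sup>2 / cell_prob P k j\<bar>
      \<le> R\<^sup>2 * (2 * (?S j)\<^sup>2 / cell_prob P k j + 4 * (?Q * sqrt C) * ?S j
          + 2 * (?Q * sqrt C)\<^sup>2 * cell_deviation n k z (\<lambda>_. 1) j)"
    if j: "j \<in> cell_indices k" for j
  proof -
    have vj: "cell_prob P k j > 0" by (rule v[OF j])
    have \<mu>a: "\<bar>?\<mu> (\<psi> a) j\<bar> \<le> sqrt C * cell_prob P k j" if a: "a \<le> q" for a
    proof -
      have "(?\<mu> (\<psi> a) j)\<^sup>2 \<le> (C * cell_prob P k j) * cell_prob P k j"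
        using cell_cauchy_schwarz[OF \<psi>[OF a] vj] mult_right_mono[OF second[OF a j], of "cell_prob P k j"] vj
        by linarith
      also have "\<dots> = (sqrt C * cell_prob P k j)\<^sup>2" using C by (simp add: power2_eq_square)
      finally show ?thesis
        using C vj abs_le_square_iff[of "?\<mu> (\<psi> a) j" "sqrt C * cell_prob P k j"]
        by (simp add: abs_mult)
    qed
    have x: "\<bar>cell_mean n k z V j - ?\<mu> V j\<bar> \<le> R * ?S j"
    proof -
      have "\<bar>cell_mean n k z V j - ?\<mu> V j\<bar> = \<bar>\<Sum>a\<le>q. c a * (cell_mean n k z (\<psi> a) j - ?\<mu> (\<psi> a) j)\<bar>"
        unfolding mean_V unfolding V_def cell_mean_sum by (simp add: sum_subtractf algebra_simps)
      also have "\<dots> \<le> (\<Sum>a\<le>q. R * cell_deviation n k z (\<psi> a) j)"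
        by (intro order_trans[OF sum_abs] sum_mono)
          (simp only: abs_mult cell_deviation_def, intro mult_right_mono c, auto)
      finally show ?thesis by (simp add: sum_distrib_left)
    qed
    have "\<bar>?\<mu> V j\<bar> \<le> (\<Sum>a\<le>q. R * (sqrt C * cell_prob P k j))"
      unfolding mean_V using \<mu>a R0
      by (intro order_trans[OF sum_abs] sum_mono)
        (simp only: abs_mult, intro mult_mono c, auto)
    then have K: "\<bar>?\<mu> V j\<bar> \<le> (R * (?Q * sqrt C)) * cell_prob P k j"
      by (simp add: algebra_simps)
    have y: "\<bar>v_hat n k z j - cell_prob P k j\<bar> \<le> cell_deviation n k z (\<lambda>_. 1) j"
      by (simp add: cell_deviation_def v_hat_eq_cell_mean cell_prob_eq_integral)
    have "\<bar>(cell_mean n k z V j)\<^sup>2 * inverse (v_hat n k z j) - (?\<mu> V j)\<^sup>2 / cell_prob P k j\<bar>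
        \<le> 2 * (R * ?S j)\<^sup>2 / cell_prob P k j + 4 * (R * (?Q * sqrt C)) * (R * ?S j)
          + 2 * (R * (?Q * sqrt C))\<^sup>2 * cell_deviation n k z (\<lambda>_. 1) j"
      by (rule self_normalised_square_perturbation[OF vj vh[OF j] x K y]) (use R0 C in auto)
    also have "\<dots> = R\<^sup>2 * (2 * (?S j)\<^sup>2 / cell_prob P k j + 4 * (?Q * sqrt C) * ?S j
          + 2 * (?Q * sqrt C)\<^sup>2 * cell_deviation n k z (\<lambda>_. 1) j)"
      by (simp add: power2_eq_square algebra_simps)
    finally show ?thesis .
  qed
  have "\<bar>(\<Sum>j\<in>cell_indices k. (cell_mean n k z V j)\<^sup>2 * inverse (v_hat n k z j))
      - (\<Sum>j\<in>cell_indices k. (?\<mu> V j)\<^sup>2 / cell_prob P k j)\<bar> \<le> R\<^sup>2 * fluctuation n k q C z \<psi>"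
    unfolding sum_subtractf[symmetric] fluctuation_def sum_distrib_left
    by (intro order_trans[OF sum_abs] sum_mono) (use per_cell in \<open>simp only: sum_distrib_left\<close>)
  moreover have "\<bar>(\<integral>u. (cond_W P V u)\<^sup>2 \<partial>P) - (\<Sum>j\<in>cell_indices k. (?\<mu> V j)\<^sup>2 / cell_prob P k j)\<bar>
      \<le> ((R * (?Q * L)) * (real CARD('d) / real k))\<^sup>2"
  proof (rule population_criterion_bias[OF V _ _ _ _ k part v, where m = mm])
    show "mm \<in> borel_measurable borel"
      unfolding mm_def[abs_def] using m
      by (intro borel_measurable_sum borel_measurable_times borel_measurable_const)
        (simp add: regression_on_W_def)
    show "AE z in P. cond_W P V z = mm (instrument z)"
      using cond_W_sum[of "{..q}" \<psi> m c] m unfolding V_def mm_def by auto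
    show "0 \<le> R * (?Q * L)" using R0 L by simp
    fix w w' :: "(real, 'd) vec" assume w: "w \<in> cbox 0 1" "w' \<in> cbox 0 1"
    have "\<bar>mm w - mm w'\<bar> = \<bar>\<Sum>a\<le>q. c a * (m a w - m a w')\<bar>"
      by (simp add: mm_def sum_subtractf algebra_simps)
    also have "\<dots> \<le> (\<Sum>a\<le>q. R * (L * norm (w - w')))"
      using R0 w by (intro order_trans[OF sum_abs] sum_mono)
        (simp only: abs_mult, intro mult_mono c lip, auto)
    finally show "\<bar>mm w - mm w'\<bar> \<le> R * (?Q * L) * norm (w - w')" by (simp add: algebra_simps)
  qed
  ultimately have "\<bar>(\<Sum>j\<in>cell_indices k. (cell_mean n k z V j)\<^sup>2 * inverse (v_hat n k z j))
      - (\<integral>u. (cond_W P V u)\<^sup>2 \<partial>P)\<bar>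
      \<le> R\<^sup>2 * fluctuation n k q C z \<psi> + ((R * (?Q * L)) * (real CARD('d) / real k))\<^sup>2"
    by linarith
  also have "\<dots> = R\<^sup>2 * (fluctuation n k q C z \<psi> + (?Q * L * (real CARD('d) / real k))\<^sup>2)"
    by (simp only: power_mult_distrib distrib_left mult.assoc)
  finally show ?thesis unfolding V_def .
qed

end

locale iid_observations = observation_law P + sample: prob_space M
  for P :: "('x::euclidean_space, 'd::finite) obs measure" and M :: "'o measure" +
  fixes Z :: "nat \<Rightarrow> 'o \<Rightarrow> ('x, 'd) obs"
  assumes indep: "sample.indep_vars (\<lambda>_. borel) Z UNIV"
    and identically_distributed: "distr M borel (Z i) = P"
begin

lemma Z_measurable [measurable]: "Z i \<in> measurable M borel"
  using indep unfolding sample.indep_vars_def by auto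

lemma transfer_integrable:
  fixes V :: "('x, 'd) obs \<Rightarrow> real"
  assumes "V \<in> borel_measurable borel"
  shows "integrable M (\<lambda>\<omega>. V (Z i \<omega>)) \<longleftrightarrow> integrable P V"
  using integrable_distr_eq[OF Z_measurable assms, of i] by (simp add: identically_distributed)

lemma transfer_integral:
  fixes V :: "('x, 'd) obs \<Rightarrow> real"
  assumes "V \<in> borel_measurable borel"
  shows "(\<integral>\<omega>. V (Z i \<omega>) \<partial>M) = (\<integral>u. V u \<partial>P)"
  using integral_distr[OF Z_measurable assms, of i] by (simp add: identically_distributed)

text \<open>
  The variance of a mean of \<open>n\<close> independent terms: the cross terms of the centred summands vanish.
\<close>

lemma sample_mean_square_error:
  fixes V :: "('x, 'd) obs \<Rightarrow> real"
  assumes V: "V \<in> borel_measurable borel" "integrable P (\<lambda>u. (V u)\<^sup>2)" and n: "n \<ge> 1"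
  defines "err \<equiv> (\<lambda>\<omega>. (1 / real n) * (\<Sum>i<n. V (Z i \<omega>)) - (\<integral>u. V u \<partial>P))"
  shows "integrable M (\<lambda>\<omega>. (err \<omega>)\<^sup>2)"
    and "(\<integral>\<omega>. (err \<omega>)\<^sup>2 \<partial>M) \<le> (\<integral>u. (V u)\<^sup>2 \<partial>P) / real n"
proof -
  define \<mu> where "\<mu> = (\<integral>u. V u \<partial>P)"
  define \<xi> where "\<xi> i \<omega> = V (Z i \<omega>) - \<mu>" for i \<omega>
  note [measurable] = V(1)
  have VP: "V \<in> borel_measurable P" by measurable
  have intV: "integrable P V" by (rule square_integrable_imp_integrable[OF VP V(2)])
  have int: "integrable M (\<xi> i)" for i
    unfolding \<xi>_def[abs_def] using intV transfer_integrable[OF V(1)] by auto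
  have mean: "(\<integral>\<omega>. \<xi> i \<omega> \<partial>M) = 0" for i
    unfolding \<xi>_def using intV transfer_integrable[OF V(1)] transfer_integral[OF V(1)] sample.prob_space
    by (simp add: \<mu>_def)
  have Vc: "integrable P (\<lambda>u. (V u - \<mu>)\<^sup>2)"
    using V intV by (simp add: power2_diff)
  have sq_int: "integrable M (\<lambda>\<omega>. (\<xi> i \<omega>)\<^sup>2)" for i
    unfolding \<xi>_def using transfer_integrable[of "\<lambda>u. (V u - \<mu>)\<^sup>2" i] Vc by simp
  have sq: "(\<integral>\<omega>. (\<xi> i \<omega>)\<^sup>2 \<partial>M) \<le> (\<integral>u. (V u)\<^sup>2 \<partial>P)" for i
  proof -
    have "(\<integral>\<omega>. (\<xi> i \<omega>)\<^sup>2 \<partial>M) = (\<integral>u. (V u - \<mu>)\<^sup>2 \<partial>P)"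
      unfolding \<xi>_def by (rule transfer_integral) simp
    also have "\<dots> = (\<integral>u. (V u)\<^sup>2 \<partial>P) - \<mu>\<^sup>2"
      unfolding \<mu>_def by (rule variance_eq[OF intV V(2)])
    finally show ?thesis by simp
  qed
  have ind: "sample.indep_vars (\<lambda>_. borel) \<xi> UNIV"
    unfolding \<xi>_def[abs_def] by (rule sample.indep_vars_compose2[OF indep]) simp
  have cross: "integrable M (\<lambda>\<omega>. \<xi> i \<omega> * \<xi> j \<omega>) \<and> (\<integral>\<omega>. \<xi> i \<omega> * \<xi> j \<omega> \<partial>M) = 0" if "i \<noteq> j" for i j
  proof -
    have ij: "sample.indep_vars (\<lambda>_. borel) \<xi> {i, j}"
      by (rule sample.indep_vars_subset[OF ind]) simp
    show ?thesis
      using sample.indep_vars_integrable[OF _ ij] sample.indep_vars_lebesgue_integral[OF _ ij] int that mean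
      by simp
  qed
  have prod_int: "integrable M (\<lambda>\<omega>. \<xi> i \<omega> * \<xi> j \<omega>)" for i j
    using cross[of i j] sq_int[of i] by (cases "i = j") (auto simp: power2_eq_square)
  have err: "err \<omega> = (1 / real n) * (\<Sum>i<n. \<xi> i \<omega>)" for \<omega>
    using n by (simp add: err_def \<xi>_def \<mu>_def sum_subtractf field_simps)
  have err2: "(err \<omega>)\<^sup>2 = (1 / (real n)\<^sup>2) * (\<Sum>i<n. \<Sum>j<n. \<xi> i \<omega> * \<xi> j \<omega>)" for \<omega>
    unfolding err power_mult_distrib by (simp add: power2_eq_square sum_product)
  show "integrable M (\<lambda>\<omega>. (err \<omega>)\<^sup>2)"
    unfolding err2 using prod_int by auto
  have "(\<integral>\<omega>. (err \<omega>)\<^sup>2 \<partial>M) = (1 / (real n)\<^sup>2) * (\<Sum>i<n. \<Sum>j<n. \<integral>\<omega>. \<xi> i \<omega> * \<xi> j \<omega> \<partial>M)"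
    unfolding err2 using prod_int by simp
  also have "(\<Sum>i<n. \<Sum>j<n. \<integral>\<omega>. \<xi> i \<omega> * \<xi> j \<omega> \<partial>M) = (\<Sum>i<n. \<Sum>j<n. if i = j then \<integral>\<omega>. (\<xi> i \<omega>)\<^sup>2 \<partial>M else 0)"
    using cross by (intro sum.cong refl) (auto simp: power2_eq_square)
  also have "\<dots> = (\<Sum>i<n. \<integral>\<omega>. (\<xi> i \<omega>)\<^sup>2 \<partial>M)" by simp
  also have "(1 / (real n)\<^sup>2) * \<dots> \<le> (1 / (real n)\<^sup>2) * (\<Sum>i<n. \<integral>u. (V u)\<^sup>2 \<partial>P)"
    using sq by (intro mult_left_mono sum_mono) auto
  also have "\<dots> = (\<integral>u. (V u)\<^sup>2 \<partial>P) / real n" using n by (simp add: power2_eq_square)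
  finally show "(\<integral>\<omega>. (err \<omega>)\<^sup>2 \<partial>M) \<le> (\<integral>u. (V u)\<^sup>2 \<partial>P) / real n" .
qed

text \<open>
  The second moment localised to the cube, rather than \<open>E(V\<^sup>2)\<close>, controls the error, so that a cube of
  small probability has a small deviation.
\<close>

lemma cell_deviation_moments:
  fixes V :: "('x, 'd) obs \<Rightarrow> real"
  assumes V: "V \<in> borel_measurable borel" "integrable P (\<lambda>u. (V u)\<^sup>2)" and n: "n \<ge> 1"
    and second: "(\<integral>u. (V u)\<^sup>2 * indicator (cell k j) (instrument u) \<partial>P) \<le> s"
  shows "integrable M (\<lambda>\<omega>. (cell_deviation n k (\<lambda>i. Z i \<omega>) V j)\<^sup>2)"
    and "(\<integral>\<omega>. (cell_deviation n k (\<lambda>i. Z i \<omega>) V j)\<^sup>2 \<partial>M) \<le> s / real n"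
    and "integrable M (\<lambda>\<omega>. cell_deviation n k (\<lambda>i. Z i \<omega>) V j)"
    and "(\<integral>\<omega>. cell_deviation n k (\<lambda>i. Z i \<omega>) V j \<partial>M) \<le> sqrt (s / real n)"
proof -
  note [measurable] = V(1)
  let ?U = "\<lambda>u. V u * indicator (cell k j) (instrument u) :: real"
  let ?D = "\<lambda>\<omega>. cell_deviation n k (\<lambda>i. Z i \<omega>) V j"
  have U2: "(?U u)\<^sup>2 = (V u)\<^sup>2 * indicator (cell k j) (instrument u)" for u
    by (simp add: power_mult_distrib indicator_def)
  have intU: "integrable P (\<lambda>u. (?U u)\<^sup>2)"
    unfolding U2 by (rule integrable_times_cell[OF V(2)])
  note mse = sample_mean_square_error[of ?U n, OF _ intU n]
  have D2: "(?D \<omega>)\<^sup>2 = ((1 / real n) * (\<Sum>i<n. ?U (Z i \<omega>)) - (\<integral>u. ?U u \<partial>P))\<^sup>2" for \<omega>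
    by (simp add: cell_deviation_def cell_mean_def)
  show i2: "integrable M (\<lambda>\<omega>. (?D \<omega>)\<^sup>2)"
    unfolding D2 by (rule mse(1)) simp
  have "(\<integral>\<omega>. (?D \<omega>)\<^sup>2 \<partial>M) \<le> (\<integral>u. (?U u)\<^sup>2 \<partial>P) / real n"
    unfolding D2 by (rule mse(2)) simp
  also have "\<dots> \<le> s / real n"
    unfolding U2 by (intro divide_right_mono second) simp
  finally show e2: "(\<integral>\<omega>. (?D \<omega>)\<^sup>2 \<partial>M) \<le> s / real n" .
  have meas: "?D \<in> borel_measurable M"
    unfolding cell_deviation_def cell_mean_def by measurable
  show i1: "integrable M ?D"
    by (rule sample.square_integrable_imp_integrable[OF meas i2])
  have "(\<integral>\<omega>. ?D \<omega> \<partial>M)\<^sup>2 \<le> (\<integral>\<omega>. (?D \<omega>)\<^sup>2 \<partial>M)"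
    using sample.variance_eq[OF i1 i2] sample.variance_positive[of ?D] by simp
  with e2 have "(\<integral>\<omega>. ?D \<omega> \<partial>M)\<^sup>2 \<le> s / real n" by linarith
  then show "(\<integral>\<omega>. ?D \<omega> \<partial>M) \<le> sqrt (s / real n)"
    by (rule real_le_rsqrt)
qed

text \<open>
  In each cube the expected deviations are at most \<open>\<surd>(C v/n)\<close> with \<open>v \<le> 1\<close>, and the quadratic term is
  of order \<open>C/n\<close> after division by \<open>v\<close>; there are \<open>k\<^sup>d\<close> cubes.
\<close>

lemma fluctuation_expectation:
  fixes \<psi> :: "nat \<Rightarrow> ('x, 'd) obs \<Rightarrow> real"
  assumes \<psi>: "\<And>a. a \<le> q \<Longrightarrow> \<psi> a \<in> borel_measurable borel" "\<And>a. a \<le> q \<Longrightarrow> integrable P (\<lambda>u. (\<psi> a u)\<^sup>2)"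
    and second: "\<And>a j. a \<le> q \<Longrightarrow> j \<in> cell_indices k \<Longrightarrow>
        (\<integral>u. (\<psi> a u)\<^sup>2 * indicator (cell k j) (instrument u) \<partial>P) \<le> C * cell_prob P k j"
    and C: "C \<ge> 0" and n: "n \<ge> 1"
    and v: "\<And>j. j \<in> cell_indices k \<Longrightarrow> cell_prob P k j > 0"
  shows "integrable M (\<lambda>\<omega>. fluctuation n k q C (\<lambda>i. Z i \<omega>) \<psi>)"
    and "(\<integral>\<omega>. fluctuation n k q C (\<lambda>i. Z i \<omega>) \<psi> \<partial>M)
          \<le> 8 * C * (real (q + 1))\<^sup>2 * (real k ^ CARD('d) / sqrt (real n))"
proof -
  let ?D = "\<lambda>a j \<omega>. cell_deviation n k (\<lambda>i. Z i \<omega>) (\<psi> a) j"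
  let ?D1 = "\<lambda>j \<omega>. cell_deviation n k (\<lambda>i. Z i \<omega>) (\<lambda>_. 1) j"
  let ?S = "\<lambda>j \<omega>. \<Sum>a\<le>q. ?D a j \<omega>"
  let ?Q = "real (q + 1)"
  let ?F = "\<lambda>j \<omega>. 2 * (?S j \<omega>)\<^sup>2 / cell_prob P k j + 4 * (?Q * sqrt C) * ?S j \<omega> + 2 * (?Q * sqrt C)\<^sup>2 * ?D1 j \<omega>"
  have cell: "integrable M (?F j) \<and> (\<integral>\<omega>. ?F j \<omega> \<partial>M) \<le> 8 * C * ?Q\<^sup>2 / sqrt (real n)"
    if j: "j \<in> cell_indices k" for j
  proof -
    let ?v = "cell_prob P k j"
    have v0: "?v > 0" and v1: "?v \<le> 1" using v[OF j] by (auto simp: cell_prob_def)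
    note dev = cell_deviation_moments[OF \<psi>(1) \<psi>(2) n second[OF _ j]]
    have one: "(\<integral>u. (1::real)\<^sup>2 * indicator (cell k j) (instrument u) \<partial>P) \<le> ?v"
      by (simp add: cell_prob_eq_integral)
    note dev1 = cell_deviation_moments(3,4)[of "\<lambda>_. 1", OF _ _ n one]
    have i1: "integrable M (?S j)" using dev(3) by auto
    have meas: "?S j \<in> borel_measurable M" using i1 by simp
    have CS: "(?S j \<omega>)\<^sup>2 \<le> ?Q * (\<Sum>a\<le>q. (?D a j \<omega>)\<^sup>2)" for \<omega>
      using sum_squared_le_sum_of_squares[of "\<lambda>a. ?D a j \<omega>" "{..q}"] by (simp add: mult.commute)
    have ibound: "integrable M (\<lambda>\<omega>. ?Q * (\<Sum>a\<le>q. (?D a j \<omega>)\<^sup>2))"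
      using dev(1) by auto
    have i2: "integrable M (\<lambda>\<omega>. (?S j \<omega>)\<^sup>2)"
      by (rule Bochner_Integration.integrable_bound[OF ibound]) (use meas in \<open>auto intro!: AE_I2 order_trans[OF CS] simp del: of_nat_add of_nat_Suc\<close>)
    have e2: "(\<integral>\<omega>. (?S j \<omega>)\<^sup>2 \<partial>M) \<le> ?Q\<^sup>2 * (C * ?v / real n)"
    proof -
      have "(\<integral>\<omega>. (?S j \<omega>)\<^sup>2 \<partial>M) \<le> (\<integral>\<omega>. ?Q * (\<Sum>a\<le>q. (?D a j \<omega>)\<^sup>2) \<partial>M)"
        by (intro integral_mono i2 ibound CS)
      also have "\<dots> = ?Q * (\<Sum>a\<le>q. \<integral>\<omega>. (?D a j \<omega>)\<^sup>2 \<partial>M)"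
        using dev(1) by simp
      also have "\<dots> \<le> ?Q * (\<Sum>a\<le>q. C * ?v / real n)"
        using dev(2) by (intro mult_left_mono sum_mono) auto
      finally show ?thesis by (simp add: power2_eq_square mult.assoc)
    qed
    have root: "sqrt (s * ?v / real n) \<le> sqrt s / sqrt (real n)" if "s \<ge> 0" for s
      using that v1 v0 by (auto simp: real_sqrt_divide real_sqrt_mult mult_left_le intro!: divide_right_mono)
    have e1: "(\<integral>\<omega>. ?S j \<omega> \<partial>M) \<le> ?Q * (sqrt C / sqrt (real n))"
    proof -
      have "(\<integral>\<omega>. ?S j \<omega> \<partial>M) = (\<Sum>a\<le>q. \<integral>\<omega>. ?D a j \<omega> \<partial>M)"
        using dev(3) by simp
      also have "\<dots> \<le> (\<Sum>a\<le>q. sqrt C / sqrt (real n))"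
        using dev(4) root[OF C] by (intro sum_mono) (auto intro: order_trans)
      finally show ?thesis by (simp add: algebra_simps)
    qed
    have e3: "(\<integral>\<omega>. ?D1 j \<omega> \<partial>M) \<le> 1 / sqrt (real n)"
      using dev1(2) root[of 1] by auto
    have i3: "integrable M (?D1 j)" by (rule dev1(1)) auto
    have "sqrt (real n) \<le> real n"
      using n self_le_power[of "real n" 2] by (intro real_le_lsqrt) auto
    then have "1 / real n \<le> 1 / sqrt (real n)"
      using n by (intro divide_left_mono) auto
    then have "?Q\<^sup>2 * (C * ?v / real n) * 2 / ?v \<le> 2 * C * ?Q\<^sup>2 * (1 / sqrt (real n))"
      using v0 C mult_left_mono[of "1 / real n" "1 / sqrt (real n)" "2 * C * ?Q\<^sup>2"] by (simp add: field_simps)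
    moreover have "(\<integral>\<omega>. ?F j \<omega> \<partial>M) = 2 * (\<integral>\<omega>. (?S j \<omega>)\<^sup>2 \<partial>M) / ?v
        + 4 * (?Q * sqrt C) * (\<integral>\<omega>. ?S j \<omega> \<partial>M) + 2 * (?Q * sqrt C)\<^sup>2 * (\<integral>\<omega>. ?D1 j \<omega> \<partial>M)"
      using i1 i2 i3 by simp
    moreover have "2 * (\<integral>\<omega>. (?S j \<omega>)\<^sup>2 \<partial>M) / ?v \<le> ?Q\<^sup>2 * (C * ?v / real n) * 2 / ?v"
      using divide_right_mono[OF mult_right_mono[OF e2, of 2], of ?v] v0
      by (simp only: mult.commute[of _ 2])
    moreover have "4 * (?Q * sqrt C) * (\<integral>\<omega>. ?S j \<omega> \<partial>M) \<le> 4 * (?Q * sqrt C) * (?Q * (sqrt C / sqrt (real n)))"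
      using e1 C by (intro mult_left_mono) auto
    moreover have "2 * (?Q * sqrt C)\<^sup>2 * (\<integral>\<omega>. ?D1 j \<omega> \<partial>M) \<le> 2 * (?Q * sqrt C)\<^sup>2 * (1 / sqrt (real n))"
      using e3 by (intro mult_left_mono) auto
    ultimately have "(\<integral>\<omega>. ?F j \<omega> \<partial>M) \<le> 2 * C * ?Q\<^sup>2 * (1 / sqrt (real n))
        + 4 * (?Q * sqrt C) * (?Q * (sqrt C / sqrt (real n))) + 2 * (?Q * sqrt C)\<^sup>2 * (1 / sqrt (real n))"
      by linarith
    also have "\<dots> = 8 * C * ?Q\<^sup>2 / sqrt (real n)"
    proof -
      have "2 * (s * s) * Q\<^sup>2 * (1 / t) + 4 * (Q * s) * (Q * (s / t)) + 2 * (Q * s)\<^sup>2 * (1 / t) = 8 * (s * s) * Q\<^sup>2 / t"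
        for s Q t :: real
        by (simp add: divide_inverse power2_eq_square algebra_simps)
      from this[of "sqrt C" ?Q "sqrt (real n)"] show ?thesis using C by simp
    qed
    finally show ?thesis using i1 i2 i3 by simp
  qed
  show "integrable M (\<lambda>\<omega>. fluctuation n k q C (\<lambda>i. Z i \<omega>) \<psi>)"
    unfolding fluctuation_def using cell by (intro Bochner_Integration.integrable_sum) auto
  have "(\<integral>\<omega>. fluctuation n k q C (\<lambda>i. Z i \<omega>) \<psi> \<partial>M) = (\<Sum>j\<in>cell_indices k. \<integral>\<omega>. ?F j \<omega> \<partial>M)"
    unfolding fluctuation_def using cell by (intro Bochner_Integration.integral_sum) auto
  also have "\<dots> \<le> (\<Sum>j\<in>(cell_indices k :: ('d \<Rightarrow> nat) set). 8 * C * ?Q\<^sup>2 / sqrt (real n))"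
    using cell by (intro sum_mono) auto
  finally show "(\<integral>\<omega>. fluctuation n k q C (\<lambda>i. Z i \<omega>) \<psi> \<partial>M)
          \<le> 8 * C * ?Q\<^sup>2 * (real k ^ CARD('d) / sqrt (real n))"
    by (simp add: card_cell_indices mult_ac)
qed

text \<open>Chebyshev and a union bound: no cell is undersampled by more than a factor two.\<close>

lemma undersampled_cell_probability:
  assumes n: "n \<ge> 1" and v0: "v > 0"
    and v: "\<And>j. j \<in> cell_indices k \<Longrightarrow> cell_prob P k j \<ge> v"
  shows "{\<omega> \<in> space M. \<exists>j\<in>cell_indices k. v_hat n k (\<lambda>i. Z i \<omega>) j < cell_prob P k j / 2} \<in> sets M"
    and "measure M {\<omega> \<in> space M. \<exists>j\<in>cell_indices k. v_hat n k (\<lambda>i. Z i \<omega>) j < cell_prob P k j / 2}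
      \<le> real k ^ CARD('d) * (4 / (real n * v))"
proof -
  let ?A = "\<lambda>j. {\<omega> \<in> space M. v_hat n k (\<lambda>i. Z i \<omega>) j < cell_prob P k j / 2}"
  have meas: "?A j \<in> sets M" for j unfolding v_hat_def by measurable
  have union: "{\<omega> \<in> space M. \<exists>j\<in>cell_indices k. v_hat n k (\<lambda>i. Z i \<omega>) j < cell_prob P k j / 2}
      = (\<Union>j\<in>cell_indices k. ?A j)" by auto
  show "{\<omega> \<in> space M. \<exists>j\<in>cell_indices k. v_hat n k (\<lambda>i. Z i \<omega>) j < cell_prob P k j / 2} \<in> sets M"
    unfolding union using meas by auto
  have single: "measure M (?A j) \<le> 4 / (real n * v)" if j: "j \<in> cell_indices k" for j
  proof -
    let ?v = "cell_prob P k j"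
    let ?D = "\<lambda>\<omega>. cell_deviation n k (\<lambda>i. Z i \<omega>) (\<lambda>_. 1) j"
    have vj: "?v \<ge> v" "?v > 0" using v[OF j] v0 by auto
    have one: "(\<integral>u. (1::real)\<^sup>2 * indicator (cell k j) (instrument u) \<partial>P) \<le> ?v"
      by (simp add: cell_prob_eq_integral)
    note dev = cell_deviation_moments(1,2)[of "\<lambda>_. 1", OF _ _ n one]
    have i2: "integrable M (\<lambda>\<omega>. (?D \<omega>)\<^sup>2)" by (rule dev(1)) auto
    have [measurable]: "?D \<in> borel_measurable M"
      unfolding cell_deviation_def cell_mean_def by measurable
    have sub: "?A j \<subseteq> {\<omega> \<in> space M. (?D \<omega>)\<^sup>2 \<ge> (?v / 2)\<^sup>2}"
    proof safe
      fix \<omega> assume "v_hat n k (\<lambda>i. Z i \<omega>) j < ?v / 2"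
      then have "?v / 2 \<le> ?D \<omega>"
        unfolding cell_deviation_def v_hat_eq_cell_mean[symmetric] mult_1_left cell_prob_eq_integral[symmetric]
        by linarith
      then show "(?v / 2)\<^sup>2 \<le> (?D \<omega>)\<^sup>2" using vj by (intro power_mono) auto
    qed
    have "measure M (?A j) \<le> measure M {\<omega> \<in> space M. (?D \<omega>)\<^sup>2 \<ge> (?v / 2)\<^sup>2}"
      using i2 by (intro sample.finite_measure_mono sub) measurable
    also have "\<dots> \<le> (\<integral>\<omega>. (?D \<omega>)\<^sup>2 \<partial>M) / (?v / 2)\<^sup>2"
      using vj by (intro integral_Markov_inequality_measure[where A = "{}"] i2) auto
    also have "\<dots> \<le> (?v / real n) / (?v / 2)\<^sup>2"
      using dev(2) by (intro divide_right_mono) auto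
    also have "\<dots> = 4 / (real n * ?v)" using vj by (simp add: power2_eq_square field_simps)
    also have "\<dots> \<le> 4 / (real n * v)"
      using n v0 vj by (intro divide_left_mono mult_left_mono mult_pos_pos) auto
    finally show ?thesis .
  qed
  have "measure M (\<Union>j\<in>cell_indices k. ?A j) \<le> (\<Sum>j\<in>cell_indices k. measure M (?A j))"
    using meas by (intro sample.finite_measure_subadditive_finite) auto
  also have "\<dots> \<le> (\<Sum>j\<in>(cell_indices k :: ('d \<Rightarrow> nat) set). 4 / (real n * v))"
    using single by (intro sum_mono) auto
  finally show "measure M {\<omega> \<in> space M. \<exists>j\<in>cell_indices k. v_hat n k (\<lambda>i. Z i \<omega>) j < cell_prob P k j / 2}
      \<le> real k ^ CARD('d) * (4 / (real n * v))"
    unfolding union by (simp add: card_cell_indices)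
qed

end

section \<open>Geometry of the sieve\<close>

context observation_law begin

lemma L2X_composed:
  assumes "g \<in> L2X P"
  shows "(\<lambda>z. g (regressor z)) \<in> borel_measurable P" "integrable P (\<lambda>z. (g (regressor z))\<^sup>2)"
    "integrable P (\<lambda>z. g (regressor z))"
proof -
  have [measurable]: "g \<in> borel_measurable borel" using assms by (simp add: L2X_def)
  show m: "(\<lambda>z. g (regressor z)) \<in> borel_measurable P" by measurable
  show s: "integrable P (\<lambda>z. (g (regressor z))\<^sup>2)" using assms by (simp add: L2X_def)
  show "integrable P (\<lambda>z. g (regressor z))" by (rule square_integrable_imp_integrable[OF m s])
qed

lemma L2X_add:
  assumes "g \<in> L2X P" "h \<in> L2X P" shows "(\<lambda>x. g x + h x) \<in> L2X P"
  using assms square_integrable_add[OF L2X_composed(1)[OF assms(1)] L2X_composed(1)[OF assms(2)]]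
  by (auto simp: L2X_def)

lemma L2X_cmult: "g \<in> L2X P \<Longrightarrow> (\<lambda>x. c * g x) \<in> L2X P"
  by (auto simp: L2X_def power_mult_distrib)

lemma L2X_diff:
  assumes "g \<in> L2X P" "h \<in> L2X P" shows "(\<lambda>x. g x - h x) \<in> L2X P"
  using L2X_add[OF assms(1) L2X_cmult[OF assms(2), of "-1"]] by simp

lemma L2X_product_integrable:
  assumes "g \<in> L2X P" "h \<in> L2X P"
  shows "integrable P (\<lambda>z. g (regressor z) * h (regressor z))"
  using assms by (intro square_integrable_product L2X_composed)

lemma L2X_sum:
  assumes "finite A" "\<And>i. i \<in> A \<Longrightarrow> f i \<in> L2X P"
  shows "(\<lambda>x. \<Sum>i\<in>A. c i * f i x) \<in> L2X P"
  using assms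
proof (induction A rule: finite_induct)
  case empty then show ?case by (simp add: L2X_def)
next
  case (insert a A) then show ?case by (simp add: L2X_add L2X_cmult)
qed

lemma norm_s_square: "(norm_s P g)\<^sup>2 = innerX P g g"
  unfolding norm_s_def innerX_def by (simp add: Bochner_Integration.integral_nonneg power2_eq_square)

lemma innerX_commute: "innerX P g h = innerX P h g"
  by (simp add: innerX_def mult.commute)

lemma norm_s_square_add:
  assumes "u \<in> L2X P" "v \<in> L2X P"
  shows "(norm_s P (\<lambda>x. u x + v x))\<^sup>2 = (norm_s P u)\<^sup>2 + 2 * innerX P u v + (norm_s P v)\<^sup>2"
proof -
  have eq: "(\<lambda>z. (u (regressor z) + v (regressor z)) * (u (regressor z) + v (regressor z)))
    = (\<lambda>z. u (regressor z) * u (regressor z) + 2 * (u (regressor z) * v (regressor z))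
        + v (regressor z) * v (regressor z))"
    by (auto simp: algebra_simps)
  then show ?thesis
    unfolding norm_s_square innerX_def eq
    using L2X_product_integrable[OF assms(1,1)] L2X_product_integrable[OF assms] L2X_product_integrable[OF assms(2,2)]
    by simp
qed

lemma innerX_sum_left:
  assumes "finite A" "\<And>i. i \<in> A \<Longrightarrow> f i \<in> L2X P" "h \<in> L2X P"
  shows "innerX P (\<lambda>x. \<Sum>i\<in>A. c i * f i x) h = (\<Sum>i\<in>A. c i * innerX P (f i) h)"
proof -
  have "innerX P (\<lambda>x. \<Sum>i\<in>A. c i * f i x) h
      = (\<integral>z. (\<Sum>i\<in>A. c i * (f i (regressor z) * h (regressor z))) \<partial>P)"
    unfolding innerX_def by (simp add: sum_distrib_right mult.assoc)
  also have "\<dots> = (\<Sum>i\<in>A. c i * innerX P (f i) h)"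
    unfolding innerX_def using assms L2X_product_integrable
    by (subst Bochner_Integration.integral_sum) auto
  finally show ?thesis .
qed

text \<open>
  Linearity of the conditional expectation and \<open>(s + t)\<^sup>2 \<le> 2 s\<^sup>2 + 2 t\<^sup>2\<close>.
\<close>

lemma norm_w_triangle:
  assumes "u \<in> L2X P" "v \<in> L2X P"
  shows "(norm_w P (\<lambda>x. u x + v x))\<^sup>2 \<le> 2 * (norm_w P u)\<^sup>2 + 2 * (norm_w P v)\<^sup>2"
proof -
  let ?c = "\<lambda>u. cond_W P (\<lambda>z. u (regressor z))"
  have sq: "(norm_w P u)\<^sup>2 = (\<integral>z. (?c u z)\<^sup>2 \<partial>P)" for u
    unfolding norm_w_def by (simp add: Bochner_Integration.integral_nonneg)
  have int: "integrable P (\<lambda>z. (?c g z)\<^sup>2)" if "g \<in> L2X P" for g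
    by (rule cond_W_contraction(1)[OF L2X_composed(1,2)[OF that]])
  have "AE z in P. (?c (\<lambda>x. u x + v x) z)\<^sup>2 \<le> 2 * (?c u z)\<^sup>2 + 2 * (?c v z)\<^sup>2"
    using cond_W_add[OF L2X_composed(3)[OF assms(1)] L2X_composed(3)[OF assms(2)]]
  proof eventually_elim
    case (elim z)
    have "(s + t)\<^sup>2 \<le> 2 * s\<^sup>2 + 2 * t\<^sup>2" for s t :: real
      using sum_squares_bound[of s t] by (simp add: power2_sum)
    then show ?case unfolding elim by blast
  qed
  then have "(\<integral>z. (?c (\<lambda>x. u x + v x) z)\<^sup>2 \<partial>P) \<le> (\<integral>z. 2 * (?c u z)\<^sup>2 + 2 * (?c v z)\<^sup>2 \<partial>P)"
    using int[OF L2X_add[OF assms]] int[OF assms(1)] int[OF assms(2)] by (intro integral_mono_AE) auto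
  then show ?thesis
    unfolding sq using int[OF assms(1)] int[OF assms(2)] by simp
qed

lemma norm_w_le_norm_s:
  assumes "u \<in> L2X P" shows "(norm_w P u)\<^sup>2 \<le> (norm_s P u)\<^sup>2"
  using cond_W_contraction(2)[OF L2X_composed(1,2)[OF assms]]
  unfolding norm_w_def norm_s_def by (simp add: Bochner_Integration.integral_nonneg)

text \<open>
  A posterior that concentrates at one identified \<open>g\<^sub>0\<close> in the strong norm concentrates at the
  identified set.
\<close>

lemma dist_Theta_le:
  assumes "g0 \<in> Theta_I P" shows "dist_Theta P g \<le> norm_s P (\<lambda>x. g x - g0 x)"
  unfolding dist_Theta_def using assms
  by (intro cINF_lower bdd_belowI[of _ 0]) (auto simp: norm_s_def)

text \<open>
  Any identified \<open>g\<^sub>0\<close> satisfies \<open>E(Y - g\<^sub>0(X) | W) = 0\<close>, so the conditional moment of \<open>Y - g(X)\<close>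
  is that of \<open>g\<^sub>0(X) - g(X)\<close>.
\<close>

lemma criterion_eq_weak_norm:
  assumes Y: "integrable P (\<lambda>z. (outcome z)\<^sup>2)" and g0: "g0 \<in> Theta_I P" and g: "g \<in> L2X P"
  shows "(\<integral>z. (cond_W P (\<lambda>u. outcome u - g (regressor u)) z)\<^sup>2 \<partial>P) = (norm_w P (\<lambda>x. g x - g0 x))\<^sup>2"
proof -
  have g0L: "g0 \<in> L2X P" using g0 by (simp add: Theta_I_def)
  have Ym: "outcome \<in> borel_measurable P" by measurable
  have Yi: "integrable P outcome" by (rule square_integrable_imp_integrable[OF Ym Y])
  have res: "(\<lambda>u. outcome u - g0 (regressor u)) \<in> borel_measurable P"
    "integrable P (\<lambda>u. (outcome u - g0 (regressor u))\<^sup>2)"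
    using square_integrable_add[of outcome "\<lambda>z. - g0 (regressor z)"] L2X_composed[OF g0L] Ym Y by auto
  have "(\<integral>z. (cond_W P (\<lambda>u. outcome u - g0 (regressor u)) z)\<^sup>2 \<partial>P) = 0"
    using g0 by (simp add: Theta_I_def G_crit_def)
  then have zero: "AE z in P. cond_W P (\<lambda>u. outcome u - g0 (regressor u)) z = 0"
    using integral_nonneg_eq_0_iff_AE[OF cond_W_contraction(1)[OF res]] by auto
  have i: "integrable P (\<lambda>u. outcome u - g0 (regressor u))"
    "integrable P (\<lambda>u. g (regressor u) - g0 (regressor u))"
    using Yi L2X_composed(3)[OF g0L] L2X_composed(3)[OF g] by auto
  have "AE z in P. cond_W P (\<lambda>u. outcome u - g (regressor u)) z
      = cond_W P (\<lambda>u. outcome u - g0 (regressor u)) z - cond_W P (\<lambda>u. g (regressor u) - g0 (regressor u)) z"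
    using cond_W_diff[OF i] by (simp add: )
  with zero have "AE z in P. (cond_W P (\<lambda>u. outcome u - g (regressor u)) z)\<^sup>2
      = (cond_W P (\<lambda>u. g (regressor u) - g0 (regressor u)) z)\<^sup>2"
    by eventually_elim simp
  then have "(\<integral>z. (cond_W P (\<lambda>u. outcome u - g (regressor u)) z)\<^sup>2 \<partial>P)
      = (\<integral>z. (cond_W P (\<lambda>u. g (regressor u) - g0 (regressor u)) z)\<^sup>2 \<partial>P)"
    by (intro integral_cong_AE) measurable
  then show ?thesis
    unfolding norm_w_def by (simp add: Bochner_Integration.integral_nonneg)
qed

end

text \<open>
  The functions \<open>varphi\<close> and \<open>\<eta>\<close> enter the geometry only through the weights
  \<open>varphi ((\<eta> j)\<^sup>2)\<close>, which are positive and decrease in \<open>j \<ge> 1\<close>.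
\<close>

locale sieve_geometry = observation_law P
  for P :: "('x::euclidean_space, 'd::finite) obs measure" +
  fixes \<phi> :: "nat \<Rightarrow> 'x \<Rightarrow> real" and g0 :: "'x \<Rightarrow> real" and bstar \<eta> :: "nat \<Rightarrow> real"
    and varphi :: "real \<Rightarrow> real"
  assumes basis: "orthonormal_basis_L2X P \<phi>"
    and g0_L2X: "g0 \<in> L2X P"
    and eta: "\<And>j. j \<ge> 1 \<Longrightarrow> 0 < \<eta> j \<and> \<eta> (Suc j) < \<eta> j"
    and varphi_mono: "mono_on {0<..} varphi"
    and varphi_pos: "\<And>t. t > 0 \<Longrightarrow> varphi t > 0"
begin

lemma basis_L2X: "i \<ge> 1 \<Longrightarrow> \<phi> i \<in> L2X P"
  using basis by (simp add: orthonormal_basis_L2X_def)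

lemma basis_orthonormal: "i \<ge> 1 \<Longrightarrow> j \<ge> 1 \<Longrightarrow> innerX P (\<phi> i) (\<phi> j) = (if i = j then 1 else 0)"
  using basis by (simp add: orthonormal_basis_L2X_def)

lemma sieve_fun_L2X: "sieve_fun \<phi> q b \<in> L2X P"
  unfolding sieve_fun_def[abs_def] by (intro L2X_sum) (auto intro: basis_L2X)

lemma innerX_sieve_left:
  "h \<in> L2X P \<Longrightarrow> innerX P (sieve_fun \<phi> q b) h = (\<Sum>i=1..q. b i * innerX P (\<phi> i) h)"
  unfolding sieve_fun_def[abs_def] by (intro innerX_sum_left) (auto intro: basis_L2X)

lemma innerX_sieve_basis:
  assumes "1 \<le> j" "j \<le> q" shows "innerX P (sieve_fun \<phi> q b) (\<phi> j) = b j"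
proof -
  have "innerX P (sieve_fun \<phi> q b) (\<phi> j) = (\<Sum>i=1..q. b i * (if i = j then 1 else 0))"
    unfolding innerX_sieve_left[OF basis_L2X[OF assms(1)]] using assms basis_orthonormal
    by (intro sum.cong) auto
  also have "\<dots> = b j" using assms by (simp add: if_distrib cong: if_cong)
  finally show ?thesis .
qed

lemma norm_s_sieve: "(norm_s P (sieve_fun \<phi> q b))\<^sup>2 = (\<Sum>i=1..q. (b i)\<^sup>2)"
  unfolding norm_s_square innerX_sieve_left[OF sieve_fun_L2X]
  by (intro sum.cong) (auto simp: innerX_commute[of "\<phi> _"] innerX_sieve_basis power2_eq_square)

text \<open>
  The squared norm of \<open>h\<close> minus its projection is nonnegative.
\<close>

lemma bessel_inequality:
  assumes h: "h \<in> L2X P"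
  shows "(\<Sum>j=1..N. (innerX P h (\<phi> j))\<^sup>2) \<le> (norm_s P h)\<^sup>2"
proof -
  let ?s = "sieve_fun \<phi> N (\<lambda>j. - innerX P h (\<phi> j))"
  have "innerX P h ?s = - (\<Sum>j=1..N. (innerX P h (\<phi> j))\<^sup>2)"
    unfolding innerX_commute[of h ?s] innerX_sieve_left[OF h]
    by (simp add: innerX_commute[of _ h] power2_eq_square sum_negf)
  then have "(norm_s P (\<lambda>x. h x + ?s x))\<^sup>2 = (norm_s P h)\<^sup>2 - (\<Sum>j=1..N. (innerX P h (\<phi> j))\<^sup>2)"
    unfolding norm_s_square_add[OF h sieve_fun_L2X] norm_s_sieve by simp
  then show ?thesis using zero_le_power2[of "norm_s P (\<lambda>x. h x + ?s x)"] by linarith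
qed

lemma eta_antimono: "1 \<le> i \<Longrightarrow> i \<le> j \<Longrightarrow> \<eta> j \<le> \<eta> i"
proof (induction j)
  case (Suc j)
  then show ?case using eta[of j] by (cases "i = Suc j") auto
qed simp

lemma link_weight_mono:
  assumes "1 \<le> i" "i \<le> j" shows "varphi ((\<eta> j)\<^sup>2) \<le> varphi ((\<eta> i)\<^sup>2)"
proof (rule mono_onD[OF varphi_mono])
  show "(\<eta> j)\<^sup>2 \<in> {0<..}" "(\<eta> i)\<^sup>2 \<in> {0<..}" using eta[of j] eta[of i] assms by auto
  show "(\<eta> j)\<^sup>2 \<le> (\<eta> i)\<^sup>2" using eta_antimono[OF assms] eta[of j] assms by (intro power_mono) auto
qed

lemma link_weight_pos: "j \<ge> 1 \<Longrightarrow> varphi ((\<eta> j)\<^sup>2) > 0"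
  using eta[of j] by (intro varphi_pos) auto

lemma bessel_partial_sum:
  assumes h: "h \<in> L2X P"
  shows "(\<Sum>j<N. (innerX P h (\<phi> (Suc j)))\<^sup>2) \<le> (norm_s P h)\<^sup>2"
proof -
  have "(\<Sum>j<N. (innerX P h (\<phi> (Suc j)))\<^sup>2) = (\<Sum>j=1..N. (innerX P h (\<phi> j))\<^sup>2)"
    by (rule sum.reindex_bij_witness[where i = "\<lambda>j. j - 1" and j = Suc]) auto
  with bessel_inequality[OF h] show ?thesis by simp
qed

text \<open>
  Bessel's inequality and the largest weight give a convergent majorant. Without summability the
  infinite sums in the link condition would carry no information.
\<close>

lemma link_series_summable:
  assumes h: "h \<in> L2X P"
  shows "summable (\<lambda>j. varphi ((\<eta> (Suc j))\<^sup>2) * \<bar>innerX P h (\<phi> (Suc j))\<bar>\<^sup>2)"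
proof (rule summable_comparison_test'[where N = 0])
  show "summable (\<lambda>j. varphi ((\<eta> 1)\<^sup>2) * (innerX P h (\<phi> (Suc j)))\<^sup>2)"
    by (intro summable_mult summableI_nonneg_bounded[OF _ bessel_partial_sum[OF h]]) auto
  fix j :: nat
  show "norm (varphi ((\<eta> (Suc j))\<^sup>2) * \<bar>innerX P h (\<phi> (Suc j))\<bar>\<^sup>2)
      \<le> varphi ((\<eta> 1)\<^sup>2) * (innerX P h (\<phi> (Suc j)))\<^sup>2"
    using link_weight_mono[of 1 "Suc j"] link_weight_pos[of "Suc j"]
    by (auto simp: abs_mult intro!: mult_right_mono)
qed

context
  fixes q :: nat
  assumes q: "q \<ge> 1"
    and projection: "\<And>i. i \<in> {1..q} \<Longrightarrow> innerX P (\<lambda>x. g0 x - sieve_fun \<phi> q bstar x) (\<phi> i) = 0"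
begin

lemma bias_L2X: "(\<lambda>x. sieve_fun \<phi> q bstar x - g0 x) \<in> L2X P" "(\<lambda>x. g0 x - sieve_fun \<phi> q bstar x) \<in> L2X P"
  by (intro L2X_diff sieve_fun_L2X g0_L2X)+

lemma sieve_error_decomposition:
  "(\<lambda>x. sieve_fun \<phi> q b x - g0 x)
    = (\<lambda>x. sieve_fun \<phi> q (\<lambda>i. b i - bstar i) x + (sieve_fun \<phi> q bstar x - g0 x))"
  by (auto simp: sieve_fun_def sum_subtractf algebra_simps)

lemma innerX_minus_left: "innerX P (\<lambda>x. h x - g x) f = - innerX P (\<lambda>x. g x - h x) f"
proof -
  have "innerX P (\<lambda>x. h x - g x) f = (\<integral>z. - ((g (regressor z) - h (regressor z)) * f (regressor z)) \<partial>P)"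
    unfolding innerX_def by (intro Bochner_Integration.integral_cong) (auto simp: algebra_simps)
  then show ?thesis by (simp add: innerX_def)
qed

text \<open>
  The projection error \<open>g\<^sup>* - g\<^sub>0\<close> is orthogonal to the sieve space.
\<close>

lemma sieve_pythagoras:
  "(norm_s P (\<lambda>x. sieve_fun \<phi> q b x - g0 x))\<^sup>2
     = (\<Sum>i=1..q. (b i - bstar i)\<^sup>2) + (norm_s P (\<lambda>x. sieve_fun \<phi> q bstar x - g0 x))\<^sup>2"
proof -
  let ?e = "\<lambda>x. sieve_fun \<phi> q bstar x - g0 x"
  have "innerX P (sieve_fun \<phi> q (\<lambda>i. b i - bstar i)) ?e = 0"
    unfolding innerX_sieve_left[OF bias_L2X(1)] using projection
    by (intro sum.neutral) (simp add: innerX_commute[of "\<phi> _"] innerX_minus_left[of _ g0])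
  then show ?thesis
    unfolding sieve_error_decomposition[of b] norm_s_square_add[OF sieve_fun_L2X bias_L2X(1)] norm_s_sieve by simp
qed

text \<open>
  The first \<open>q\<close> coefficients of \<open>g\<^sub>b - g\<^sub>0\<close> are \<open>b\<^sub>i - b\<^sup>*\<^sub>i\<close>, and each carries at least the
  weight of index \<open>q\<close>.
\<close>

lemma weak_norm_lower:
  assumes C1: "C1 > 0"
    and link: "\<And>g. g \<in> L2X P \<Longrightarrow> (norm_w P (\<lambda>x. g x - g0 x))\<^sup>2 \<ge>
        C1 * (\<Sum>j. varphi ((\<eta> (Suc j))\<^sup>2) * \<bar>innerX P (\<lambda>x. g x - g0 x) (\<phi> (Suc j))\<bar>\<^sup>2)"
  shows "C1 * (varphi ((\<eta> q)\<^sup>2) * (\<Sum>i=1..q. (b i - bstar i)\<^sup>2)) \<le> (norm_w P (\<lambda>x. sieve_fun \<phi> q b x - g0 x))\<^sup>2"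
proof -
  let ?h = "\<lambda>x. sieve_fun \<phi> q b x - g0 x"
  have h: "?h \<in> L2X P" by (intro L2X_diff sieve_fun_L2X g0_L2X)
  have coeff: "innerX P ?h (\<phi> i) = b i - bstar i" if i: "i \<in> {1..q}" for i
  proof -
    have int: "integrable P (\<lambda>z. sieve_fun \<phi> q (\<lambda>i. b i - bstar i) (regressor z) * \<phi> i (regressor z))"
      "integrable P (\<lambda>z. (sieve_fun \<phi> q bstar (regressor z) - g0 (regressor z)) * \<phi> i (regressor z))"
      using i L2X_product_integrable[OF sieve_fun_L2X basis_L2X] L2X_product_integrable[OF bias_L2X(1) basis_L2X]
      by auto
    have "innerX P ?h (\<phi> i) = innerX P (sieve_fun \<phi> q (\<lambda>i. b i - bstar i)) (\<phi> i)
        + innerX P (\<lambda>x. sieve_fun \<phi> q bstar x - g0 x) (\<phi> i)"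
      unfolding sieve_error_decomposition[of b] innerX_def using int by (simp add: distrib_right)
    then show ?thesis
      using i projection[OF i] by (simp add: innerX_sieve_basis innerX_minus_left[of _ g0])
  qed
  have "varphi ((\<eta> q)\<^sup>2) * (\<Sum>i=1..q. (b i - bstar i)\<^sup>2)
      = (\<Sum>j<q. varphi ((\<eta> q)\<^sup>2) * \<bar>innerX P ?h (\<phi> (Suc j))\<bar>\<^sup>2)"
    unfolding sum_distrib_left
    by (rule sum.reindex_bij_witness[where j = "\<lambda>j. j - 1" and i = Suc]) (auto simp: coeff)
  also have "\<dots> \<le> (\<Sum>j<q. varphi ((\<eta> (Suc j))\<^sup>2) * \<bar>innerX P ?h (\<phi> (Suc j))\<bar>\<^sup>2)"
    by (intro sum_mono mult_right_mono link_weight_mono) auto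
  also have "\<dots> \<le> (\<Sum>j. varphi ((\<eta> (Suc j))\<^sup>2) * \<bar>innerX P ?h (\<phi> (Suc j))\<bar>\<^sup>2)"
    by (intro sum_le_suminf link_series_summable h) (simp_all add: less_imp_le[OF link_weight_pos])
  finally have "C1 * (varphi ((\<eta> q)\<^sup>2) * (\<Sum>i=1..q. (b i - bstar i)\<^sup>2))
      \<le> C1 * (\<Sum>j. varphi ((\<eta> (Suc j))\<^sup>2) * \<bar>innerX P ?h (\<phi> (Suc j))\<bar>\<^sup>2)"
    using C1 by (intro mult_left_mono) auto
  also have "\<dots> \<le> (norm_w P ?h)\<^sup>2" by (rule link[OF sieve_fun_L2X])
  finally show ?thesis .
qed

text \<open>
  The approximation error has no component along \<open>\<phi>\<^sub>1, \<dots>, \<phi>\<^sub>q\<close>, so only weights of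
  index beyond \<open>q\<close> act on it, and these are at most \<open>varphi ((\<eta> q)\<^sup>2)\<close>.
\<close>

lemma weak_norm_bias:
  assumes C2: "C2 > 0"
    and link: "(norm_w P (\<lambda>x. sieve_fun \<phi> q bstar x - g0 x))\<^sup>2 \<le>
        C2 * (\<Sum>j. varphi ((\<eta> (Suc j))\<^sup>2) * \<bar>innerX P (\<lambda>x. g0 x - sieve_fun \<phi> q bstar x) (\<phi> (Suc j))\<bar>\<^sup>2)"
  shows "(norm_w P (\<lambda>x. sieve_fun \<phi> q bstar x - g0 x))\<^sup>2
      \<le> C2 * (varphi ((\<eta> q)\<^sup>2) * (norm_s P (\<lambda>x. sieve_fun \<phi> q bstar x - g0 x))\<^sup>2)"
proof -
  let ?e = "\<lambda>x. g0 x - sieve_fun \<phi> q bstar x"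
  let ?c = "\<lambda>j. innerX P ?e (\<phi> (Suc j))"
  have sum2: "summable (\<lambda>j. (?c j)\<^sup>2)"
    by (rule summableI_nonneg_bounded[OF _ bessel_partial_sum[OF bias_L2X(2)]]) auto
  have "(\<Sum>j. varphi ((\<eta> (Suc j))\<^sup>2) * \<bar>?c j\<bar>\<^sup>2) \<le> (\<Sum>j. varphi ((\<eta> q)\<^sup>2) * (?c j)\<^sup>2)"
  proof (intro suminf_le link_series_summable bias_L2X summable_mult sum2)
    fix j
    show "varphi ((\<eta> (Suc j))\<^sup>2) * \<bar>?c j\<bar>\<^sup>2 \<le> varphi ((\<eta> q)\<^sup>2) * (?c j)\<^sup>2"
    proof (cases "Suc j \<le> q")
      case True then show ?thesis using projection[of "Suc j"] by simp
    next
      case False then show ?thesis using link_weight_mono[of q "Suc j"] q by (auto intro: mult_right_mono)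
    qed
  qed
  also have "\<dots> = varphi ((\<eta> q)\<^sup>2) * (\<Sum>j. (?c j)\<^sup>2)" by (rule suminf_mult[OF sum2])
  also have "(\<Sum>j. (?c j)\<^sup>2) \<le> (norm_s P ?e)\<^sup>2"
    by (rule suminf_le_const[OF sum2 bessel_partial_sum[OF bias_L2X(2)]])
  also have "norm_s P ?e = norm_s P (\<lambda>x. sieve_fun \<phi> q bstar x - g0 x)"
    by (simp add: norm_s_def power2_commute)
  finally have "C2 * (\<Sum>j. varphi ((\<eta> (Suc j))\<^sup>2) * \<bar>?c j\<bar>\<^sup>2)
      \<le> C2 * (varphi ((\<eta> q)\<^sup>2) * (norm_s P (\<lambda>x. sieve_fun \<phi> q bstar x - g0 x))\<^sup>2)"
    using C2 link_weight_pos[OF q] by (simp add: mult_left_mono)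
  with link show ?thesis by linarith
qed

text \<open>
  Within the sieve the weak norm is bounded by the strong one; the sieve bias is covered by
  \<open>weak_norm_bias\<close>.
\<close>

lemma weak_norm_upper:
  assumes "C2 > 0"
    and "(norm_w P (\<lambda>x. sieve_fun \<phi> q bstar x - g0 x))\<^sup>2 \<le>
        C2 * (\<Sum>j. varphi ((\<eta> (Suc j))\<^sup>2) * \<bar>innerX P (\<lambda>x. g0 x - sieve_fun \<phi> q bstar x) (\<phi> (Suc j))\<bar>\<^sup>2)"
  shows "(norm_w P (\<lambda>x. sieve_fun \<phi> q b x - g0 x))\<^sup>2
      \<le> 2 * (\<Sum>i=1..q. (b i - bstar i)\<^sup>2)
        + 2 * (C2 * (varphi ((\<eta> q)\<^sup>2) * (norm_s P (\<lambda>x. sieve_fun \<phi> q bstar x - g0 x))\<^sup>2))"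
  using norm_w_triangle[OF sieve_fun_L2X bias_L2X(1), of q "\<lambda>i. b i - bstar i"]
    norm_w_le_norm_s[OF sieve_fun_L2X, of q "\<lambda>i. b i - bstar i"] weak_norm_bias[OF assms]
  unfolding sieve_error_decomposition[of b, symmetric] norm_s_sieve by linarith

end

end

section \<open>Priors on the coefficients\<close>

abbreviation coeff_cube :: "nat \<Rightarrow> (nat \<Rightarrow> real) \<Rightarrow> real \<Rightarrow> (nat \<Rightarrow> real) set" where
  "coeff_cube q a s \<equiv> PiE {1..q} (\<lambda>i. {a i - s..a i + s})"

lemma product_sigma_finite_lborel: "product_sigma_finite (\<lambda>_::nat. lborel :: real measure)"
  by standard

lemma sigma_finite_lebesgue_coeff: "sigma_finite_measure (lebesgue_coeff q)"
proof -
  interpret product_sigma_finite "\<lambda>_::nat. lborel :: real measure" by (rule product_sigma_finite_lborel)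
  show ?thesis unfolding lebesgue_coeff_def by (rule sigma_finite) simp
qed

lemma space_lebesgue_coeff: "space (lebesgue_coeff q) = PiE {1..q} (\<lambda>_. UNIV)"
  by (simp add: lebesgue_coeff_def space_PiM)

lemma coeff_component_measurable:
  "i \<in> {1..q} \<Longrightarrow> (\<lambda>b. b i) \<in> borel_measurable (lebesgue_coeff q)"
  unfolding lebesgue_coeff_def by measurable

lemma coeff_cube_sets [measurable]: "coeff_cube q a s \<in> sets (lebesgue_coeff q)"
  unfolding lebesgue_coeff_def by (intro sets_PiM_I_finite) auto

lemma emeasure_coeff_cube:
  assumes "s \<ge> 0" shows "emeasure (lebesgue_coeff q) (coeff_cube q a s) = ennreal ((2 * s) ^ q)"
proof -
  interpret product_sigma_finite "\<lambda>_::nat. lborel :: real measure" by (rule product_sigma_finite_lborel)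
  have "emeasure (lebesgue_coeff q) (coeff_cube q a s) = (\<Prod>i=1..q. emeasure lborel {a i - s..a i + s})"
    unfolding lebesgue_coeff_def by (rule emeasure_PiM) auto
  also have "\<dots> = (\<Prod>i=1..q. ennreal (2 * s))"
    using assms by (intro prod.cong) auto
  finally show ?thesis using assms by (simp add: ennreal_power)
qed

lemma nn_integral_coeff_prod:
  assumes "\<And>i. i \<in> {1..q} \<Longrightarrow> f i \<in> borel_measurable borel"
  shows "(\<integral>\<^sup>+b. (\<Prod>i=1..q. f i (b i)) \<partial>lebesgue_coeff q) = (\<Prod>i=1..q. \<integral>\<^sup>+t. f i t \<partial>lborel)"
proof -
  interpret product_sigma_finite "\<lambda>_::nat. lborel :: real measure" by (rule product_sigma_finite_lborel)
  show ?thesis unfolding lebesgue_coeff_def by (rule product_nn_integral_prod) (use assms in auto)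
qed

text \<open>The origin is negligible; the thin-tail density is only bounded below away from it.\<close>

lemma AE_coeff_nonzero:
  assumes "q \<ge> 1" shows "AE b in lebesgue_coeff q. L2_set b {1..q} > 0"
proof -
  have "emeasure (lebesgue_coeff q) (coeff_cube q (\<lambda>_. 0) 0) = 0"
    using assms by (subst emeasure_coeff_cube) auto
  then have "coeff_cube q (\<lambda>_. 0) 0 \<in> null_sets (lebesgue_coeff q)"
    by (rule null_setsI[OF _ coeff_cube_sets])
  moreover have "{b \<in> space (lebesgue_coeff q). \<not> L2_set b {1..q} > 0} \<subseteq> coeff_cube q (\<lambda>_. 0) 0"
  proof
    fix b assume b: "b \<in> {b \<in> space (lebesgue_coeff q). \<not> L2_set b {1..q} > 0}"
    then have "L2_set b {1..q} = 0" by (simp add: not_less antisym[OF _ L2_set_nonneg])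
    then have "\<forall>i\<in>{1..q}. b i = 0" by (simp add: L2_set_eq_0_iff)
    moreover have "b \<in> extensional {1..q}" using b by (simp add: space_lebesgue_coeff PiE_def)
    ultimately show "b \<in> coeff_cube q (\<lambda>_. 0) 0" unfolding PiE_def Pi_def by simp
  qed
  ultimately show ?thesis by (rule AE_I')
qed

lemma abs_le_L2_set: "i \<in> {1..q::nat} \<Longrightarrow> \<bar>b i\<bar> \<le> L2_set b {1..q}"
  using member_le_L2_set[of "{1..q}" i "\<lambda>i. \<bar>b i\<bar>", OF finite_atLeastAtMost] by (simp add: L2_set_def del: atLeastAtMost_iff)

lemma L2_set_coeff_measurable [measurable]:
  "(\<lambda>b. L2_set b {1..q}) \<in> borel_measurable (lebesgue_coeff q)"
  unfolding L2_set_def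
  by (intro measurable_compose[OF _ borel_measurable_sqrt] borel_measurable_sum borel_measurable_power coeff_component_measurable)

lemma prior_density_measurable [measurable]:
  "prior_density prior q B \<in> borel_measurable (lebesgue_coeff q)"
proof (cases prior)
  case Uniform
  have [measurable]: "(\<lambda>t::real. indicator {t. \<bar>t\<bar> \<le> B} t / (2 * B) :: real) \<in> borel_measurable borel"
    by measurable
  show ?thesis unfolding Uniform prior_density.simps[abs_def]
    by (intro borel_measurable_prod) (rule measurable_compose[OF coeff_component_measurable], auto)
next
  case (Truncated_Normal \<sigma>)
  show ?thesis unfolding Truncated_Normal prior_density.simps[abs_def]
    by (intro borel_measurable_prod) (rule measurable_compose[OF coeff_component_measurable], auto)
next
  case (Thin_Tail r \<beta>)
  show ?thesis unfolding Thin_Tail prior_density.simps[abs_def] by measurable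
qed

lemma sphere_area_nonneg: "sphere_area q \<ge> 0"
  unfolding sphere_area_def by (cases "q = 0") (auto intro!: divide_nonneg_nonneg less_imp_le[OF Gamma_real_pos])

lemma prior_density_nonneg:
  assumes "valid_prior prior" shows "prior_density prior q B b \<ge> 0"
proof -
  have "indicator {t. \<bar>t\<bar> \<le> B} x / (2 * B) \<ge> (0::real)" for x
    by (cases "B \<ge> 0") (auto simp: indicator_def)
  then have "prior = Uniform \<Longrightarrow> ?thesis" by (simp only: prior_density.simps prod_nonneg)
  then show ?thesis
    using assms by (cases prior)
      (auto intro!: prod_nonneg mult_nonneg_nonneg divide_nonneg_nonneg sphere_area_nonneg)
qed

lemma truncated_prior_support:
  assumes "truncated_prior prior" "i \<in> {1..q}" "\<bar>b i\<bar> > B"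
  shows "prior_density prior q B b = 0"
  using assms by (cases prior) (auto intro!: prod_zero bexI[of _ i])

text \<open>
  The normalising constant of the truncated normal prior.
\<close>

lemma normal_window_measure:
  assumes "\<sigma> > 0"
  shows "measure (density lborel (\<lambda>t. ennreal (normal_density 0 \<sigma> t))) {t. \<bar>t\<bar> \<le> B} \<le> 1"
    and "ennreal (measure (density lborel (\<lambda>t. ennreal (normal_density 0 \<sigma> t))) {t. \<bar>t\<bar> \<le> B})
      = (\<integral>\<^sup>+t. ennreal (indicator {t. \<bar>t\<bar> \<le> B} t * normal_density 0 \<sigma> t) \<partial>lborel)"
    and "B > 0 \<Longrightarrow> measure (density lborel (\<lambda>t. ennreal (normal_density 0 \<sigma> t))) {t. \<bar>t\<bar> \<le> B} > 0"
proof -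
  let ?N = "density lborel (\<lambda>t. ennreal (normal_density 0 \<sigma> t))"
  interpret prob_space ?N by (rule prob_space_normal_density[OF assms])
  show "measure ?N {t. \<bar>t\<bar> \<le> B} \<le> 1" by (rule prob_le_1)
  have e: "emeasure ?N {t. \<bar>t\<bar> \<le> B} = (\<integral>\<^sup>+t. ennreal (indicator {t. \<bar>t\<bar> \<le> B} t * normal_density 0 \<sigma> t) \<partial>lborel)"
    by (subst emeasure_density) (auto intro!: nn_integral_cong simp: indicator_def)
  then show "ennreal (measure ?N {t. \<bar>t\<bar> \<le> B}) = (\<integral>\<^sup>+t. ennreal (indicator {t. \<bar>t\<bar> \<le> B} t * normal_density 0 \<sigma> t) \<partial>lborel)"
    by (simp add: emeasure_eq_measure)
  assume B: "B > 0"
  show "measure ?N {t. \<bar>t\<bar> \<le> B} > 0"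
  proof (rule ccontr)
    assume "\<not> ?thesis"
    then have "measure ?N {t. \<bar>t\<bar> \<le> B} = 0" using measure_nonneg[of ?N] by (metis linorder_neqE_linordered_idom not_less)
    then have "(\<integral>\<^sup>+t. ennreal (indicator {t. \<bar>t\<bar> \<le> B} t * normal_density 0 \<sigma> t) \<partial>lborel) = 0"
      using e by (simp add: emeasure_eq_measure)
    then have "AE t in lborel. ennreal (indicator {t. \<bar>t\<bar> \<le> B} t * normal_density 0 \<sigma> t) = 0"
      by (subst (asm) nn_integral_0_iff_AE) auto
    then have "AE t in lborel. t \<notin> {-B..B}"
    proof eventually_elim
      case (elim t)
      then show ?case
        using normal_density_pos[OF assms, of 0 t] by (cases "\<bar>t\<bar> \<le> B") auto
    qed
    then have "emeasure lborel {-B..B} = 0"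
      by (subst (asm) AE_iff_null_sets[symmetric]) auto
    with B show False by simp
  qed
qed

lemma truncated_prior_total_mass:
  assumes "valid_prior prior" "truncated_prior prior" "B > 0"
  shows "(\<integral>\<^sup>+b. ennreal (prior_density prior q B b) \<partial>lebesgue_coeff q) \<le> 1"
proof (cases prior)
  case Uniform
  let ?f = "\<lambda>t. indicator {t. \<bar>t\<bar> \<le> B} t / (2 * B) :: real"
  have f0: "?f t \<ge> 0" for t using assms by (auto simp: indicator_def)
  have one: "(\<integral>\<^sup>+t. ennreal (?f t) \<partial>lborel) = 1"
  proof -
    have "(\<integral>\<^sup>+t. ennreal (?f t) \<partial>lborel) = (\<integral>\<^sup>+t. ennreal (1 / (2 * B)) * indicator {-B..B} t \<partial>lborel)"
      by (intro nn_integral_cong) (auto simp: indicator_def abs_le_iff)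
    also have "\<dots> = ennreal (1 / (2 * B)) * ennreal (2 * B)"
      using assms by (subst nn_integral_cmult_indicator) auto
    also have "\<dots> = 1" using assms by (simp add: ennreal_mult[symmetric])
    finally show ?thesis .
  qed
  have "(\<integral>\<^sup>+b. ennreal (prior_density prior q B b) \<partial>lebesgue_coeff q)
      = (\<integral>\<^sup>+b. (\<Prod>i=1..q. ennreal (?f (b i))) \<partial>lebesgue_coeff q)"
    unfolding Uniform prior_density.simps by (subst prod_ennreal) (use f0 in auto)
  also have "\<dots> = (\<Prod>i=1..q. \<integral>\<^sup>+t. ennreal (?f t) \<partial>lborel)"
    by (rule nn_integral_coeff_prod) measurable
  finally show ?thesis by (simp add: one)
next
  case (Truncated_Normal \<sigma>)
  then have \<sigma>: "\<sigma> > 0" using assms by simp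
  let ?c = "measure (density lborel (\<lambda>t. ennreal (normal_density 0 \<sigma> t))) {t. \<bar>t\<bar> \<le> B}"
  let ?f = "\<lambda>t. indicator {t. \<bar>t\<bar> \<le> B} t * normal_density 0 \<sigma> t / ?c"
  have c: "?c > 0" by (rule normal_window_measure(3)[OF \<sigma> assms(3)])
  have f0: "?f t \<ge> 0" for t by (auto simp: indicator_def)
  have one: "(\<integral>\<^sup>+t. ennreal (?f t) \<partial>lborel) = 1"
  proof -
    have "(\<integral>\<^sup>+t. ennreal (?f t) \<partial>lborel)
        = (\<integral>\<^sup>+t. ennreal (indicator {t. \<bar>t\<bar> \<le> B} t * normal_density 0 \<sigma> t) / ennreal ?c \<partial>lborel)"
      using c by (intro nn_integral_cong) (simp add: divide_ennreal)
    also have "\<dots> = (\<integral>\<^sup>+t. ennreal (indicator {t. \<bar>t\<bar> \<le> B} t * normal_density 0 \<sigma> t) \<partial>lborel) / ennreal ?c"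
      by (rule nn_integral_divide) measurable
    also have "\<dots> = 1"
      unfolding normal_window_measure(2)[OF \<sigma>, symmetric] using c by (simp add: divide_ennreal)
    finally show ?thesis .
  qed
  have "(\<integral>\<^sup>+b. ennreal (prior_density prior q B b) \<partial>lebesgue_coeff q)
      = (\<integral>\<^sup>+b. (\<Prod>i=1..q. ennreal (?f (b i))) \<partial>lebesgue_coeff q)"
    unfolding Truncated_Normal prior_density.simps by (subst prod_ennreal) (use f0 in auto)
  also have "\<dots> = (\<Prod>i=1..q. \<integral>\<^sup>+t. ennreal (?f t) \<partial>lborel)"
    by (rule nn_integral_coeff_prod) measurable
  finally show ?thesis by (simp add: one)
qed (use assms in auto)

lemma uniform_prior_local:
  assumes "B > 0" "\<And>i. i \<in> {1..q} \<Longrightarrow> \<bar>b i\<bar> \<le> B"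
  shows "prior_density Uniform q B b = (1 / (2 * B)) ^ q"
  using assms by (simp add: indicator_def)

text \<open>
  Truncation divides each normal density by a constant at most one, hence can only increase it inside
  the window.
\<close>

lemma truncated_normal_prior_local:
  assumes \<sigma>: "\<sigma> > 0" and R: "R \<le> B" "R > 0" and b: "\<And>i. i \<in> {1..q} \<Longrightarrow> \<bar>b i\<bar> \<le> R"
  shows "prior_density (Truncated_Normal \<sigma>) q B b \<ge> (normal_density 0 \<sigma> R) ^ q"
proof -
  let ?c = "measure (density lborel (\<lambda>t. ennreal (normal_density 0 \<sigma> t))) {t. \<bar>t\<bar> \<le> B}"
  have c: "0 < ?c" "?c \<le> 1" using normal_window_measure[OF \<sigma>, of B] R by auto
  have "(\<Prod>i=1..q. normal_density 0 \<sigma> R)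
      \<le> (\<Prod>i=1..q. indicator {t. \<bar>t\<bar> \<le> B} (b i) * normal_density 0 \<sigma> (b i) / ?c)"
  proof (intro prod_mono conjI)
    fix i assume i: "i \<in> {1..q}"
    have "(b i)\<^sup>2 \<le> R\<^sup>2" using power_mono[OF b[OF i], of 2] by simp
    then have "normal_density 0 \<sigma> R \<le> normal_density 0 \<sigma> (b i)"
      unfolding normal_density_def using \<sigma> by (intro mult_left_mono) (auto simp: divide_right_mono)
    also have "\<dots> \<le> normal_density 0 \<sigma> (b i) / ?c"
      using c by (simp add: field_simps mult_left_le)
    finally show "normal_density 0 \<sigma> R \<le> indicator {t. \<bar>t\<bar> \<le> B} (b i) * normal_density 0 \<sigma> (b i) / ?c"
      using b[OF i] R by (simp add: indicator_def)
  qed auto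
  then show ?thesis by simp
qed

lemma sphere_area_step:
  assumes "q \<ge> 1" shows "sphere_area (q + 2) = sphere_area q * (2 * pi / real q)"
proof -
  have "Gamma (real q / 2 + 1) = real q / 2 * Gamma (real q / 2)"
    using assms by (intro Gamma_plus1) (auto elim!: nonpos_Ints_cases)
  moreover have half: "real (q + 2) / 2 = real q / 2 + 1" by simp
  ultimately have G: "Gamma (real (q + 2) / 2) = real q / 2 * Gamma (real q / 2)" by (simp only:)
  have p: "pi powr (real (q + 2) / 2) = pi powr (real q / 2) * pi"
    unfolding half powr_add by simp
  have law: "2 * (a * b) / (x / 2 * g) = 2 * a / g * (2 * b / x)" for a b x g :: real
    by (cases "x = 0 \<or> g = 0") (auto simp: field_simps)
  show ?thesis unfolding sphere_area_def G p by (rule law)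
qed

text \<open>
  Crude bounds suffice, since factors \<open>exp(O(q log q))\<close> are negligible for the posterior. Both
  propagate along the recursion \<open>sphere_area_step\<close> from the values in dimensions one and two.
\<close>

lemma sphere_area_bounds:
  assumes "q \<ge> 1" shows "sphere_area q \<le> 7 ^ q \<and> 1 / real q ^ q \<le> sphere_area q"
  using assms
proof (induction q rule: less_induct)
  case (less q)
  define p where "p = q - 2"
  consider "q = 1" | "q = 2" | "q = p + 2" "p \<ge> 1" using less.prems unfolding p_def by linarith
  then show ?case
  proof cases
    case 1
    then show ?thesis by (simp add: sphere_area_def Gamma_one_half_real powr_half_sqrt)
  next
    case 2
    then show ?thesis using pi_less_4 pi_gt3 by (simp add: sphere_area_def)
  next
    case 3
    have IH: "sphere_area p \<le> 7 ^ p" "1 / real p ^ p \<le> sphere_area p" using less.IH[of p] 3 by auto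
    have pi7: "2 * pi / real p \<le> 49"
      using 3 pi_less_4 by (simp add: field_simps)
    have "sphere_area q \<le> 7 ^ p * 49"
      unfolding 3(1) sphere_area_step[OF 3(2)] using IH(1) pi7 3 by (intro mult_mono) auto
    moreover have "1 / real q ^ q \<le> sphere_area q"
    proof -
      have "real p ^ p * real p \<le> real q ^ p * (real q)\<^sup>2"
        using 3 by (intro mult_mono power_mono) (auto simp: power2_eq_square algebra_simps)
      also have "\<dots> = real q ^ q" using 3 by (simp add: power2_eq_square)
      finally have "1 / real q ^ q \<le> 1 / (real p ^ p * real p)"
        using 3 by (intro divide_left_mono mult_pos_pos) auto
      also have "\<dots> = 1 / real p ^ p * (1 / real p)" by simp
      also have "\<dots> \<le> sphere_area p * (2 * pi / real p)"
        using IH(2) 3 pi_gt3 by (intro mult_mono divide_right_mono order_trans[OF _ IH(2)]) auto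
      finally show ?thesis unfolding 3(1) sphere_area_step[OF 3(2)] .
    qed
    ultimately show ?thesis using 3 by (simp add: power_add)
  qed
qed

section \<open>The thin-tail prior\<close>

text \<open>
  Every point of the punctured unit ball has its norm in one of the shells on which the radial
  density is comparable to a constant.
\<close>

lemma dyadic_shell:
  fixes x :: real
  assumes "0 < x" "x \<le> 1"
  obtains m :: nat where "2 powr (- real (Suc m)) \<le> x" "x \<le> 2 powr (- real m)"
proof
  define m where "m = nat \<lfloor>- log 2 x\<rfloor>"
  have "log 2 x \<le> 0" using assms by (simp add: log_le_zero_cancel_iff)
  then have m: "real m \<le> - log 2 x" "- log 2 x < real m + 1" unfolding m_def by linarith+
  have x: "x = 2 powr (log 2 x)" using assms by simp
  show "2 powr (- real (Suc m)) \<le> x" by (subst x, rule powr_mono) (use m in auto)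
  show "x \<le> 2 powr (- real m)" by (subst x, rule powr_mono) (use m in auto)
qed

text \<open>
  For \<open>q > r\<close> the density \<open>|b|\<^bsup>r - q\<^esup>\<close> is unbounded at the origin. On the shell
  \<open>2\<^bsup>-m-1\<^esup> \<le> |b| \<le> 2\<^bsup>-m\<^esup>\<close> it is at most \<open>2\<^bsup>(m+1)(q-r)\<^esup>\<close>, and the shell lies in a cube
  of volume \<open>2\<^bsup>(1-m)q\<^esup>\<close>; the products form a geometric series.
\<close>

lemma radial_singularity_mass:
  assumes r: "1 \<le> r" "r \<le> real q"
  shows "(\<integral>\<^sup>+b. ennreal (indicator {b. L2_set b {1..q} \<le> 1} b * L2_set b {1..q} powr (r - real q))
      \<partial>lebesgue_coeff q) \<le> ennreal (4 ^ q)"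
proof -
  let ?N = "\<lambda>b :: nat \<Rightarrow> real. L2_set b {1..q}"
  define a where "a m = 2 powr (real (Suc m) * (real q - r))" for m :: nat
  define s where "s m = 2 powr (- real m)" for m :: nat
  have pointwise: "ennreal (indicator {b. ?N b \<le> 1} b * ?N b powr (r - real q))
      \<le> (\<Sum>m. ennreal (a m) * indicator (coeff_cube q (\<lambda>_. 0) (s m)) b)"
    if b: "b \<in> space (lebesgue_coeff q)" for b
  proof (cases "0 < ?N b \<and> ?N b \<le> 1")
    case True
    then obtain m where m: "2 powr (- real (Suc m)) \<le> ?N b" "?N b \<le> s m"
      unfolding s_def using dyadic_shell by blast
    have "?N b powr (r - real q) \<le> (2 powr (- real (Suc m))) powr (r - real q)"
      using r m(1) by (intro powr_mono2') auto
    also have "\<dots> = a m" by (simp add: a_def powr_powr algebra_simps)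
    finally have "ennreal (indicator {b. ?N b \<le> 1} b * ?N b powr (r - real q)) \<le> ennreal (a m)"
      using True by (simp add: ennreal_leI)
    moreover have "b \<in> coeff_cube q (\<lambda>_. 0) (s m)"
    proof -
      have "\<bar>b i\<bar> \<le> s m" if "i \<in> {1..q}" for i using abs_le_L2_set[OF that, of b] m(2) by linarith
      then have "b i \<in> {0 - s m..0 + s m}" if "i \<in> {1..q}" for i using that by (fastforce simp: abs_le_iff)
      then show ?thesis using b unfolding space_lebesgue_coeff by (auto simp: PiE_def)
    qed
    ultimately have "ennreal (indicator {b. ?N b \<le> 1} b * ?N b powr (r - real q))
        \<le> (\<Sum>m\<in>{m}. ennreal (a m) * indicator (coeff_cube q (\<lambda>_. 0) (s m)) b)" by simp
    also have "\<dots> \<le> (\<Sum>m. ennreal (a m) * indicator (coeff_cube q (\<lambda>_. 0) (s m)) b)"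
      by (rule sum_le_suminf) auto
    finally show ?thesis .
  next
    case False
    then have "?N b = 0 \<or> \<not> ?N b \<le> 1" using L2_set_nonneg[of b "{1..q}"] by linarith
    then show ?thesis by auto
  qed
  have shell: "ennreal (a m) * emeasure (lebesgue_coeff q) (coeff_cube q (\<lambda>_. 0) (s m))
      \<le> ennreal (4 ^ q * (1 / 2) ^ Suc m)" for m
  proof -
    have "a m * (2 * s m) ^ q = 2 powr (real (Suc m) * (real q - r) + real q * (1 - real m))"
      by (simp add: a_def s_def powr_add powr_realpow[symmetric] powr_mult powr_powr powr_diff[symmetric]
          algebra_simps flip: powr_minus powr_add)
    also have "\<dots> \<le> 2 powr (2 * real q - real (Suc m))"
    proof (rule powr_mono)
      have "real (Suc m) * 1 \<le> real (Suc m) * r" using r by (intro mult_left_mono) auto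
      then show "real (Suc m) * (real q - r) + real q * (1 - real m) \<le> 2 * real q - real (Suc m)"
        by (simp add: algebra_simps)
    qed simp
    also have "\<dots> = 4 ^ q * (1 / 2) ^ Suc m"
    proof -
      have "2 powr (2 * real q) = (4::real) ^ q" by (simp add: powr_realpow[symmetric] powr_powr[symmetric])
      moreover have "2 powr real (Suc m) = (2::real) ^ Suc m" by (rule powr_realpow) simp
      ultimately show ?thesis by (simp only: powr_diff power_one_over) simp
    qed
    finally show ?thesis
      by (subst emeasure_coeff_cube) (auto simp: s_def a_def ennreal_mult[symmetric] intro!: ennreal_leI)
  qed
  have "(\<integral>\<^sup>+b. ennreal (indicator {b. ?N b \<le> 1} b * ?N b powr (r - real q)) \<partial>lebesgue_coeff q)
      \<le> (\<integral>\<^sup>+b. (\<Sum>m. ennreal (a m) * indicator (coeff_cube q (\<lambda>_. 0) (s m)) b) \<partial>lebesgue_coeff q)"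
    using pointwise by (rule nn_integral_mono)
  also have "\<dots> = (\<Sum>m. \<integral>\<^sup>+b. ennreal (a m) * indicator (coeff_cube q (\<lambda>_. 0) (s m)) b \<partial>lebesgue_coeff q)"
    by (rule nn_integral_suminf) measurable
  also have "\<dots> = (\<Sum>m. ennreal (a m) * emeasure (lebesgue_coeff q) (coeff_cube q (\<lambda>_. 0) (s m)))"
    by (intro suminf_cong nn_integral_cmult_indicator) measurable
  also have "\<dots> \<le> (\<Sum>m. ennreal (4 ^ q * (1 / 2) ^ Suc m))"
    by (intro suminf_le shell) auto
  also have "\<dots> = ennreal (4 ^ q)"
  proof (rule suminf_ennreal_eq)
    show "(\<lambda>m. 4 ^ q * (1 / 2) ^ Suc m :: real) sums 4 ^ q"
      using sums_mult[OF power_half_series, of "4 ^ q"] by simp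
  qed simp
  finally show ?thesis .
qed

text \<open>
  The squared Euclidean norm is a sum over coordinates, so the integral factorises into
  one-dimensional normal integrals.
\<close>

lemma gaussian_coeff_mass:
  assumes a: "a > 0"
  shows "(\<integral>\<^sup>+b. ennreal (exp (- (a / 2) * (L2_set b {1..q})\<^sup>2)) \<partial>lebesgue_coeff q) = ennreal (sqrt (2 * pi / a) ^ q)"
proof -
  have one: "(\<integral>\<^sup>+t. ennreal (exp (- (a / 2) * t\<^sup>2)) \<partial>lborel) = ennreal (sqrt (2 * pi / a))"
  proof -
    have s: "1 / sqrt a > 0" using a by simp
    have "exp (- (a / 2) * t\<^sup>2) = sqrt (2 * pi / a) * normal_density 0 (1 / sqrt a) t" for t
      using a by (simp add: normal_density_def power_divide real_sqrt_divide real_sqrt_mult field_simps)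
    then have "(\<integral>\<^sup>+t. ennreal (exp (- (a / 2) * t\<^sup>2)) \<partial>lborel)
        = (\<integral>\<^sup>+t. ennreal (sqrt (2 * pi / a)) * ennreal (normal_density 0 (1 / sqrt a) t) \<partial>lborel)"
      using a by (intro nn_integral_cong) (simp add: ennreal_mult[symmetric])
    also have "\<dots> = ennreal (sqrt (2 * pi / a)) * (\<integral>\<^sup>+t. ennreal (normal_density 0 (1 / sqrt a) t) \<partial>lborel)"
      by (rule nn_integral_cmult) measurable
    also have "(\<integral>\<^sup>+t. ennreal (normal_density 0 (1 / sqrt a) t) \<partial>lborel) = 1"
      using prob_space.emeasure_space_1[OF prob_space_normal_density[OF s, of 0]]
      by (simp add: emeasure_density)
    finally show ?thesis by simp
  qed
  have "ennreal (exp (- (a / 2) * (L2_set b {1..q})\<^sup>2)) = (\<Prod>i=1..q. ennreal (exp (- (a / 2) * (b i)\<^sup>2)))" for b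
    by (simp add: prod_ennreal exp_sum[symmetric] L2_set_def sum_nonneg sum_distrib_left)
  then have "(\<integral>\<^sup>+b. ennreal (exp (- (a / 2) * (L2_set b {1..q})\<^sup>2)) \<partial>lebesgue_coeff q)
      = (\<Prod>i=1..q. \<integral>\<^sup>+t. ennreal (exp (- (a / 2) * t\<^sup>2)) \<partial>lborel)"
    by (simp only:) (rule nn_integral_coeff_prod, measurable)
  then show ?thesis unfolding one using a by (simp add: ennreal_power)
qed

lemma inverse_sphere_area_le:
  assumes "q \<ge> 1" shows "1 / sphere_area q \<le> real q ^ q" "sphere_area q > 0"
proof -
  have b: "1 / real q ^ q \<le> sphere_area q" using sphere_area_bounds[OF assms] by blast
  moreover have "0 < 1 / real q ^ q" using assms by simp
  ultimately show p: "sphere_area q > 0" by linarith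
  show "1 / sphere_area q \<le> real q ^ q"
    using b p assms by (simp add: field_simps)
qed

lemma thin_tail_density_eq:
  "prior_density (Thin_Tail r \<beta>) q B b =
     r * \<beta> powr r * (L2_set b {1..q} powr (r - real q) * exp (- (\<beta> powr r) * L2_set b {1..q} powr r))
       * (1 / sphere_area q)"
  by simp

text \<open>
  For \<open>|b| > R \<ge> 1\<close> the factor \<open>|b|\<^bsup>r - q\<^esup>\<close> is at most one. Half of the exponent yields the
  tail factor at \<open>R\<close>, and because \<open>|b|\<^sup>r \<ge> |b|\<^sup>2\<close> there, the other half is dominated by a Gaussian.
\<close>

lemma thin_tail_tail_mass:
  assumes r: "2 \<le> r" "r \<le> real q" and \<beta>: "\<beta> > 0" and R: "R \<ge> 1"
  shows "(\<integral>\<^sup>+b. ennreal (prior_density (Thin_Tail r \<beta>) q B b) * indicator {b. L2_set b {1..q} > R} b \<partial>lebesgue_coeff q)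
    \<le> ennreal (r * \<beta> powr r * real q ^ q * sqrt (2 * pi / \<beta> powr r) ^ q * exp (- (\<beta> powr r * R powr r / 2)))"
proof -
  let ?N = "\<lambda>b :: nat \<Rightarrow> real. L2_set b {1..q}"
  define a where "a = \<beta> powr r"
  have a: "a > 0" using \<beta> by (simp add: a_def)
  have q: "q \<ge> 1" using r by (cases q) auto
  let ?c = "r * a * real q ^ q * exp (- (a * R powr r / 2))"
  have pointwise: "ennreal (prior_density (Thin_Tail r \<beta>) q B b) * indicator {b. ?N b > R} b
      \<le> ennreal ?c * ennreal (exp (- (a / 2) * (?N b)\<^sup>2))" for b
  proof (cases "?N b > R")
    case True
    then have N: "?N b \<ge> 1" using R by linarith
    have "?N b powr (r - real q) \<le> ?N b powr 0" using N r by (intro powr_mono) auto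
    then have one: "?N b powr (r - real q) \<le> 1" using N by simp
    have "(?N b)\<^sup>2 = ?N b powr 2" using N by (simp add: powr_numeral)
    also have "\<dots> \<le> ?N b powr r" using N r by (intro powr_mono) auto
    finally have "a * (?N b)\<^sup>2 \<le> a * ?N b powr r" using a by (intro mult_left_mono) auto
    moreover have "a * R powr r \<le> a * ?N b powr r"
      using True R r a by (intro mult_left_mono powr_mono2) auto
    ultimately have "- a * ?N b powr r \<le> - (a * R powr r / 2) + - (a / 2) * (?N b)\<^sup>2" by simp
    then have e: "exp (- a * ?N b powr r) \<le> exp (- (a * R powr r / 2)) * exp (- (a / 2) * (?N b)\<^sup>2)"
      unfolding exp_add[symmetric] by (simp only: exp_le_cancel_iff)
    have radial: "?N b powr (r - real q) * exp (- a * ?N b powr r)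
        \<le> 1 * (exp (- (a * R powr r / 2)) * exp (- (a / 2) * (?N b)\<^sup>2))"
      using one e by (intro mult_mono) auto
    then have "prior_density (Thin_Tail r \<beta>) q B b
        \<le> r * a * (1 * (exp (- (a * R powr r / 2)) * exp (- (a / 2) * (?N b)\<^sup>2))) * real q ^ q"
      unfolding thin_tail_density_eq a_def[symmetric] using r a inverse_sphere_area_le[OF q]
      by (intro mult_mono[OF mult_left_mono[OF radial]]) auto
    also have "\<dots> = ?c * exp (- (a / 2) * (?N b)\<^sup>2)" by simp
    finally show ?thesis
      using True r a by (simp add: ennreal_mult[symmetric] ennreal_leI del: prior_density.simps)
  qed simp
  have "(\<integral>\<^sup>+b. ennreal (prior_density (Thin_Tail r \<beta>) q B b) * indicator {b. ?N b > R} b \<partial>lebesgue_coeff q)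
      \<le> (\<integral>\<^sup>+b. ennreal ?c * ennreal (exp (- (a / 2) * (?N b)\<^sup>2)) \<partial>lebesgue_coeff q)"
    by (intro nn_integral_mono pointwise)
  also have "\<dots> = ennreal ?c * ennreal (sqrt (2 * pi / a) ^ q)"
    by (subst nn_integral_cmult) (measurable, simp only: gaussian_coeff_mass[OF a])
  also have "\<dots> = ennreal (r * a * real q ^ q * sqrt (2 * pi / a) ^ q * exp (- (a * R powr r / 2)))"
    using r a by (simp add: ennreal_mult[symmetric] mult_ac)
  finally show ?thesis unfolding a_def .
qed

text \<open>
  The exponential factor is at most one near the origin, where only the singularity matters; the
  remainder is the tail beyond radius one.
\<close>

lemma thin_tail_total_mass:
  assumes r: "2 \<le> r" "r \<le> real q" and \<beta>: "\<beta> > 0"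
  shows "(\<integral>\<^sup>+b. ennreal (prior_density (Thin_Tail r \<beta>) q B b) \<partial>lebesgue_coeff q)
    \<le> ennreal (r * \<beta> powr r * real q ^ q * (4 ^ q + sqrt (2 * pi / \<beta> powr r) ^ q))"
proof -
  let ?N = "\<lambda>b :: nat \<Rightarrow> real. L2_set b {1..q}"
  let ?\<pi> = "prior_density (Thin_Tail r \<beta>) q B"
  define a where "a = \<beta> powr r"
  have a: "a > 0" using \<beta> by (simp add: a_def)
  have q: "q \<ge> 1" using r by (cases q) auto
  let ?c = "r * a * real q ^ q"
  let ?near = "\<lambda>b. ennreal (indicator {b. ?N b \<le> 1} b * ?N b powr (r - real q))"
  have near: "ennreal (?\<pi> b) \<le> ennreal ?c * ?near b + ennreal (?\<pi> b) * indicator {b. ?N b > 1} b" for b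
  proof (cases "?N b \<le> 1")
    case True
    have "?N b powr (r - real q) * exp (- a * ?N b powr r) \<le> ?N b powr (r - real q) * 1"
      using a by (intro mult_left_mono) auto
    then have "?\<pi> b \<le> r * a * (?N b powr (r - real q) * 1) * real q ^ q"
      unfolding thin_tail_density_eq a_def[symmetric] using r a inverse_sphere_area_le[OF q]
      by (intro mult_mono mult_left_mono) auto
    then have "?\<pi> b \<le> ?c * ?N b powr (r - real q)" by (simp add: mult_ac)
    with True show ?thesis
      using r a by (simp add: ennreal_mult[symmetric] ennreal_leI del: prior_density.simps)
  qed (simp del: prior_density.simps)
  have [measurable]: "?\<pi> \<in> borel_measurable (lebesgue_coeff q)" by (rule prior_density_measurable)
  have meas1: "(\<lambda>b. ennreal ?c * ?near b) \<in> borel_measurable (lebesgue_coeff q)"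
    by measurable
  have meas2: "(\<lambda>b. ennreal (?\<pi> b) * indicator {b. ?N b > 1} b) \<in> borel_measurable (lebesgue_coeff q)"
    by measurable
  have "(\<integral>\<^sup>+b. ennreal (?\<pi> b) \<partial>lebesgue_coeff q)
      \<le> (\<integral>\<^sup>+b. ennreal ?c * ?near b + ennreal (?\<pi> b) * indicator {b. ?N b > 1} b \<partial>lebesgue_coeff q)"
    by (intro nn_integral_mono near)
  also have "\<dots> = (\<integral>\<^sup>+b. ennreal ?c * ?near b \<partial>lebesgue_coeff q)
      + (\<integral>\<^sup>+b. ennreal (?\<pi> b) * indicator {b. ?N b > 1} b \<partial>lebesgue_coeff q)"
    by (rule nn_integral_add[OF meas1 meas2])
  also have "(\<integral>\<^sup>+b. ennreal ?c * ?near b \<partial>lebesgue_coeff q) = ennreal ?c * (\<integral>\<^sup>+b. ?near b \<partial>lebesgue_coeff q)"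
    by (rule nn_integral_cmult) measurable
  also have "\<dots> + (\<integral>\<^sup>+b. ennreal (?\<pi> b) * indicator {b. ?N b > 1} b \<partial>lebesgue_coeff q)
      \<le> ennreal ?c * ennreal (4 ^ q) + ennreal (?c * sqrt (2 * pi / a) ^ q * exp (- (a * 1 powr r / 2)))"
    using thin_tail_tail_mass[OF r \<beta>, of 1 B] r
    by (intro add_mono mult_left_mono radial_singularity_mass) (auto simp: a_def simp del: prior_density.simps)
  also have "\<dots> \<le> ennreal ?c * ennreal (4 ^ q) + ennreal (?c * sqrt (2 * pi / a) ^ q * 1)"
    using r a by (intro add_mono ennreal_leI mult_left_mono) auto
  also have "\<dots> = ennreal (?c * (4 ^ q + sqrt (2 * pi / a) ^ q))"
    using r a by (simp add: ennreal_mult[symmetric] ennreal_plus[symmetric] distrib_left del: ennreal_plus)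
  finally show ?thesis unfolding a_def .
qed

text \<open>
  For \<open>q \<ge> r\<close> both radial factors decrease in \<open>|b|\<close>, so their values at radius \<open>R\<close> bound them from
  below.
\<close>

lemma thin_tail_local:
  assumes r: "1 \<le> r" "r \<le> real q" and \<beta>: "\<beta> > 0" and R: "R \<ge> 1"
    and N: "0 < L2_set b {1..q}" "L2_set b {1..q} \<le> R"
  shows "r * \<beta> powr r * exp (- (\<beta> powr r) * R powr r) * (1 / (7 * R)) ^ q
    \<le> prior_density (Thin_Tail r \<beta>) q B b"
proof -
  let ?N = "L2_set b {1..q}"
  have q: "q \<ge> 1" using r by (cases q) auto
  have "(1 / R) ^ q = R powr (- real q)" using R by (simp add: powr_minus powr_realpow power_one_over divide_inverse power_inverse)
  also have "\<dots> \<le> R powr (r - real q)" using R r by (intro powr_mono) auto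
  also have "\<dots> \<le> ?N powr (r - real q)" using N r by (intro powr_mono2') auto
  finally have p: "(1 / R) ^ q \<le> ?N powr (r - real q)" .
  have "\<beta> powr r * ?N powr r \<le> \<beta> powr r * R powr r" using N r by (intro mult_left_mono powr_mono2) auto
  then have e: "exp (- (\<beta> powr r) * R powr r) \<le> exp (- (\<beta> powr r) * ?N powr r)" by simp
  have "(1 / 7) ^ q \<le> 1 / sphere_area q"
    using sphere_area_bounds[OF q] inverse_sphere_area_le(2)[OF q] by (simp add: power_one_over frac_le)
  then have "r * \<beta> powr r * ((1 / R) ^ q * exp (- (\<beta> powr r) * R powr r)) * (1 / 7) ^ q
      \<le> prior_density (Thin_Tail r \<beta>) q B b"
    unfolding thin_tail_density_eq using p e r R \<beta> by (intro mult_mono mult_left_mono) auto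
  then show ?thesis by (simp add: power_one_over power_mult_distrib mult_ac del: prior_density.simps)
qed

section \<open>The quasi-posterior for a fixed sample size\<close>

text \<open>
  The numerator splits into the part of \<open>A\<close> in the cube of radius \<open>R\<close>, where the criterion is at
  least \<open>l\<close>, and the prior tail, on which the likelihood factor is bounded by one. The denominator
  is bounded below by its integral over a small cube on which the criterion is at most \<open>u\<close>.
\<close>

lemma posterior_ratio_bound:
  fixes \<pi> G :: "(nat \<Rightarrow> real) \<Rightarrow> real" and n :: nat
  defines "w \<equiv> \<lambda>b. \<pi> b * exp (- (real n / 2) * G b)"
  assumes \<pi>: "\<pi> \<in> borel_measurable (lebesgue_coeff q)" "\<And>b. \<pi> b \<ge> 0"
    and G: "G \<in> borel_measurable (lebesgue_coeff q)" "\<And>b. G b \<ge> 0"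
    and A: "A \<inter> space (lebesgue_coeff q) \<in> sets (lebesgue_coeff q)"
    and total: "(\<integral>\<^sup>+b. ennreal (\<pi> b) \<partial>lebesgue_coeff q) \<le> ennreal Mt" and Mt: "Mt \<ge> 0"
    and tail: "(\<integral>\<^sup>+b. ennreal (\<pi> b) * indicator {b. \<exists>i\<in>{1..q}. \<bar>b i\<bar> > R} b \<partial>lebesgue_coeff q) \<le> ennreal Ml"
    and Ml: "Ml \<ge> 0"
    and cube: "AE b in lebesgue_coeff q. b \<in> coeff_cube q a s \<longrightarrow> \<kappa> \<le> \<pi> b \<and> G b \<le> u"
    and \<kappa>: "\<kappa> > 0" and s: "s > 0"
    and away: "\<And>b. b \<in> A \<Longrightarrow> (\<And>i. i \<in> {1..q} \<Longrightarrow> \<bar>b i\<bar> \<le> R) \<Longrightarrow> l \<le> G b"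
  shows "0 \<le> (\<integral>b. indicator A b * w b \<partial>lebesgue_coeff q) / (\<integral>b. w b \<partial>lebesgue_coeff q)"
    and "(\<integral>b. indicator A b * w b \<partial>lebesgue_coeff q) / (\<integral>b. w b \<partial>lebesgue_coeff q)
      \<le> (Mt * exp (- (real n / 2) * l) + Ml) / (\<kappa> * (2 * s) ^ q * exp (- (real n / 2) * u))"
proof -
  let ?\<Lambda> = "lebesgue_coeff q"
  let ?T = "{b. \<exists>i\<in>{1..q}. \<bar>b i\<bar> > R}"
  let ?num = "\<integral>b. indicator A b * w b \<partial>?\<Lambda>" and ?den = "\<integral>b. w b \<partial>?\<Lambda>"
  note [measurable] = \<pi>(1) G(1)
  have w0: "w b \<ge> 0" for b unfolding w_def using \<pi>(2) by simp
  have w\<pi>: "w b \<le> \<pi> b" for b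
    unfolding w_def using \<pi>(2)[of b] G(2)[of b] by (intro mult_left_le) auto
  have wm [measurable]: "w \<in> borel_measurable ?\<Lambda>" unfolding w_def by measurable
  have Tm: "?T \<inter> space ?\<Lambda> \<in> sets ?\<Lambda>"
  proof -
    have "?T \<inter> space ?\<Lambda> = (\<Union>i\<in>{1..q}. {b \<in> space ?\<Lambda>. \<bar>b i\<bar> > R})" by auto
    also have "\<dots> \<in> sets ?\<Lambda>"
    proof (intro sets.finite_UN)
      fix i assume "i \<in> {1..q}"
      note [measurable] = coeff_component_measurable[OF this]
      show "{b \<in> space ?\<Lambda>. \<bar>b i\<bar> > R} \<in> sets ?\<Lambda>" by measurable
    qed simp
    finally show ?thesis .
  qed
  have Am: "(indicator A :: _ \<Rightarrow> real) \<in> borel_measurable ?\<Lambda>"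
    using A by (simp add: borel_measurable_indicator_iff)
  have Tm': "(indicator ?T :: _ \<Rightarrow> ennreal) \<in> borel_measurable ?\<Lambda>"
    using Tm by (simp add: borel_measurable_indicator_iff)
  have wint: "integrable ?\<Lambda> w"
  proof (rule integrableI_nonneg)
    have "(\<integral>\<^sup>+b. ennreal (w b) \<partial>?\<Lambda>) \<le> (\<integral>\<^sup>+b. ennreal (\<pi> b) \<partial>?\<Lambda>)"
      by (intro nn_integral_mono ennreal_leI w\<pi>)
    also have "\<dots> \<le> ennreal Mt" by (rule total)
    finally show "(\<integral>\<^sup>+b. ennreal (w b) \<partial>?\<Lambda>) < \<infinity>" by (simp add: le_less_trans)
  qed (use w0 in auto)
  have numint: "integrable ?\<Lambda> (\<lambda>b. indicator A b * w b)"
  proof (rule Bochner_Integration.integrable_bound[OF wint])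
    show "(\<lambda>b. indicator A b * w b) \<in> borel_measurable ?\<Lambda>"
      by (intro borel_measurable_times Am wm)
    show "AE b in ?\<Lambda>. norm (indicator A b * w b) \<le> norm (w b)"
      using w0 by (auto simp: indicator_def)
  qed
  have num0: "?num \<ge> 0" using w0 by (intro Bochner_Integration.integral_nonneg) auto
  have den0: "?den \<ge> 0" using w0 by (intro Bochner_Integration.integral_nonneg) auto
  show "0 \<le> ?num / ?den" using num0 den0 by simp
  have "ennreal ?num = (\<integral>\<^sup>+b. ennreal (indicator A b * w b) \<partial>?\<Lambda>)"
    using w0 by (intro nn_integral_eq_integral[symmetric] numint) auto
  also have "\<dots> \<le> (\<integral>\<^sup>+b. ennreal (exp (- (real n / 2) * l)) * ennreal (\<pi> b) + ennreal (\<pi> b) * indicator ?T b \<partial>?\<Lambda>)"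
  proof (intro nn_integral_mono)
    fix b
    show "ennreal (indicator A b * w b)
        \<le> ennreal (exp (- (real n / 2) * l)) * ennreal (\<pi> b) + ennreal (\<pi> b) * indicator ?T b"
    proof (cases "b \<in> ?T")
      case True
      have "ennreal (indicator A b * w b) \<le> ennreal (\<pi> b)"
        using w\<pi>[of b] \<pi>(2)[of b] by (intro ennreal_leI) (auto simp: indicator_def)
      with True show ?thesis by (simp add: add_increasing)
    next
      case False
      have "indicator A b * w b \<le> exp (- (real n / 2) * l) * \<pi> b"
      proof (cases "b \<in> A")
        case True
        have "l \<le> G b" by (rule away[OF True]) (use False in \<open>auto simp: not_less\<close>)
        then have "exp (- (real n / 2) * G b) \<le> exp (- (real n / 2) * l)"
          by (simp add: mult_left_mono)
        then show ?thesis using True \<pi>(2)[of b] by (simp add: w_def mult.commute mult_left_mono)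
      qed (use \<pi>(2) in simp)
      then have "ennreal (indicator A b * w b) \<le> ennreal (exp (- (real n / 2) * l)) * ennreal (\<pi> b)"
        using \<pi>(2)[of b] by (simp add: ennreal_mult[symmetric] ennreal_leI)
      then show ?thesis by (simp add: add_increasing2)
    qed
  qed
  also have "\<dots> = ennreal (exp (- (real n / 2) * l)) * (\<integral>\<^sup>+b. ennreal (\<pi> b) \<partial>?\<Lambda>)
      + (\<integral>\<^sup>+b. ennreal (\<pi> b) * indicator ?T b \<partial>?\<Lambda>)"
    using Tm' by (subst nn_integral_add) (auto simp: nn_integral_cmult)
  also have "\<dots> \<le> ennreal (exp (- (real n / 2) * l)) * ennreal Mt + ennreal Ml"
    by (intro add_mono mult_left_mono total tail) auto
  also have "\<dots> = ennreal (Mt * exp (- (real n / 2) * l) + Ml)"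
    using Mt Ml by (simp add: ennreal_mult[symmetric] ennreal_plus[symmetric] mult.commute del: ennreal_plus)
  finally have num: "?num \<le> Mt * exp (- (real n / 2) * l) + Ml"
    using Mt Ml by (simp add: ennreal_le_iff del: ennreal_plus)
  let ?d = "\<kappa> * (2 * s) ^ q * exp (- (real n / 2) * u)"
  have "ennreal ?d = ennreal (\<kappa> * exp (- (real n / 2) * u)) * emeasure ?\<Lambda> (coeff_cube q a s)"
    using s \<kappa> by (subst emeasure_coeff_cube) (auto simp: ennreal_mult[symmetric] mult_ac)
  also have "\<dots> = (\<integral>\<^sup>+b. ennreal (\<kappa> * exp (- (real n / 2) * u)) * indicator (coeff_cube q a s) b \<partial>?\<Lambda>)"
    by (rule nn_integral_cmult_indicator[OF coeff_cube_sets, symmetric])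
  also have "\<dots> \<le> (\<integral>\<^sup>+b. ennreal (w b) \<partial>?\<Lambda>)"
  proof (rule nn_integral_mono_AE)
    show "AE b in ?\<Lambda>. ennreal (\<kappa> * exp (- (real n / 2) * u)) * indicator (coeff_cube q a s) b \<le> ennreal (w b)"
      using cube
    proof eventually_elim
      case (elim b)
      show ?case
      proof (cases "b \<in> coeff_cube q a s")
        case True
        with elim have "\<kappa> \<le> \<pi> b" "G b \<le> u" by auto
        then have "\<kappa> * exp (- (real n / 2) * u) \<le> w b"
          unfolding w_def using \<kappa> by (intro mult_mono) (auto simp: mult_left_mono)
        then show ?thesis using True by (simp add: ennreal_leI)
      qed simp
    qed
  qed
  also have "\<dots> = ennreal ?den"
    using w0 by (intro nn_integral_eq_integral wint) auto
  finally have den: "?d \<le> ?den" using den0 by (simp add: ennreal_le_iff)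
  have "?d > 0" using s \<kappa> by simp
  with num den num0 show "?num / ?den \<le> (Mt * exp (- (real n / 2) * l) + Ml) / ?d"
    by (intro frac_le) auto
qed

lemma G_bar_sieve_measurable:
  fixes Z :: "nat \<Rightarrow> 'o \<Rightarrow> ('x::euclidean_space, 'd::finite) obs"
  assumes Z: "\<And>i. Z i \<in> measurable M borel"
    and \<phi>: "\<And>i. i \<in> {1..q} \<Longrightarrow> \<phi> i \<in> borel_measurable borel"
  shows "(\<lambda>(\<omega>, b). G_bar n k (\<lambda>i. Z i \<omega>) (sieve_fun \<phi> q b)) \<in> borel_measurable (M \<Otimes>\<^sub>M lebesgue_coeff q)"
proof -
  have [measurable]: "(\<lambda>x. sieve_fun \<phi> q (snd x) (regressor (Z i (fst x)))) \<in> borel_measurable (M \<Otimes>\<^sub>M lebesgue_coeff q)" for i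
    unfolding sieve_fun_def
  proof (intro borel_measurable_sum borel_measurable_times)
    fix l assume l: "l \<in> {1..q}"
    show "(\<lambda>x. snd x l) \<in> borel_measurable (M \<Otimes>\<^sub>M lebesgue_coeff q)"
      by (rule measurable_compose[OF measurable_snd coeff_component_measurable[OF l]])
    note [measurable] = \<phi>[OF l] Z
    show "(\<lambda>x. \<phi> l (regressor (Z i (fst x)))) \<in> borel_measurable (M \<Otimes>\<^sub>M lebesgue_coeff q)"
      by measurable
  qed
  note [measurable] = Z
  show ?thesis unfolding G_bar_def v_hat_def split_beta' by measurable
qed

text \<open>
  Numerator and denominator are parameter integrals of jointly measurable functions of the sample and
  the coefficients.
\<close>

lemma quasi_posterior_measurable:
  fixes Z :: "nat \<Rightarrow> 'o \<Rightarrow> ('x::euclidean_space, 'd::finite) obs"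
  assumes Z: "\<And>i. Z i \<in> measurable M borel"
    and \<phi>: "\<And>i. i \<in> {1..q} \<Longrightarrow> \<phi> i \<in> borel_measurable borel"
    and \<pi>: "\<pi> \<in> borel_measurable (lebesgue_coeff q)"
    and A: "A \<inter> space (lebesgue_coeff q) \<in> sets (lebesgue_coeff q)"
  shows "(\<lambda>\<omega>. quasi_posterior \<pi> \<phi> q k n (\<lambda>i. Z i \<omega>) A) \<in> borel_measurable M"
proof -
  interpret \<Lambda>: sigma_finite_measure "lebesgue_coeff q" by (rule sigma_finite_lebesgue_coeff)
  have [measurable]: "(\<lambda>x. G_bar n k (\<lambda>i. Z i (fst x)) (sieve_fun \<phi> q (snd x)))
      \<in> borel_measurable (M \<Otimes>\<^sub>M lebesgue_coeff q)"
    using G_bar_sieve_measurable[of Z M q \<phi> n k, OF Z \<phi>] by (simp add: split_beta')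
  note [measurable] = \<pi>
  have [measurable]: "(indicator A :: _ \<Rightarrow> real) \<in> borel_measurable (lebesgue_coeff q)"
    using A by (simp add: borel_measurable_indicator_iff)
  show ?thesis
    unfolding quasi_posterior_def
    by (intro borel_measurable_divide \<Lambda>.borel_measurable_lebesgue_integral; unfold split_beta'; measurable)
qed

context sieve_geometry begin

lemma norm_s_sieve_diff_continuous:
  assumes g: "g \<in> L2X P"
  shows "continuous_on UNIV (\<lambda>b :: nat \<Rightarrow> real. norm_s P (\<lambda>x. sieve_fun \<phi> q b x - g x))"
proof -
  have g': "(\<lambda>x. - 1 * g x) \<in> L2X P" by (rule L2X_cmult[OF g])
  have "norm_s P (\<lambda>x. sieve_fun \<phi> q b x - g x)
      = sqrt ((\<Sum>i=1..q. (b i)\<^sup>2) + 2 * (\<Sum>i=1..q. b i * innerX P (\<phi> i) (\<lambda>x. - 1 * g x))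
          + (norm_s P (\<lambda>x. - 1 * g x))\<^sup>2)" for b
  proof -
    have "(norm_s P (\<lambda>x. sieve_fun \<phi> q b x + - 1 * g x))\<^sup>2
      = (\<Sum>i=1..q. (b i)\<^sup>2) + 2 * (\<Sum>i=1..q. b i * innerX P (\<phi> i) (\<lambda>x. - 1 * g x))
          + (norm_s P (\<lambda>x. - 1 * g x))\<^sup>2"
      unfolding norm_s_square_add[OF sieve_fun_L2X g'] norm_s_sieve innerX_sieve_left[OF g'] ..
    moreover have "norm_s P (\<lambda>x. sieve_fun \<phi> q b x + - 1 * g x) \<ge> 0"
      by (simp add: norm_s_def Bochner_Integration.integral_nonneg)
    ultimately show ?thesis
      using real_sqrt_unique[of "norm_s P (\<lambda>x. sieve_fun \<phi> q b x + - 1 * g x)"] by simp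
  qed
  then show ?thesis
    by (simp only:) (intro continuous_intros continuous_on_product_coordinates)
qed

text \<open>
  The distance to the identified set is an infimum over an uncountable family of continuous
  functions of the coefficients, hence upper semicontinuous, and so Borel.
\<close>

lemma far_coefficients_measurable:
  assumes ne: "Theta_I P \<noteq> {}"
  shows "{b. dist_Theta P (sieve_fun \<phi> q b) > \<epsilon>} \<inter> space (lebesgue_coeff q) \<in> sets (lebesgue_coeff q)"
proof -
  let ?F = "\<lambda>b. dist_Theta P (sieve_fun \<phi> q b)"
  have borel: "?F \<in> borel_measurable borel"
  proof (rule borel_measurableI_less)
    fix c
    have "{b \<in> space borel. ?F b < c} = (\<Union>g\<in>Theta_I P. {b. norm_s P (\<lambda>x. sieve_fun \<phi> q b x - g x) < c})"
      unfolding dist_Theta_def using ne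
      by (subst cINF_less_iff) (auto intro!: bdd_belowI[of _ 0] simp: norm_s_def)
    also have "open \<dots>"
      by (intro open_UN ballI open_Collect_less norm_s_sieve_diff_continuous continuous_on_const)
        (simp add: Theta_I_def)
    then have "\<dots> \<in> sets borel" by simp
    finally show "{b \<in> space borel. ?F b < c} \<in> sets borel" .
  qed
  \<comment> \<open>The product topology on all sequences generates the same sets on the first \<open>q\<close> coordinates.\<close>
  let ?e = "\<lambda>b i. if i \<in> {1..q} then b i else (0::real)"
  have "?e \<in> measurable (lebesgue_coeff q) (Pi\<^sub>M UNIV (\<lambda>_. borel))"
  proof (rule measurable_PiM_single')
    fix i show "(\<lambda>b. ?e b i) \<in> borel_measurable (lebesgue_coeff q)"
      using coeff_component_measurable[of i q] by (cases "i \<in> {1..q}") auto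
  qed auto
  then have e: "?e \<in> measurable (lebesgue_coeff q) borel"
    using measurable_cong_sets[OF refl sets_PiM_equal_borel] by blast
  have [measurable]: "?F \<in> borel_measurable (lebesgue_coeff q)"
  proof -
    have "sieve_fun \<phi> q (?e b) = sieve_fun \<phi> q b" for b
      unfolding sieve_fun_def by (intro ext sum.cong) auto
    then show ?thesis using measurable_compose[OF e borel] by simp
  qed
  have "{b. ?F b > \<epsilon>} \<inter> space (lebesgue_coeff q) = {b \<in> space (lebesgue_coeff q). ?F b > \<epsilon>}" by auto
  also have "\<dots> \<in> sets (lebesgue_coeff q)" by measurable
  finally show ?thesis .
qed

end

section \<open>Rates for the priors\<close>

text \<open>
  The factor in both rate conditions that bounds the sampling error of the criterion.
\<close>

definition approx_rate :: "nat \<Rightarrow> nat \<Rightarrow> real \<Rightarrow> real" where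
  "approx_rate n k d = real k powr (3 * d / 2) / sqrt (real n) + 1 / real k"

text \<open>
  The rate cannot beat \<open>n\<^bsup>-1/2\<^esup>\<close>; hence the rate conditions force \<open>\<lambda>\<^sub>n\<close> to decay slowly.
\<close>

lemma approx_rate_lower:
  assumes "k \<ge> 1" "n \<ge> 1" "d \<ge> 0"
  shows "1 / sqrt (real n) \<le> approx_rate n k d"
proof -
  have "1 \<le> real k powr (3 * d / 2)" using assms by (intro ge_one_powr_ge_zero) auto
  then have "1 / sqrt (real n) \<le> real k powr (3 * d / 2) / sqrt (real n)"
    by (intro divide_right_mono) auto
  then show ?thesis by (simp add: approx_rate_def add_increasing2)
qed

text \<open>
  Together with \<open>power_le_exp\<close>: the \<open>q\<close>-th power of a quantity between \<open>n\<^bsup>-m\<^esup>\<close> and \<open>n\<close> is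
  \<open>exp(O(q log n))\<close>, the order of everything negligible in the posterior.
\<close>

lemma inverse_power_ge_exp:
  assumes "n \<ge> 1" "1 / real n ^ m \<le> x"
  shows "exp (- real m * (real q * ln (real n))) \<le> x ^ q"
proof -
  have "exp (real (m * q) * ln (real n)) = real n ^ (m * q)"
    unfolding exp_of_nat_mult using assms(1) by simp
  then have "exp (- (real m * (real q * ln (real n)))) = 1 / real n ^ (m * q)"
    by (simp add: exp_minus inverse_eq_divide mult.assoc)
  then have "exp (- real m * (real q * ln (real n))) = (1 / real n ^ m) ^ q"
    by (simp add: power_one_over power_mult)
  also have "\<dots> \<le> x ^ q" using assms by (intro power_mono) auto
  finally show ?thesis .
qed

lemma power_le_exp:
  assumes "n \<ge> 1" "0 \<le> x" "x \<le> real n"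
  shows "x ^ q \<le> exp (real q * ln (real n))"
proof -
  have "x ^ q \<le> real n ^ q" using assms by (intro power_mono) auto
  also have "\<dots> = exp (real q * ln (real n))" using assms by (simp add: exp_of_nat_mult)
  finally show ?thesis .
qed

text \<open>
  The properties of a prior sequence that the posterior argument uses, where \<open>lam n\<close>, written
  \<open>\<lambda>\<^sub>n\<close>, is the scale on which the criterion separates coefficients: outside a cube
  whose radius \<open>R\<close> is still admissible for the concentration of the criterion the prior mass is
  \<open>exp(- n \<lambda>\<^sub>n)\<close> up to a factor \<open>exp(K q log n)\<close>; every other contribution of the prior is
  bounded from above or below by \<open>exp(\<plusminus> K q log n)\<close>, which is negligible against \<open>exp(n \<lambda>\<^sub>n)\<close>.
\<close>

definition admissible_prior_sequence ::
  "(nat \<Rightarrow> (nat \<Rightarrow> real) \<Rightarrow> real) \<Rightarrow> (nat \<Rightarrow> nat) \<Rightarrow> (nat \<Rightarrow> real) \<Rightarrow> (nat \<Rightarrow> real) \<Rightarrow> (nat \<Rightarrow> real) \<Rightarrow> bool" where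
  "admissible_prior_sequence \<pi> q rate lam R \<longleftrightarrow>
    ((\<lambda>n. (real (q n))\<^sup>2 * (R n)\<^sup>2 * rate n / lam n) \<longlonglongrightarrow> 0) \<and>
    filterlim R at_top sequentially \<and>
    (\<forall>\<^sub>F n in sequentially. real (q n) * sqrt (real n) \<le> real n * lam n) \<and>
    (\<exists>K\<ge>0. \<forall>\<^sub>F n in sequentially.
      (\<integral>\<^sup>+b. ennreal (\<pi> n b) \<partial>lebesgue_coeff (q n)) \<le> ennreal (exp (K * (real (q n) * ln (real n)))) \<and>
      (\<integral>\<^sup>+b. ennreal (\<pi> n b) * indicator {b. \<exists>i\<in>{1..q n}. \<bar>b i\<bar> > R n} b \<partial>lebesgue_coeff (q n))
        \<le> ennreal (exp (K * (real (q n) * ln (real n)) - real n * lam n))) \<and>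
    (\<forall>D. \<exists>K\<ge>0. \<forall>\<^sub>F n in sequentially.
      AE b in lebesgue_coeff (q n). L2_set b {1..q n} \<le> D \<longrightarrow> exp (- K * (real (q n) * ln (real n))) \<le> \<pi> n b)"

text \<open>
  The radius is the truncation point, so there is no mass outside the cube. From
  \<open>q\<^sup>2 B\<^sup>2 rate \<le> \<lambda>\<^sub>n \<le> 1\<close> and \<open>rate \<ge> n\<^bsup>-1/2\<^esup>\<close> one obtains both \<open>n \<lambda>\<^sub>n \<ge> q \<surd>n\<close> and
  \<open>B \<le> n\<close>; the latter keeps the uniform density \<open>(2 B)\<^bsup>-q\<^esup>\<close> above \<open>exp(- 2 q log n)\<close>.
\<close>

lemma truncated_prior_admissible:
  assumes valid: "valid_prior prior" and trunc: "truncated_prior prior"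
    and q: "filterlim q at_top sequentially" and k: "filterlim k at_top sequentially"
    and B: "filterlim B at_top sequentially"
    and lam: "\<forall>\<^sub>F n in sequentially. lam n > 0" "\<forall>\<^sub>F n in sequentially. lam n \<le> 1" and d: "d \<ge> 0"
    and rate: "(\<lambda>n. (real (q n))\<^sup>2 * (B n)\<^sup>2 * approx_rate n (k n) d) \<in> o(lam)"
  shows "admissible_prior_sequence (\<lambda>n. prior_density prior (q n) (B n)) q
    (\<lambda>n. approx_rate n (k n) d) lam B"
proof -
  have q1: "\<forall>\<^sub>F n in sequentially. q n \<ge> 1" using q by (simp add: filterlim_at_top)
  have k1: "\<forall>\<^sub>F n in sequentially. k n \<ge> 1" using k by (simp add: filterlim_at_top)
  have B_ge: "\<forall>\<^sub>F n in sequentially. B n \<ge> D" for D using B by (simp add: filterlim_at_top)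
  have n_ge: "\<forall>\<^sub>F n in sequentially. real n \<ge> x" for x
    using filterlim_real_sequentially by (simp add: filterlim_at_top)
  have le: "\<forall>\<^sub>F n in sequentially. (real (q n))\<^sup>2 * (B n)\<^sup>2 * approx_rate n (k n) d \<le> lam n"
    using landau_o.smallD[OF rate zero_less_one] lam(1) by eventually_elim auto
  have core: "\<forall>\<^sub>F n in sequentially. (real (q n))\<^sup>2 * (B n)\<^sup>2 \<le> sqrt (real n) * lam n"
    using le q1 k1 n_ge[of 1] B_ge[of 1]
  proof eventually_elim
    case (elim n)
    have "(real (q n))\<^sup>2 * (B n)\<^sup>2 * (1 / sqrt (real n)) \<le> (real (q n))\<^sup>2 * (B n)\<^sup>2 * approx_rate n (k n) d"
      using approx_rate_lower[of "k n" n d] elim d by (intro mult_left_mono) auto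
    also have "\<dots> \<le> lam n" by (rule elim)
    finally show ?case using elim by (simp add: field_simps)
  qed
  have grow: "\<forall>\<^sub>F n in sequentially. real (q n) * sqrt (real n) \<le> real n * lam n"
    using core q1 n_ge[of 1] B_ge[of 1]
  proof eventually_elim
    case (elim n)
    have "real (q n) * 1 \<le> (real (q n))\<^sup>2 * (B n)\<^sup>2"
      using elim by (intro mult_mono) (auto simp: power2_eq_square one_le_power intro: mult_ge1_I)
    also have "\<dots> \<le> sqrt (real n) * lam n" by (rule elim)
    finally have "real (q n) * sqrt (real n) \<le> sqrt (real n) * lam n * sqrt (real n)"
      by (intro mult_right_mono) auto
    then show ?case by (simp add: mult_ac)
  qed
  have B_le: "\<forall>\<^sub>F n in sequentially. B n \<le> real n"
    using core q1 n_ge[of 1] B_ge[of 1] lam(2)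
  proof eventually_elim
    case (elim n)
    have "B n \<le> (B n)\<^sup>2" using elim by (simp add: power2_eq_square mult_le_cancel_left1)
    also have "1 * (B n)\<^sup>2 \<le> (real (q n))\<^sup>2 * (B n)\<^sup>2" using elim by (intro mult_right_mono) auto
    also have "\<dots> \<le> sqrt (real n) * lam n" by (rule elim)
    also have "\<dots> \<le> sqrt (real n) * 1" using elim by (intro mult_left_mono) auto
    also have "sqrt (real n) \<le> real n" using elim self_le_power[of "real n" 2] by (intro real_le_lsqrt) auto
    finally show ?case by simp
  qed
  have "((\<lambda>n. (real (q n))\<^sup>2 * (B n)\<^sup>2 * approx_rate n (k n) d / lam n) \<longlonglongrightarrow> 0)"
    using smalloD_tendsto[OF rate] .
  moreover have "\<forall>\<^sub>F n in sequentially.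
      (\<integral>\<^sup>+b. ennreal (prior_density prior (q n) (B n) b) \<partial>lebesgue_coeff (q n)) \<le> ennreal (exp (0 * (real (q n) * ln (real n)))) \<and>
      (\<integral>\<^sup>+b. ennreal (prior_density prior (q n) (B n) b) * indicator {b. \<exists>i\<in>{1..q n}. \<bar>b i\<bar> > B n} b \<partial>lebesgue_coeff (q n))
        \<le> ennreal (exp (0 * (real (q n) * ln (real n)) - real n * lam n))"
    using B_ge[of 1]
  proof eventually_elim
    case (elim n)
    have "(\<lambda>b. ennreal (prior_density prior (q n) (B n) b) * indicator {b. \<exists>i\<in>{1..q n}. \<bar>b i\<bar> > B n} b) = (\<lambda>_. 0)"
      using truncated_prior_support[OF trunc] by (fastforce simp: indicator_def simp del: atLeastAtMost_iff)
    then show ?case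
      using truncated_prior_total_mass[OF valid trunc, of "B n" "q n"] elim by simp
  qed
  then have "\<exists>K\<ge>0. \<forall>\<^sub>F n in sequentially.
      (\<integral>\<^sup>+b. ennreal (prior_density prior (q n) (B n) b) \<partial>lebesgue_coeff (q n)) \<le> ennreal (exp (K * (real (q n) * ln (real n)))) \<and>
      (\<integral>\<^sup>+b. ennreal (prior_density prior (q n) (B n) b) * indicator {b. \<exists>i\<in>{1..q n}. \<bar>b i\<bar> > B n} b \<partial>lebesgue_coeff (q n))
        \<le> ennreal (exp (K * (real (q n) * ln (real n)) - real n * lam n))"
    by (intro exI[of _ 0]) simp
  moreover have "\<exists>K\<ge>0. \<forall>\<^sub>F n in sequentially. AE b in lebesgue_coeff (q n).
      L2_set b {1..q n} \<le> D \<longrightarrow> exp (- K * (real (q n) * ln (real n))) \<le> prior_density prior (q n) (B n) b" for D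
  proof -
    define R where "R = max D 1"
    have local: "\<forall>\<^sub>F n in sequentially. \<forall>b. L2_set b {1..q n} \<le> D \<longrightarrow>
        exp (- real 2 * (real (q n) * ln (real n))) \<le> prior_density prior (q n) (B n) b"
    proof (cases prior)
      case Uniform
      show ?thesis using B_ge[of R] B_le n_ge[of 2]
      proof eventually_elim
        case (elim n)
        show ?case
        proof (intro allI impI)
          fix b assume b: "L2_set b {1..q n} \<le> D"
          have "B n > 0" using elim by (simp add: R_def)
          have "2 * B n \<le> real n * real n" using elim \<open>B n > 0\<close> by (intro mult_mono) auto
          then have "1 / real n ^ 2 \<le> 1 / (2 * B n)"
            using \<open>B n > 0\<close> elim by (intro divide_left_mono) (auto simp: power2_eq_square)
          then have "exp (- real 2 * (real (q n) * ln (real n))) \<le> (1 / (2 * B n)) ^ q n"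
            using elim by (intro inverse_power_ge_exp) auto
          also have "\<dots> = prior_density prior (q n) (B n) b"
            unfolding Uniform
          proof (rule uniform_prior_local[symmetric])
            fix i assume "i \<in> {1..q n}"
            then show "\<bar>b i\<bar> \<le> B n" using abs_le_L2_set[of i "q n" b] b elim by (simp add: R_def)
          qed fact
          finally show "exp (- real 2 * (real (q n) * ln (real n))) \<le> prior_density prior (q n) (B n) b" .
        qed
      qed
    next
      case (Truncated_Normal \<sigma>)
      have \<sigma>: "\<sigma> > 0" using valid Truncated_Normal by simp
      \<comment> \<open>The smallest value of the normal density on the ball of radius \<open>R\<close>, independent of \<open>n\<close>.\<close>
      define \<kappa> where "\<kappa> = normal_density 0 \<sigma> R"
      have \<kappa>: "\<kappa> > 0" unfolding \<kappa>_def using \<sigma> by (rule normal_density_pos)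
      show ?thesis using B_ge[of R] n_ge[of "max 1 (1 / \<kappa>)"]
      proof eventually_elim
        case (elim n)
        show ?case
        proof (intro allI impI)
          fix b assume b: "L2_set b {1..q n} \<le> D"
          have "1 / real n ^ 2 \<le> 1 / real n"
            using elim by (intro divide_left_mono) (auto simp: power2_eq_square)
          also have "\<dots> \<le> \<kappa>" using elim \<kappa> by (simp add: field_simps)
          finally have "exp (- real 2 * (real (q n) * ln (real n))) \<le> \<kappa> ^ q n"
            using elim by (intro inverse_power_ge_exp) auto
          also have "\<dots> \<le> prior_density prior (q n) (B n) b"
            unfolding Truncated_Normal \<kappa>_def
          proof (rule truncated_normal_prior_local[OF \<sigma>])
            fix i assume "i \<in> {1..q n}"
            then show "\<bar>b i\<bar> \<le> R" using abs_le_L2_set[of i "q n" b] b by (simp add: R_def)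
          qed (use elim in \<open>auto simp: R_def\<close>)
          finally show "exp (- real 2 * (real (q n) * ln (real n))) \<le> prior_density prior (q n) (B n) b" .
        qed
      qed
    qed (use trunc in auto)
    show ?thesis
    proof (intro exI[of _ 2] conjI)
      show "\<forall>\<^sub>F n in sequentially. AE b in lebesgue_coeff (q n).
        L2_set b {1..q n} \<le> D \<longrightarrow> exp (- 2 * (real (q n) * ln (real n))) \<le> prior_density prior (q n) (B n) b"
        using local by eventually_elim (auto intro!: AE_I2)
    qed simp
  qed
  ultimately show ?thesis
    unfolding admissible_prior_sequence_def using B grow by blast
qed

text \<open>
  The thin-tail rate condition in the form in which it is used, with the squared radius
  \<open>(n \<lambda>\<^sub>n)\<^bsup>2/r\<^esup>\<close> visible.
\<close>

lemma thin_tail_rate_transfer: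
  fixes lam D q x r :: real
  assumes "lam > 0" "r > 2" "x > 0" "q > 0" "D > 0"
  shows "(x powr (2 / (r - 2)) * q powr (2 * r / (r - 2)) * D powr (r / (r - 2)) / lam) powr ((r - 2) / r)
    = q\<^sup>2 * (x * lam) powr (2 / r) * D / lam"
proof -
  have e: "2 / (r - 2) * ((r - 2) / r) = 2 / r" "2 * r / (r - 2) * ((r - 2) / r) = 2"
    "r / (r - 2) * ((r - 2) / r) = 1" "(r - 2) / r = 1 - 2 / r"
    using assms by (auto simp: field_simps)
  have "(x powr (2 / (r - 2)) * q powr (2 * r / (r - 2)) * D powr (r / (r - 2)) / lam) powr ((r - 2) / r)
     = x powr (2 / r) * q powr 2 * D powr 1 / lam powr ((r - 2) / r)"
    using assms by (simp only: powr_divide powr_mult powr_powr e(1-3))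
  also have "lam powr ((r - 2) / r) = lam / lam powr (2 / r)"
    using assms by (simp only: e(4) powr_diff) simp
  finally show ?thesis using assms by (simp add: powr_mult powr_numeral)
qed

text \<open>
  With \<open>a = \<beta>\<^sup>r\<close>, the tail factor beyond radius \<open>R\<close> is \<open>exp(- a R\<^sup>r/2)\<close>. The constant \<open>m\<close> in
  \<open>R = m (n \<lambda>\<^sub>n)\<^bsup>1/r\<^esup>\<close> solves \<open>a m\<^sup>r = 2\<close>, so that this factor becomes \<open>exp(- n \<lambda>\<^sub>n)\<close>.
\<close>

lemma thin_tail_prior_admissible:
  assumes r: "r > 2" and \<beta>: "\<beta> > 0"
    and q: "filterlim q at_top sequentially" and k: "filterlim k at_top sequentially"
    and lam: "\<forall>\<^sub>F n in sequentially. lam n > 0" "\<forall>\<^sub>F n in sequentially. lam n \<le> 1" and d: "d \<ge> 0"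
    and rate: "(\<lambda>n. real n powr (2 / (r - 2)) * real (q n) powr (2 * r / (r - 2))
              * approx_rate n (k n) d powr (r / (r - 2))) \<in> o(lam)"
  shows "\<exists>R. admissible_prior_sequence (\<lambda>n. prior_density (Thin_Tail r \<beta>) (q n) (B n)) q
    (\<lambda>n. approx_rate n (k n) d) lam R"
proof -
  define a where "a = \<beta> powr r"
  have a: "a > 0" using \<beta> by (simp add: a_def)
  define m where "m = (2 / a) powr (1 / r)"
  have m: "m > 0" using a by (simp add: m_def)
  have mr: "m powr r = 2 / a" using a r by (simp add: m_def powr_powr)
  define R where "R n = m * (real n * lam n) powr (1 / r)" for n
  define g where "g = sqrt (2 * pi / a)"
  let ?D = "\<lambda>n. approx_rate n (k n) d"
  have q1: "\<forall>\<^sub>F n in sequentially. real (q n) \<ge> x" for x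
    using filterlim_compose[OF filterlim_real_sequentially q] by (simp add: filterlim_at_top)
  have k1: "\<forall>\<^sub>F n in sequentially. k n \<ge> 1" using k by (simp add: filterlim_at_top)
  have n_ge: "\<forall>\<^sub>F n in sequentially. real n \<ge> x" for x
    using filterlim_real_sequentially by (simp add: filterlim_at_top)
  have good: "\<forall>\<^sub>F n in sequentially. lam n > 0 \<and> lam n \<le> 1 \<and> real (q n) \<ge> 1 \<and> k n \<ge> 1 \<and> real n \<ge> 1
      \<and> 1 / sqrt (real n) \<le> ?D n \<and> ?D n > 0"
    using lam q1[of 1] k1 n_ge[of 1]
  proof eventually_elim
    case (elim n)
    have "1 / sqrt (real n) \<le> ?D n" using elim d by (intro approx_rate_lower) auto
    moreover have "0 < 1 / sqrt (real n)" using elim by simp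
    ultimately have "?D n > 0" by linarith
    with elim \<open>1 / sqrt (real n) \<le> ?D n\<close> show ?case by auto
  qed
  have "((\<lambda>n. (real n powr (2 / (r - 2)) * real (q n) powr (2 * r / (r - 2))
              * ?D n powr (r / (r - 2)) / lam n) powr ((r - 2) / r)) \<longlonglongrightarrow> 0 powr ((r - 2) / r))"
    by (intro tendsto_powr2[OF smalloD_tendsto[OF rate] tendsto_const] eventually_mono[OF good])
      (use r in auto)
  then have lim0: "(\<lambda>n. (real n powr (2 / (r - 2)) * real (q n) powr (2 * r / (r - 2))
              * ?D n powr (r / (r - 2)) / lam n) powr ((r - 2) / r)) \<longlonglongrightarrow> 0" by simp
  have lim: "(\<lambda>n. (real (q n))\<^sup>2 * (real n * lam n) powr (2 / r) * ?D n / lam n) \<longlonglongrightarrow> 0"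
    by (rule Lim_transform_eventually[OF lim0]) (use good in \<open>eventually_elim, subst thin_tail_rate_transfer, use r in auto\<close>)
  have R2: "(R n)\<^sup>2 = m\<^sup>2 * (real n * lam n) powr (2 / r)" for n
    by (simp add: R_def power_mult_distrib) (simp add: power2_eq_square powr_add[symmetric])
  have "(\<lambda>n. m\<^sup>2 * ((real (q n))\<^sup>2 * (real n * lam n) powr (2 / r) * ?D n / lam n)) \<longlonglongrightarrow> m\<^sup>2 * 0"
    by (intro tendsto_mult tendsto_const lim)
  then have limR: "(\<lambda>n. (real (q n))\<^sup>2 * (R n)\<^sup>2 * ?D n / lam n) \<longlonglongrightarrow> 0"
    by (simp add: R2 mult_ac)
  have grow2: "\<forall>\<^sub>F n in sequentially. (real (q n))\<^sup>2 * sqrt (real n) \<le> real n * lam n"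
    using good order_tendstoD(2)[OF lim zero_less_one]
  proof eventually_elim
    case (elim n)
    let ?x = "real n * lam n"
    have x: "?x > 0" using elim by simp
    have "(real (q n))\<^sup>2 * ?x powr (2 / r) * (1 / sqrt (real n)) \<le> (real (q n))\<^sup>2 * ?x powr (2 / r) * ?D n"
      using elim by (intro mult_left_mono) auto
    also have "\<dots> \<le> lam n" using elim by (simp add: divide_simps)
    finally have "(real (q n))\<^sup>2 * ?x powr (2 / r) * (1 / sqrt (real n)) * real n \<le> lam n * real n"
      by (intro mult_right_mono) auto
    moreover have "1 / sqrt (real n) * real n = sqrt (real n)"
      using elim by (simp add: real_div_sqrt)
    ultimately have main: "(real (q n))\<^sup>2 * ?x powr (2 / r) * sqrt (real n) \<le> ?x"
      by (simp only: mult.assoc) (simp add: mult_ac)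
    show ?case
    \<comment> \<open>If \<open>x < 1\<close>, then \<open>x\<^bsup>2/r\<^esup> > x\<close> as \<open>2/r < 1\<close>, contradicting the bound just derived.\<close>
    proof (cases "?x \<ge> 1")
      case True
      then have "1 \<le> ?x powr (2 / r)" using r by (intro ge_one_powr_ge_zero) auto
      then have "(real (q n))\<^sup>2 * 1 * sqrt (real n) \<le> (real (q n))\<^sup>2 * ?x powr (2 / r) * sqrt (real n)"
        by (intro mult_right_mono mult_left_mono) auto
      with main show ?thesis by simp
    next
      case False
      have "1 * 1 \<le> (real (q n))\<^sup>2 * sqrt (real n)" using elim by (intro mult_mono) auto
      then have "?x powr (2 / r) * 1 \<le> ?x powr (2 / r) * ((real (q n))\<^sup>2 * sqrt (real n))"
        by (intro mult_left_mono) auto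
      then have "?x powr (2 / r) \<le> ?x" using main by (simp add: mult_ac)
      moreover have "?x powr 1 < ?x powr (2 / r)" using False x r by (intro powr_less_mono') auto
      ultimately show ?thesis using x by simp
    qed
  qed
  have grow: "\<forall>\<^sub>F n in sequentially. real (q n) * sqrt (real n) \<le> real n * lam n"
    using grow2 good
  proof eventually_elim
    case (elim n)
    have "real (q n) * sqrt (real n) \<le> (real (q n))\<^sup>2 * sqrt (real n)"
      using elim by (intro mult_right_mono) (auto simp: power2_eq_square)
    then show ?case using elim by linarith
  qed
  have R_top: "filterlim R at_top sequentially"
  proof -
    have sq: "filterlim (\<lambda>n. sqrt (real n)) at_top sequentially"
      by (rule filterlim_compose[OF sqrt_at_top filterlim_real_sequentially])
    have "filterlim (\<lambda>n. real n * lam n) at_top sequentially"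
      by (rule filterlim_at_top_mono[OF sq]) (use grow good in \<open>eventually_elim, auto intro: order_trans[rotated]\<close>)
    then have lim_exp: "filterlim (\<lambda>n. exp (1 / r * ln (real n * lam n))) at_top sequentially"
      using r by (intro filterlim_compose[OF exp_at_top] filterlim_compose[OF ln_at_top]
          filterlim_tendsto_pos_mult_at_top[OF tendsto_const]) auto
    have "filterlim (\<lambda>n. (real n * lam n) powr (1 / r)) at_top sequentially"
      by (rule filterlim_at_top_mono[OF lim_exp])
        (use good in \<open>eventually_elim, simp add: powr_def\<close>)
    then show ?thesis unfolding R_def using m by (intro filterlim_tendsto_pos_mult_at_top[OF tendsto_const])
  qed
  have R1: "\<forall>\<^sub>F n in sequentially. R n \<ge> 1" using R_top by (simp add: filterlim_at_top)
  have q_le: "\<forall>\<^sub>F n in sequentially. real (q n) \<le> real n"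
    using grow good
  proof eventually_elim
    case (elim n)
    have "real (q n) * 1 \<le> real (q n) * sqrt (real n)" using elim by (intro mult_left_mono) auto
    also have "\<dots> \<le> real n * lam n" using elim by simp
    also have "\<dots> \<le> real n * 1" using elim by (intro mult_left_mono) auto
    finally show ?case by simp
  qed
  have mass: "\<forall>\<^sub>F n in sequentially.
      (\<integral>\<^sup>+b. ennreal (prior_density (Thin_Tail r \<beta>) (q n) (B n) b) \<partial>lebesgue_coeff (q n)) \<le> ennreal (exp (3 * (real (q n) * ln (real n)))) \<and>
      (\<integral>\<^sup>+b. ennreal (prior_density (Thin_Tail r \<beta>) (q n) (B n) b) * indicator {b. \<exists>i\<in>{1..q n}. \<bar>b i\<bar> > R n} b \<partial>lebesgue_coeff (q n))
        \<le> ennreal (exp (3 * (real (q n) * ln (real n)) - real n * lam n))"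
    using good R1 q_le q1[of r] n_ge[of "max (r * a) (4 + g)"]
  proof eventually_elim
    case (elim n)
    let ?h = "real (q n) * ln (real n)"
    have g0: "g \<ge> 0" using a by (simp add: g_def)
    have qn: "q n \<ge> 1" "n \<ge> 1" using elim by auto
    have "r * a \<le> real n ^ 1" using elim by simp
    also have "\<dots> \<le> real n ^ q n" using qn by (intro power_increasing) auto
    also have "\<dots> = exp ?h" unfolding exp_of_nat_mult using qn by simp
    finally have f1: "r * a \<le> exp ?h" .
    have f2: "real (q n) ^ q n \<le> exp ?h" using elim qn by (intro power_le_exp) auto
    have "(4::real) ^ q n + g ^ q n \<le> (4 + g) ^ q n"
    proof -
      have "(4::real) ^ q + g ^ q \<le> (4 + g) ^ q" if "q \<ge> 1" for q using that
      proof (induction q rule: dec_induct)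
        case (step q)
        have "4 ^ Suc q + g ^ Suc q \<le> (4 + g) * (4 ^ q + g ^ q)" using g0 by (simp add: algebra_simps)
        also have "\<dots> \<le> (4 + g) * (4 + g) ^ q" using step g0 by (intro mult_left_mono) auto
        finally show ?case by simp
      qed simp
      then show ?thesis using qn by simp
    qed
    also have "\<dots> \<le> exp ?h" using elim qn g0 by (intro power_le_exp) auto
    finally have f3: "(4::real) ^ q n + g ^ q n \<le> exp ?h" .
    have e3: "exp ?h * exp ?h * exp ?h = exp (3 * ?h)" by (simp add: exp_add[symmetric])
    have "(\<integral>\<^sup>+b. ennreal (prior_density (Thin_Tail r \<beta>) (q n) (B n) b) \<partial>lebesgue_coeff (q n))
        \<le> ennreal (r * a * real (q n) ^ q n * (4 ^ q n + g ^ q n))"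
      unfolding a_def g_def using r elim by (intro thin_tail_total_mass \<beta>) (auto simp: a_def)
    also have "\<dots> \<le> ennreal (exp ?h * exp ?h * exp ?h)"
      using f1 f2 f3 r a g0 by (intro ennreal_leI mult_mono) auto
    finally have total: "(\<integral>\<^sup>+b. ennreal (prior_density (Thin_Tail r \<beta>) (q n) (B n) b) \<partial>lebesgue_coeff (q n))
        \<le> ennreal (exp (3 * ?h))" unfolding e3 .
    have "(\<integral>\<^sup>+b. ennreal (prior_density (Thin_Tail r \<beta>) (q n) (B n) b) * indicator {b. \<exists>i\<in>{1..q n}. \<bar>b i\<bar> > R n} b \<partial>lebesgue_coeff (q n))
        \<le> (\<integral>\<^sup>+b. ennreal (prior_density (Thin_Tail r \<beta>) (q n) (B n) b) * indicator {b. L2_set b {1..q n} > R n} b \<partial>lebesgue_coeff (q n))"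
    proof (intro nn_integral_mono mult_left_mono)
      fix b :: "nat \<Rightarrow> real"
      have "L2_set b {1..q n} > R n" if "i \<in> {1..q n}" "\<bar>b i\<bar> > R n" for i
        using abs_le_L2_set[OF that(1), of b] that(2) by linarith
      then show "indicator {b. \<exists>i\<in>{1..q n}. \<bar>b i\<bar> > R n} b \<le> (indicator {b. L2_set b {1..q n} > R n} b :: ennreal)"
        by (auto simp: indicator_def simp del: atLeastAtMost_iff)
    qed simp
    also have "\<dots> \<le> ennreal (r * a * real (q n) ^ q n * g ^ q n * exp (- (a * R n powr r / 2)))"
      unfolding a_def g_def using r elim by (intro thin_tail_tail_mass \<beta>) (auto simp: a_def)
    also have "a * R n powr r / 2 = real n * lam n"
      using m a r elim by (simp add: R_def powr_mult powr_powr mr)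
    also have "ennreal (r * a * real (q n) ^ q n * g ^ q n * exp (- (real n * lam n)))
        \<le> ennreal (exp ?h * exp ?h * exp ?h * exp (- (real n * lam n)))"
      using f1 f2 f3 r a g0 by (intro ennreal_leI mult_mono) (auto intro: order_trans[rotated])
    also have "\<dots> = ennreal (exp (3 * ?h - real n * lam n))"
      unfolding e3 by (simp add: exp_add[symmetric])
    finally show ?case using total by blast
  qed
  have local: "\<exists>K\<ge>0. \<forall>\<^sub>F n in sequentially. AE b in lebesgue_coeff (q n).
      L2_set b {1..q n} \<le> D \<longrightarrow> exp (- K * (real (q n) * ln (real n))) \<le> prior_density (Thin_Tail r \<beta>) (q n) (B n) b" for D
  proof -
    define R0 where "R0 = max D 1"
    define c where "c = r * a * exp (- a * R0 powr r)"
    have c: "c > 0" using r a by (simp add: c_def)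
    have "\<forall>\<^sub>F n in sequentially. AE b in lebesgue_coeff (q n). L2_set b {1..q n} \<le> D \<longrightarrow>
        exp (- 2 * (real (q n) * ln (real n))) \<le> prior_density (Thin_Tail r \<beta>) (q n) (B n) b"
      using good q1[of r] n_ge[of "max (1 / c) (7 * R0)"]
    proof eventually_elim
      case (elim n)
      let ?h = "real (q n) * ln (real n)"
      have qn: "q n \<ge> 1" "n \<ge> 1" using elim by auto
      have "exp (- real 1 * ?h) \<le> (1 / real n) ^ q n" using qn by (intro inverse_power_ge_exp) auto
      also have "\<dots> \<le> (1 / real n) ^ 1" using qn by (intro power_decreasing) auto
      also have "\<dots> \<le> c" using elim c by (simp add: field_simps)
      finally have f1: "exp (- ?h) \<le> c" by simp
      have "1 / real n ^ 1 \<le> 1 / (7 * R0)" using elim by (simp add: R0_def frac_le)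
      then have f2: "exp (- real 1 * ?h) \<le> (1 / (7 * R0)) ^ q n" using qn by (intro inverse_power_ge_exp) auto
      show ?case using AE_coeff_nonzero[OF qn(1)]
      proof eventually_elim
        case (elim b)
        show ?case
        proof
          assume b: "L2_set b {1..q n} \<le> D"
          have "exp (- 2 * ?h) = exp (- ?h) * exp (- real 1 * ?h)" by (simp add: exp_add[symmetric])
          also have "\<dots> \<le> c * (1 / (7 * R0)) ^ q n" using f1 f2 c by (intro mult_mono) auto
          also have "\<dots> \<le> prior_density (Thin_Tail r \<beta>) (q n) (B n) b"
            unfolding c_def a_def using elim b r \<beta> \<open>r \<le> real (q n)\<close>
            by (intro thin_tail_local) (auto simp: R0_def)
          finally show "exp (- 2 * ?h) \<le> prior_density (Thin_Tail r \<beta>) (q n) (B n) b" .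
        qed
      qed
    qed
    then show ?thesis by (intro exI[of _ 2]) simp
  qed
  have "\<exists>K\<ge>0. \<forall>\<^sub>F n in sequentially.
      (\<integral>\<^sup>+b. ennreal (prior_density (Thin_Tail r \<beta>) (q n) (B n) b) \<partial>lebesgue_coeff (q n)) \<le> ennreal (exp (K * (real (q n) * ln (real n)))) \<and>
      (\<integral>\<^sup>+b. ennreal (prior_density (Thin_Tail r \<beta>) (q n) (B n) b) * indicator {b. \<exists>i\<in>{1..q n}. \<bar>b i\<bar> > R n} b \<partial>lebesgue_coeff (q n))
        \<le> ennreal (exp (K * (real (q n) * ln (real n)) - real n * lam n))"
    using mass by (intro exI[of _ 3]) simp
  with limR R_top grow local show ?thesis
    unfolding admissible_prior_sequence_def by blast
qed

section \<open>Concentration of the criterion\<close>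

context observation_law begin

lemma fluctuation_nonneg:
  assumes "\<And>j. j \<in> cell_indices k \<Longrightarrow> cell_prob P k j > 0" "C \<ge> 0"
  shows "fluctuation n k q C z \<psi> \<ge> 0"
  unfolding fluctuation_def using assms
  by (intro sum_nonneg add_nonneg_nonneg mult_nonneg_nonneg divide_nonneg_nonneg)
    (auto simp: cell_deviation_def intro!: sum_nonneg less_imp_le)

lemma cell_second_moment:
  assumes reg: "regression_on_W P (\<lambda>u. (V u)\<^sup>2) m" and C: "\<And>w. w \<in> cbox 0 1 \<Longrightarrow> m w < C"
    and unit: "AE z in P. instrument z \<in> cbox 0 1"
  shows "(\<integral>u. (V u)\<^sup>2 * indicator (cell k j) (instrument u) \<partial>P) \<le> C * cell_prob P k j"
proof -
  let ?I = "\<lambda>u. indicator (cell k j) (instrument u) :: real"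
  have V: "integrable P (\<lambda>u. (V u)\<^sup>2)" and m: "AE z in P. cond_W P (\<lambda>u. (V u)\<^sup>2) z = m (instrument z)"
    using reg by (auto simp: regression_on_W_def)
  have "(\<integral>u. (V u)\<^sup>2 * ?I u \<partial>P) = (\<integral>u. cond_W P (\<lambda>u. (V u)\<^sup>2) u * ?I u \<partial>P)"
    by (rule cond_W_integral_cell[OF V]) simp
  also have "\<dots> \<le> (\<integral>u. C * ?I u \<partial>P)"
  proof (intro integral_mono_AE integrable_times_cell cond_W_integrable V)
    show "integrable P (\<lambda>u. C)" by simp
    show "AE u in P. cond_W P (\<lambda>u. (V u)\<^sup>2) u * ?I u \<le> C * ?I u"
      using m unit
    proof eventually_elim
      case (elim u)
      then have "cond_W P (\<lambda>u. (V u)\<^sup>2) u \<le> C" using C[of "instrument u"] by simp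
      then show ?case by (rule mult_right_mono) simp
    qed
  qed
  finally show ?thesis by (simp add: cell_prob_eq_integral)
qed

end

text \<open>
  The partition property is the form in which the absolute continuity of the instrument is used.
\<close>

locale sieve_sample = iid_observations P M Z + sieve_geometry P \<phi> g0 bstar \<eta> varphi
  for P :: "('x::euclidean_space, 'd::finite) obs measure" and M :: "'o measure"
    and Z :: "nat \<Rightarrow> 'o \<Rightarrow> ('x, 'd) obs" and \<phi> g0 bstar \<eta> varphi +
  assumes g0_identified: "g0 \<in> Theta_I P"
    and unit_cube: "AE z in P. instrument z \<in> cbox 0 1"
    and partition: "\<And>k. k \<ge> 1 \<Longrightarrow> AE z in P. (\<Sum>j\<in>cell_indices k. indicator (cell k j) (instrument z)) = (1::real)"
begin

text \<open>
  Markov's inequality for the fluctuation, and the undersampling event. Regressand \<open>0\<close> is the outcome with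
  coefficient \<open>1\<close>, regressand \<open>i \<ge> 1\<close> is \<open>\<phi>\<^sub>i(X)\<close> with coefficient \<open>- b\<^sub>i\<close>.
\<close>

lemma criterion_deviation:
  fixes q k n :: nat
  assumes C: "C > 0" and L: "L \<ge> 0"
    and Y2: "\<exists>m. regression_on_W P (\<lambda>z. (outcome z)\<^sup>2) m \<and> (\<forall>w\<in>cbox 0 1. m w < C)"
    and Y1: "\<exists>m. regression_on_W P outcome m \<and> (\<forall>w1\<in>cbox 0 1. \<forall>w2\<in>cbox 0 1. \<bar>m w1 - m w2\<bar> \<le> L * norm (w1 - w2))"
    and X2: "\<And>i. i \<in> {1..q} \<Longrightarrow> \<exists>m. regression_on_W P (\<lambda>z. (\<phi> i (regressor z))\<^sup>2) m \<and> (\<forall>w\<in>cbox 0 1. m w < C)"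
    and X1: "\<And>i. i \<in> {1..q} \<Longrightarrow> \<exists>m. regression_on_W P (\<lambda>z. \<phi> i (regressor z)) m \<and>
        (\<forall>w1\<in>cbox 0 1. \<forall>w2\<in>cbox 0 1. \<bar>m w1 - m w2\<bar> \<le> L * norm (w1 - w2))"
    and k: "k \<ge> 1" and n: "n \<ge> 1" and v: "v > 0" "\<And>j. j \<in> cell_indices k \<Longrightarrow> cell_prob P k j \<ge> v"
    and R: "R \<ge> 1" and t: "t > 0"
  shows "\<exists>E\<in>sets M.
    measure M E \<le> R\<^sup>2 * (8 * C * (real (q + 1))\<^sup>2 * (real k ^ CARD('d) / sqrt (real n))) / t
        + real k ^ CARD('d) * (4 / (real n * v)) \<and>
    (\<forall>\<omega>\<in>space M - E. \<forall>b. (\<forall>i\<in>{1..q}. \<bar>b i\<bar> \<le> R) \<longrightarrow>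
      \<bar>G_bar n k (\<lambda>i. Z i \<omega>) (sieve_fun \<phi> q b) - (norm_w P (\<lambda>x. sieve_fun \<phi> q b x - g0 x))\<^sup>2\<bar>
        \<le> t + R\<^sup>2 * (real (q + 1) * L * (real CARD('d) / real k))\<^sup>2)"
proof -
  define \<psi> :: "nat \<Rightarrow> ('x, 'd) obs \<Rightarrow> real"
    where "\<psi> a = (if a = 0 then outcome else (\<lambda>z. \<phi> a (regressor z)))" for a
  have "\<forall>a\<le>q. \<exists>m. regression_on_W P (\<psi> a) m \<and>
        (\<forall>w1\<in>cbox 0 1. \<forall>w2\<in>cbox 0 1. \<bar>m w1 - m w2\<bar> \<le> L * norm (w1 - w2))"
    using Y1 X1 by (auto simp: \<psi>_def)
  then obtain m where m: "\<And>a. a \<le> q \<Longrightarrow> regression_on_W P (\<psi> a) (m a)"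
    and lip: "\<And>a w w'. a \<le> q \<Longrightarrow> w \<in> cbox 0 1 \<Longrightarrow> w' \<in> cbox 0 1 \<Longrightarrow> \<bar>m a w - m a w'\<bar> \<le> L * norm (w - w')"
    by metis
  have sq: "\<exists>m. regression_on_W P (\<lambda>z. (\<psi> a z)\<^sup>2) m \<and> (\<forall>w\<in>cbox 0 1. m w < C)" if "a \<le> q" for a
    using Y2 X2[of a] that by (auto simp: \<psi>_def)
  have second: "(\<integral>u. (\<psi> a u)\<^sup>2 * indicator (cell k j) (instrument u) \<partial>P) \<le> C * cell_prob P k j" if "a \<le> q" for a j
    using sq[OF that] cell_second_moment unit_cube by blast
  have int: "integrable P (\<lambda>u. (\<psi> a u)\<^sup>2)" if "a \<le> q" for a
    using sq[OF that] by (auto simp: regression_on_W_def)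
  have meas: "\<psi> a \<in> borel_measurable borel" if "a \<le> q" for a
  proof (cases "a = 0")
    case False
    then have [measurable]: "\<phi> a \<in> borel_measurable borel"
      using basis_L2X[of a] by (simp add: L2X_def)
    show ?thesis using False by (simp add: \<psi>_def)
  qed (simp add: \<psi>_def)
  have meas': "\<psi> a \<in> borel_measurable P" if "a \<le> q" for a
    using meas[OF that] by measurable
  have v0: "cell_prob P k j > 0" if "j \<in> cell_indices k" for j using v that by force
  let ?fl = "\<lambda>\<omega>. fluctuation n k q C (\<lambda>i. Z i \<omega>) \<psi>"
  note fl = fluctuation_expectation[where \<psi> = \<psi> and q = q, OF meas int second less_imp_le[OF C] n v0]
  let ?E1 = "{\<omega> \<in> space M. R\<^sup>2 * ?fl \<omega> \<ge> t}"
  let ?E2 = "{\<omega> \<in> space M. \<exists>j\<in>cell_indices k. v_hat n k (\<lambda>i. Z i \<omega>) j < cell_prob P k j / 2}"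
  note E2 = undersampled_cell_probability[OF n v]
  have intR: "integrable M (\<lambda>\<omega>. R\<^sup>2 * ?fl \<omega>)" using fl(1) by simp
  have E1s: "?E1 \<in> sets M" using intR by measurable
  have "measure M ?E1 \<le> (\<integral>\<omega>. R\<^sup>2 * ?fl \<omega> \<partial>M) / t"
    using t by (intro integral_Markov_inequality_measure[OF intR, where A = "{}"])
      (auto intro!: AE_I2 mult_nonneg_nonneg fluctuation_nonneg v0 less_imp_le[OF C])
  also have "\<dots> \<le> R\<^sup>2 * (8 * C * (real (q + 1))\<^sup>2 * (real k ^ CARD('d) / sqrt (real n))) / t"
    unfolding Bochner_Integration.integral_mult_right_zero
    by (intro divide_right_mono mult_left_mono fl(2)) (use t in auto)
  finally have E1: "measure M ?E1 \<le> R\<^sup>2 * (8 * C * (real (q + 1))\<^sup>2 * (real k ^ CARD('d) / sqrt (real n))) / t" .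
  show ?thesis
  proof (intro bexI[of _ "?E1 \<union> ?E2"] conjI ballI allI impI)
    show "?E1 \<union> ?E2 \<in> sets M" using E1s E2(1) by blast
    have "measure M (?E1 \<union> ?E2) \<le> measure M ?E1 + measure M ?E2"
      using E1s E2(1) by (rule measure_Un_le)
    with E1 E2(2) show "measure M (?E1 \<union> ?E2)
      \<le> R\<^sup>2 * (8 * C * (real (q + 1))\<^sup>2 * (real k ^ CARD('d) / sqrt (real n))) / t
        + real k ^ CARD('d) * (4 / (real n * v))" by linarith
    fix \<omega> b assume \<omega>: "\<omega> \<in> space M - (?E1 \<union> ?E2)" and b: "\<forall>i\<in>{1..q}. \<bar>b i\<bar> \<le> R"
    define c where "c a = (if a = 0 then 1 else - b a)" for a :: nat
    have res: "(\<Sum>a\<le>q. c a * \<psi> a u) = outcome u - sieve_fun \<phi> q b (regressor u)" for u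
    proof -
      have "(\<Sum>a\<le>q. c a * \<psi> a u) = c 0 * \<psi> 0 u + (\<Sum>a=1..q. c a * \<psi> a u)"
        by (simp add: atMost_atLeast0 sum.atLeast_Suc_atMost)
      also have "(\<Sum>a=1..q. c a * \<psi> a u) = (\<Sum>a=1..q. - (b a * \<phi> a (regressor u)))"
        by (intro sum.cong) (auto simp: c_def \<psi>_def)
      finally show ?thesis by (simp add: c_def \<psi>_def sieve_fun_def sum_negf)
    qed
    have cR: "\<bar>c a\<bar> \<le> R" if "a \<le> q" for a using b R that by (auto simp: c_def)
    have vh: "v_hat n k (\<lambda>i. Z i \<omega>) j \<ge> cell_prob P k j / 2" if "j \<in> cell_indices k" for j
      using \<omega> that by (auto simp: not_less)
    have "\<bar>G_bar n k (\<lambda>i. Z i \<omega>) (sieve_fun \<phi> q b) - (norm_w P (\<lambda>x. sieve_fun \<phi> q b x - g0 x))\<^sup>2\<bar>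
        \<le> R\<^sup>2 * (?fl \<omega> + (real (q + 1) * L * (real CARD('d) / real k))\<^sup>2)"
      using uniform_criterion_bound[where \<psi> = \<psi> and q = q and m = m and c = c, OF meas' int second m lip L less_imp_le[OF C] k partition[OF k] v0 vh cR]
      unfolding res G_bar_eq_cell_mean[symmetric]
      using criterion_eq_weak_norm[OF _ g0_identified sieve_fun_L2X, of q b] int[of 0] by (simp add: \<psi>_def)
    moreover have "R\<^sup>2 * ?fl \<omega> \<le> t" using \<omega> by auto
    ultimately show "\<bar>G_bar n k (\<lambda>i. Z i \<omega>) (sieve_fun \<phi> q b) - (norm_w P (\<lambda>x. sieve_fun \<phi> q b x - g0 x))\<^sup>2\<bar>
        \<le> t + R\<^sup>2 * (real (q + 1) * L * (real CARD('d) / real k))\<^sup>2"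
      by (simp add: distrib_left)
  qed
qed

end

context sieve_sample begin

text \<open>
  All error terms of \<open>criterion_deviation\<close> are bounded through \<open>y\<^sub>n = q\<^sup>2 R\<^sup>2 rate / \<lambda>\<^sub>n\<close>, which tends to
  zero: the Markov term is of order \<open>y\<^sub>n\<close>, the undersampling probability of order \<open>y\<^sub>n\<^sup>2\<close>, and the
  discretisation bias is \<open>y\<^sub>n \<lambda>\<^sub>n\<close> up to a constant.
\<close>

lemma criterion_concentration:
  fixes q k :: "nat \<Rightarrow> nat" and R lam :: "nat \<Rightarrow> real"
  assumes N2: "balanced_cells P k" and N3: "regular_cond_moments P \<phi> q"
    and q: "filterlim q at_top sequentially" and k: "filterlim k at_top sequentially"
    and R: "filterlim R at_top sequentially"
    and lam: "\<forall>\<^sub>F n in sequentially. lam n > 0" "\<forall>\<^sub>F n in sequentially. lam n \<le> 1"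
    and rate: "(\<lambda>n. (real (q n))\<^sup>2 * (R n)\<^sup>2 * approx_rate n (k n) (real CARD('d)) / lam n) \<longlonglongrightarrow> 0"
    and \<tau>: "\<tau> > 0"
  shows "\<exists>E. (\<forall>n. E n \<in> sets M) \<and> ((\<lambda>n. measure M (E n)) \<longlonglongrightarrow> 0) \<and>
    (\<forall>\<^sub>F n in sequentially. \<forall>\<omega>\<in>space M - E n. \<forall>b. (\<forall>i\<in>{1..q n}. \<bar>b i\<bar> \<le> R n) \<longrightarrow>
      \<bar>G_bar n (k n) (\<lambda>i. Z i \<omega>) (sieve_fun \<phi> (q n) b)
        - (norm_w P (\<lambda>x. sieve_fun \<phi> (q n) b x - g0 x))\<^sup>2\<bar> \<le> \<tau> * lam n)"
proof -
  let ?d = "real CARD('d)"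
  define y where "y n = (real (q n))\<^sup>2 * (R n)\<^sup>2 * approx_rate n (k n) ?d / lam n" for n
  have y0: "y \<longlonglongrightarrow> 0" using rate unfolding y_def .
  obtain C mY L0 where C: "C > 0"
    and Y2: "\<exists>m. regression_on_W P (\<lambda>z. (outcome z)\<^sup>2) m \<and> (\<forall>w\<in>cbox 0 1. m w < C)"
    and mY: "regression_on_W P outcome mY" "L0-lipschitz_on (cbox 0 1) mY"
    and X: "\<And>n i. i \<in> {1..q n} \<Longrightarrow>
        (\<exists>m. regression_on_W P (\<lambda>z. (\<phi> i (regressor z))\<^sup>2) m \<and> (\<forall>w\<in>cbox 0 1. m w < C)) \<and>
        (\<exists>m. regression_on_W P (\<lambda>z. \<phi> i (regressor z)) m \<and>
             (\<forall>w1\<in>cbox 0 1. \<forall>w2\<in>cbox 0 1. \<bar>m w1 - m w2\<bar> \<le> C * norm (w1 - w2)))"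
    using N3 unfolding regular_cond_moments_def by blast
  define L where "L = max L0 C"
  have L: "L \<ge> 0" "C \<le> L" "L0 \<le> L" using C by (auto simp: L_def)
  have Y1: "\<exists>m. regression_on_W P outcome m \<and> (\<forall>w1\<in>cbox 0 1. \<forall>w2\<in>cbox 0 1. \<bar>m w1 - m w2\<bar> \<le> L * norm (w1 - w2))"
  proof (intro exI conjI ballI)
    fix w1 w2 :: "(real, 'd) vec" assume w: "w1 \<in> cbox 0 1" "w2 \<in> cbox 0 1"
    have "\<bar>mY w1 - mY w2\<bar> \<le> L0 * norm (w1 - w2)"
      using lipschitz_onD[OF mY(2) w] by (simp add: dist_norm)
    also have "\<dots> \<le> L * norm (w1 - w2)" using L by (intro mult_right_mono) auto
    finally show "\<bar>mY w1 - mY w2\<bar> \<le> L * norm (w1 - w2)" .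
  qed (rule mY)
  have X1: "\<exists>m. regression_on_W P (\<lambda>z. \<phi> i (regressor z)) m \<and>
             (\<forall>w1\<in>cbox 0 1. \<forall>w2\<in>cbox 0 1. \<bar>m w1 - m w2\<bar> \<le> L * norm (w1 - w2))" if i: "i \<in> {1..q n}" for i n
  proof -
    obtain m where m: "regression_on_W P (\<lambda>z. \<phi> i (regressor z)) m"
      "\<And>w1 w2. w1 \<in> cbox 0 1 \<Longrightarrow> w2 \<in> cbox 0 1 \<Longrightarrow> \<bar>m w1 - m w2\<bar> \<le> C * norm (w1 - w2)"
      using X[OF i] by blast
    have "\<bar>m w1 - m w2\<bar> \<le> L * norm (w1 - w2)" if "w1 \<in> cbox 0 1" "w2 \<in> cbox 0 1" for w1 w2
      using m(2)[OF that] mult_right_mono[OF L(2), of "norm (w1 - w2)"] by simp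
    with m(1) show ?thesis by blast
  qed
  obtain c where c: "c > 0" and cells: "\<forall>\<^sub>F n in sequentially. norm (1 / real (k n) ^ CARD('d))
      \<le> c * norm (Min (cell_prob P (k n) ` (cell_indices (k n) :: ('d \<Rightarrow> nat) set)))"
    using N2 unfolding balanced_cells_def by (auto elim!: landau_o.bigE)
  let ?v = "\<lambda>n. 1 / (c * real (k n) ^ CARD('d))"
  let ?t = "\<lambda>n. \<tau> / 2 * lam n"
  let ?p = "\<lambda>n. (R n)\<^sup>2 * (8 * C * (real (q n + 1))\<^sup>2 * (real (k n) ^ CARD('d) / sqrt (real n))) / ?t n
        + real (k n) ^ CARD('d) * (4 / (real n * ?v n))"
  let ?dev = "\<lambda>n \<omega> b. \<bar>G_bar n (k n) (\<lambda>i. Z i \<omega>) (sieve_fun \<phi> (q n) b)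
        - (norm_w P (\<lambda>x. sieve_fun \<phi> (q n) b x - g0 x))\<^sup>2\<bar>"
  let ?good = "\<lambda>n E. measure M E \<le> ?p n \<and> (\<forall>\<omega>\<in>space M - E. \<forall>b. (\<forall>i\<in>{1..q n}. \<bar>b i\<bar> \<le> R n) \<longrightarrow>
      ?dev n \<omega> b \<le> ?t n + (R n)\<^sup>2 * (real (q n + 1) * L * (?d / real (k n)))\<^sup>2)"
  let ?pre = "\<lambda>n. lam n > 0 \<and> lam n \<le> 1 \<and> k n \<ge> 1 \<and> q n \<ge> 1 \<and> n \<ge> 1 \<and> R n \<ge> 1 \<and>
      (\<forall>j\<in>cell_indices (k n). cell_prob P (k n) (j :: 'd \<Rightarrow> nat) \<ge> ?v n)"
  have pre: "\<forall>\<^sub>F n in sequentially. ?pre n"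
  proof -
    have "\<forall>\<^sub>F n in sequentially. k n \<ge> 1" "\<forall>\<^sub>F n in sequentially. q n \<ge> 1" "\<forall>\<^sub>F n in sequentially. R n \<ge> 1"
      using k q R by (auto simp: filterlim_at_top)
    with lam eventually_ge_at_top[of "1::nat"] cells show ?thesis
    proof eventually_elim
      case (elim n)
      have "?v n \<le> cell_prob P (k n) j" if j: "j \<in> cell_indices (k n)" for j :: "'d \<Rightarrow> nat"
      proof -
        let ?S = "cell_prob P (k n) ` (cell_indices (k n) :: ('d \<Rightarrow> nat) set)"
        have S: "finite ?S" "?S \<noteq> {}" using j by auto
        have "Min ?S \<ge> 0" using S by (auto simp: cell_prob_def)
        then have "1 / real (k n) ^ CARD('d) \<le> c * Min ?S" using elim by simp
        also have "\<dots> \<le> c * cell_prob P (k n) j" using S j c by (intro mult_left_mono Min_le) auto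
        finally show ?thesis using c elim by (simp add: field_simps)
      qed
      then show ?case using elim by blast
    qed
  qed
  have "\<forall>n. \<exists>E. E \<in> sets M \<and> (?pre n \<longrightarrow> ?good n E)"
  proof
    fix n
    show "\<exists>E. E \<in> sets M \<and> (?pre n \<longrightarrow> ?good n E)"
    proof (cases "?pre n")
      case True
      have "\<exists>E\<in>sets M. ?good n E"
      proof (rule criterion_deviation[where q = "q n" and k = "k n" and n = n and C = C and L = L
            and v = "?v n" and R = "R n" and t = "?t n", OF C L(1) Y2 Y1])
        have "k n \<ge> 1" "lam n > 0" using True by auto
        then show "?v n > 0" "?t n > 0" using c \<tau> by auto
      qed (use X X1 True in blast)+
      then show ?thesis by blast
    next
      case False
      have "?pre n \<longrightarrow> ?good n {}" by (rule impI, rule notE[OF False], assumption)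
      then show ?thesis by (intro exI[of _ "{}"] conjI[OF sets.empty_sets])
    qed
  qed
  from choice[OF this] obtain E where E0: "\<forall>n. E n \<in> sets M \<and> (?pre n \<longrightarrow> ?good n (E n))" by (rule exE)
  have Es: "E n \<in> sets M" for n by (rule conjunct1[OF spec[OF E0]])
  have E: "?good n (E n)" if "?pre n" for n by (rule mp[OF conjunct2[OF spec[OF E0]] that])
  have aux: "real (k n) ^ CARD('d) / sqrt (real n) \<le> approx_rate n (k n) ?d"
    "1 / real (k n) \<le> approx_rate n (k n) ?d" "0 < approx_rate n (k n) ?d"
    "approx_rate n (k n) ?d \<le> y n" "(real (q n))\<^sup>2 * (R n)\<^sup>2 * approx_rate n (k n) ?d = y n * lam n"
    "(real (q n + 1))\<^sup>2 \<le> 4 * (real (q n))\<^sup>2" if p: "?pre n" for n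
  proof -
    have "real (k n) ^ CARD('d) = real (k n) powr ?d" using p by (simp add: powr_realpow)
    also have "\<dots> \<le> real (k n) powr (3 * ?d / 2)" using p by (intro powr_mono) auto
    finally have kd: "real (k n) ^ CARD('d) / sqrt (real n) \<le> real (k n) powr (3 * ?d / 2) / sqrt (real n)"
      by (intro divide_right_mono) auto
    then show "real (k n) ^ CARD('d) / sqrt (real n) \<le> approx_rate n (k n) ?d"
      by (simp add: approx_rate_def add_increasing2)
    show D1: "1 / real (k n) \<le> approx_rate n (k n) ?d" by (simp add: approx_rate_def)
    have "0 < 1 / real (k n)" using p by simp
    with D1 show D0: "0 < approx_rate n (k n) ?d" by linarith
    show yl: "(real (q n))\<^sup>2 * (R n)\<^sup>2 * approx_rate n (k n) ?d = y n * lam n" using p by (simp add: y_def)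
    have "1 * 1 * approx_rate n (k n) ?d \<le> (real (q n))\<^sup>2 * (R n)\<^sup>2 * approx_rate n (k n) ?d"
      using p D0 by (intro mult_right_mono mult_mono) auto
    also have "\<dots> = y n * lam n" by (rule yl)
    also have "\<dots> \<le> y n * 1" using p D0 by (intro mult_left_mono) (auto simp: y_def)
    finally show "approx_rate n (k n) ?d \<le> y n" by simp
    have "(real (q n + 1))\<^sup>2 \<le> (2 * real (q n))\<^sup>2" using p by (intro power_mono) auto
    then show "(real (q n + 1))\<^sup>2 \<le> 4 * (real (q n))\<^sup>2" by (simp add: power_mult_distrib)
  qed
  have p_le: "?p n \<le> 64 * C / \<tau> * y n + 4 * c * (y n)\<^sup>2" if p: "?pre n" for n
  proof -
    note a = aux[OF p]
    let ?D = "approx_rate n (k n) ?d"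
    have "(R n)\<^sup>2 * (8 * C * (real (q n + 1))\<^sup>2 * (real (k n) ^ CARD('d) / sqrt (real n))) / ?t n
        \<le> (R n)\<^sup>2 * (8 * C * (4 * (real (q n))\<^sup>2) * ?D) / ?t n"
      using a p C \<tau> by (intro divide_right_mono mult_left_mono mult_mono) auto
    also have "\<dots> = 64 * C / \<tau> * y n" using p \<tau> by (simp add: y_def field_simps)
    finally have 1: "(R n)\<^sup>2 * (8 * C * (real (q n + 1))\<^sup>2 * (real (k n) ^ CARD('d) / sqrt (real n))) / ?t n
        \<le> 64 * C / \<tau> * y n" .
    have "real (k n) ^ CARD('d) * (4 / (real n * ?v n)) = 4 * c * (real (k n) ^ CARD('d) / sqrt (real n))\<^sup>2"
      using p c by (simp add: power_divide power2_eq_square)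
    also have "\<dots> \<le> 4 * c * (y n)\<^sup>2"
      using a c by (intro mult_left_mono power_mono) auto
    finally show ?thesis using 1 by linarith
  qed
  have "(\<lambda>n. measure M (E n)) \<longlonglongrightarrow> 0"
  proof (rule tendsto_sandwich[where f = "\<lambda>_. 0" and h = "\<lambda>n. 64 * C / \<tau> * y n + 4 * c * (y n)\<^sup>2"])
    have "(\<lambda>n. 64 * C / \<tau> * y n + 4 * c * (y n)\<^sup>2) \<longlonglongrightarrow> 64 * C / \<tau> * 0 + 4 * c * 0\<^sup>2"
      by (intro tendsto_intros y0)
    then show "(\<lambda>n. 64 * C / \<tau> * y n + 4 * c * (y n)\<^sup>2) \<longlonglongrightarrow> 0" by simp
    show "\<forall>\<^sub>F n in sequentially. measure M (E n) \<le> 64 * C / \<tau> * y n + 4 * c * (y n)\<^sup>2"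
      using pre by eventually_elim (rule order_trans[OF conjunct1[OF E] p_le])
  qed auto
  moreover have "\<forall>\<^sub>F n in sequentially. \<forall>\<omega>\<in>space M - E n. \<forall>b. (\<forall>i\<in>{1..q n}. \<bar>b i\<bar> \<le> R n) \<longrightarrow>
      ?dev n \<omega> b \<le> \<tau> * lam n"
  proof -
    have "(\<lambda>n. 4 * (L * ?d)\<^sup>2 * y n) \<longlonglongrightarrow> 4 * (L * ?d)\<^sup>2 * 0" by (intro tendsto_intros y0)
    then have "\<forall>\<^sub>F n in sequentially. 4 * (L * ?d)\<^sup>2 * y n < \<tau> / 2"
      by (rule order_tendstoD) (use \<tau> in auto)
    with pre show ?thesis
    proof eventually_elim
      case (elim n)
      note p = elim(1) and a = aux[OF elim(1)]
      have kk: "(1 / real (k n))\<^sup>2 \<le> approx_rate n (k n) ?d"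
      proof -
        have "(1 / real (k n))\<^sup>2 \<le> 1 / real (k n)" using p by (simp add: power2_eq_square field_simps)
        with a(2) show ?thesis by linarith
      qed
      have "(R n)\<^sup>2 * (real (q n + 1) * L * (?d / real (k n)))\<^sup>2
          = (L * ?d)\<^sup>2 * ((R n)\<^sup>2 * ((real (q n + 1))\<^sup>2 * (1 / real (k n))\<^sup>2))"
        by (simp add: power_mult_distrib power_divide)
      also have "\<dots> \<le> (L * ?d)\<^sup>2 * ((R n)\<^sup>2 * (4 * (real (q n))\<^sup>2 * approx_rate n (k n) ?d))"
        using a kk by (intro mult_left_mono mult_mono) auto
      also have "\<dots> = 4 * (L * ?d)\<^sup>2 * ((real (q n))\<^sup>2 * (R n)\<^sup>2 * approx_rate n (k n) ?d)" by simp
      also have "\<dots> = (4 * (L * ?d)\<^sup>2 * y n) * lam n" unfolding a(5) by simp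
      also have "\<dots> \<le> \<tau> / 2 * lam n" using elim p by (intro mult_right_mono) auto
      finally have "?t n + (R n)\<^sup>2 * (real (q n + 1) * L * (?d / real (k n)))\<^sup>2 \<le> \<tau> * lam n" by simp
      then show ?case using conjunct2[OF E[OF p]] by (meson order_trans)
    qed
  qed
  ultimately show ?thesis using Es by blast
qed

end

section \<open>Posterior consistency\<close>

context sieve_sample begin

lemma cube_near_coefficients:
  assumes b: "b \<in> coeff_cube q a s" and s: "s \<ge> 0"
  shows "(\<Sum>i=1..q. (b i - a i)\<^sup>2) \<le> real q * s\<^sup>2"
    and "L2_set b {1..q} \<le> L2_set a {1..q} + sqrt (real q * s\<^sup>2)"
proof -
  have "\<bar>b i - a i\<bar> \<le> s" if "i \<in> {1..q}" for i
    using b that by (auto simp: PiE_def Pi_def abs_le_iff algebra_simps)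
  then have "(\<Sum>i=1..q. (b i - a i)\<^sup>2) \<le> (\<Sum>i=1..q. s\<^sup>2)"
    by (intro sum_mono) (metis abs_ge_zero power2_abs power_mono)
  then show sum: "(\<Sum>i=1..q. (b i - a i)\<^sup>2) \<le> real q * s\<^sup>2" by simp
  have "L2_set b {1..q} = L2_set (\<lambda>i. a i + (b i - a i)) {1..q}" by simp
  also have "\<dots> \<le> L2_set a {1..q} + L2_set (\<lambda>i. b i - a i) {1..q}" by (rule L2_set_triangle_ineq)
  also have "L2_set (\<lambda>i. b i - a i) {1..q} \<le> sqrt (real q * s\<^sup>2)"
    unfolding L2_set_def using sum by (rule real_sqrt_le_mono)
  finally show "L2_set b {1..q} \<le> L2_set a {1..q} + sqrt (real q * s\<^sup>2)" by simp
qed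

text \<open>
  Here \<open>h = q log n\<close> and \<open>x = n \<lambda>\<^sub>n\<close>. Off an event of vanishing probability the posterior mass is at
  most \<open>exp(K h - c x/4) + exp(K h - x/2)\<close>, a deterministic sequence; it tends to zero because
  \<open>x \<ge> q \<surd>n\<close> gives \<open>h/x \<le> log n/\<surd>n\<close>.
\<close>

lemma posterior_consistency:
  fixes \<pi> :: "nat \<Rightarrow> (nat \<Rightarrow> real) \<Rightarrow> real" and q k :: "nat \<Rightarrow> nat" and R :: "nat \<Rightarrow> real" and D :: real
  defines "lam \<equiv> \<lambda>n. varphi ((\<eta> (q n))\<^sup>2)"
  assumes \<pi>: "\<And>n. \<pi> n \<in> borel_measurable (lebesgue_coeff (q n))" "\<And>n b. \<pi> n b \<ge> 0"
    and admissible: "admissible_prior_sequence \<pi> q (\<lambda>n. approx_rate n (k n) (real CARD('d))) lam R"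
    and lam1: "lam \<longlonglongrightarrow> 0"
    and N2: "balanced_cells P k" and N3: "regular_cond_moments P \<phi> q"
    and q: "filterlim q at_top sequentially" and k: "filterlim k at_top sequentially"
    and projection: "\<And>n i. i \<in> {1..q n} \<Longrightarrow> innerX P (\<lambda>x. g0 x - sieve_fun \<phi> (q n) bstar x) (\<phi> i) = 0"
    and bias: "(\<lambda>n. norm_s P (\<lambda>x. sieve_fun \<phi> (q n) bstar x - g0 x)) \<longlonglongrightarrow> 0"
    and bstar: "\<And>q. L2_set bstar {1..q} \<le> D"
    and C1: "C1 > 0" "\<And>g. g \<in> L2X P \<Longrightarrow> (norm_w P (\<lambda>x. g x - g0 x))\<^sup>2 \<ge>
        C1 * (\<Sum>j. varphi ((\<eta> (Suc j))\<^sup>2) * \<bar>innerX P (\<lambda>x. g x - g0 x) (\<phi> (Suc j))\<bar>\<^sup>2)"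
    and C2: "C2 > 0" "\<And>n. (norm_w P (\<lambda>x. sieve_fun \<phi> (q n) bstar x - g0 x))\<^sup>2 \<le>
        C2 * (\<Sum>j. varphi ((\<eta> (Suc j))\<^sup>2)
                   * \<bar>innerX P (\<lambda>x. g0 x - sieve_fun \<phi> (q n) bstar x) (\<phi> (Suc j))\<bar>\<^sup>2)"
    and \<epsilon>: "\<epsilon> > 0"
  shows "op_one M (\<lambda>n \<omega>. quasi_posterior (\<pi> n) \<phi> (q n) (k n) n (\<lambda>i. Z i \<omega>)
             {b. dist_Theta P (sieve_fun \<phi> (q n) b) > \<epsilon>})"
proof -
  let ?A = "\<lambda>n. {b. dist_Theta P (sieve_fun \<phi> (q n) b) > \<epsilon>}"
  let ?T = "\<lambda>n \<omega>. quasi_posterior (\<pi> n) \<phi> (q n) (k n) n (\<lambda>i. Z i \<omega>) (?A n)"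
  let ?e = "\<lambda>n. norm_s P (\<lambda>x. sieve_fun \<phi> (q n) bstar x - g0 x)"
  define h where "h n = real (q n) * ln (real n)" for n
  define x where "x n = real n * lam n" for n
  have Theta: "Theta_I P \<noteq> {}" using g0_identified by auto
  have A: "?A n \<inter> space (lebesgue_coeff (q n)) \<in> sets (lebesgue_coeff (q n))" for n
    by (rule far_coefficients_measurable[OF Theta])
  have \<phi>: "\<phi> i \<in> borel_measurable borel" if "i \<ge> 1" for i
    using basis_L2X[OF that] by (simp add: L2X_def)
  have meas: "?T n \<in> borel_measurable M" for n
    by (rule quasi_posterior_measurable[OF Z_measurable _ \<pi>(1) A]) (simp add: \<phi>)
  have q1: "\<forall>\<^sub>F n in sequentially. q n \<ge> 1" using q by (simp add: filterlim_at_top)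
  have n_ge: "\<forall>\<^sub>F n in sequentially. real n \<ge> y" for y
    using filterlim_real_sequentially by (simp add: filterlim_at_top)
  have lam_pos: "\<forall>\<^sub>F n in sequentially. lam n > 0"
    using q1 by eventually_elim (simp add: lam_def link_weight_pos)
  have lam_le: "\<forall>\<^sub>F n in sequentially. lam n \<le> y" if "y > 0" for y
    using order_tendstoD(2)[OF lam1 that] by eventually_elim simp
  from admissible have rate: "(\<lambda>n. (real (q n))\<^sup>2 * (R n)\<^sup>2 * approx_rate n (k n) (real CARD('d)) / lam n) \<longlonglongrightarrow> 0"
    and R: "filterlim R at_top sequentially"
    and grow: "\<forall>\<^sub>F n in sequentially. real (q n) * sqrt (real n) \<le> x n"
    unfolding admissible_prior_sequence_def x_def by auto
  from admissible obtain K1 where K1: "K1 \<ge> 0" and mass: "\<forall>\<^sub>F n in sequentially.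
      (\<integral>\<^sup>+b. ennreal (\<pi> n b) \<partial>lebesgue_coeff (q n)) \<le> ennreal (exp (K1 * h n)) \<and>
      (\<integral>\<^sup>+b. ennreal (\<pi> n b) * indicator {b. \<exists>i\<in>{1..q n}. \<bar>b i\<bar> > R n} b \<partial>lebesgue_coeff (q n))
        \<le> ennreal (exp (K1 * h n - x n))"
    unfolding admissible_prior_sequence_def h_def x_def by blast
  from admissible obtain K2 where K2: "K2 \<ge> 0" and local: "\<forall>\<^sub>F n in sequentially. AE b in lebesgue_coeff (q n).
      L2_set b {1..q n} \<le> D + 1 \<longrightarrow> exp (- K2 * h n) \<le> \<pi> n b"
    unfolding admissible_prior_sequence_def h_def by blast
  define K where "K = K1 + K2 + 1"
  define c where "c = C1 * \<epsilon>\<^sup>2 / 2"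
  have c: "c > 0" using C1 \<epsilon> by (simp add: c_def)
  \<comment> \<open>With \<open>l = (c - \<tau>) \<lambda>\<^sub>n\<close> and \<open>u = 5 \<tau> \<lambda>\<^sub>n\<close>, the exponents \<open>(l - u)/2\<close> and \<open>\<lambda>\<^sub>n - u/2\<close> must stay positive multiples of \<open>\<lambda>\<^sub>n\<close>: \<open>c/2 - 3 \<tau> \<ge> c/4\<close> and \<open>1 - 5 \<tau>/2 \<ge> 1/2\<close>.\<close>
  define \<tau> where "\<tau> = min (c / 12) (1 / 5)"
  have \<tau>: "\<tau> > 0" "\<tau> \<le> c / 12" "\<tau> \<le> 1 / 5" using c by (auto simp: \<tau>_def)
  obtain E where E: "\<And>n. E n \<in> sets M" "(\<lambda>n. measure M (E n)) \<longlonglongrightarrow> 0"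
    and conc: "\<forall>\<^sub>F n in sequentially. \<forall>\<omega>\<in>space M - E n. \<forall>b. (\<forall>i\<in>{1..q n}. \<bar>b i\<bar> \<le> R n) \<longrightarrow>
      \<bar>G_bar n (k n) (\<lambda>i. Z i \<omega>) (sieve_fun \<phi> (q n) b)
        - (norm_w P (\<lambda>x. sieve_fun \<phi> (q n) b x - g0 x))\<^sup>2\<bar> \<le> \<tau> * lam n"
    using criterion_concentration[OF N2 N3 q k R lam_pos lam_le[OF zero_less_one] rate \<tau>(1)] by blast
  define bound where "bound n = exp (K * h n - c / 4 * x n) + exp (K * h n - x n / 2)" for n
  have R_ge: "\<forall>\<^sub>F n in sequentially. R n \<ge> D + 1" using R by (simp add: filterlim_at_top)
  have e2: "(\<lambda>n. (?e n)\<^sup>2) \<longlonglongrightarrow> 0" using tendsto_power[OF bias, of 2] by simp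
  have bias_small: "\<forall>\<^sub>F n in sequentially. (?e n)\<^sup>2 \<le> \<epsilon>\<^sup>2 / 2 \<and> C2 * (?e n)\<^sup>2 \<le> \<tau>"
  proof -
    have "0 < \<epsilon>\<^sup>2 / 2" "0 < \<tau> / C2" using \<epsilon> \<tau> C2 by auto
    from order_tendstoD(2)[OF e2 this(1)] order_tendstoD(2)[OF e2 this(2)] show ?thesis
      by eventually_elim (use C2 in \<open>auto simp: field_simps\<close>)
  qed
  have key: "\<forall>\<^sub>F n in sequentially. \<forall>\<omega>\<in>space M - E n. 0 \<le> ?T n \<omega> \<and> ?T n \<omega> \<le> bound n"
    using q1 lam_pos lam_le[OF zero_less_one] grow mass local conc R_ge bias_small n_ge[of 1] n_ge[of "1 / \<tau>"]
  proof eventually_elim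
    case (elim n)
    note q_pos = elim(1) and l_pos = elim(2) and l_le = elim(3) and grow_n = elim(4) and RD = elim(8)
    have n1: "real n \<ge> 1" "\<tau> * real n \<ge> 1" "n \<ge> 1" using elim(10,11) \<tau>(1) by (simp_all add: field_simps)
    have bias_n: "(?e n)\<^sup>2 \<le> \<epsilon>\<^sup>2 / 2" "C2 * (?e n)\<^sup>2 \<le> \<tau>" using elim(9) by auto
    have qn: "real (q n) \<ge> 1" using q_pos by simp
    \<comment> \<open>The cube of half-side \<open>s\<close> lies in the Euclidean ball of squared radius \<open>\<tau> \<lambda>\<^sub>n\<close>.\<close>
    define s where "s = sqrt (\<tau> * lam n / real (q n))"
    have qs: "real (q n) * s\<^sup>2 = \<tau> * lam n" using l_pos \<tau> qn by (simp add: s_def)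
    have s: "s > 0" using l_pos \<tau> q_pos by (simp add: s_def)
    have qs1: "sqrt (real (q n) * s\<^sup>2) \<le> 1"
      using \<tau> l_pos l_le mult_mono[of \<tau> 1 "lam n" 1] unfolding qs by simp
    \<comment> \<open>The half-side is bounded below by a power of \<open>n\<close>, so the volume of the cube is at least \<open>exp(- q log n)\<close>.\<close>
    have \<open>1 / real n \<le> s\<close>
    proof -
      have "1 / real n * (1 / real n) \<le> \<tau> * (1 / real n)" using n1 by (intro mult_right_mono) (auto simp: field_simps)
      also have "\<dots> \<le> \<tau> * (1 / sqrt (real n))"
        using n1 \<tau> self_le_power[of "real n" 2] by (intro mult_left_mono divide_left_mono real_le_lsqrt) auto
      also have "1 / sqrt (real n) = sqrt (real n) / real n" using n1 by (simp add: divide_simps)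
      also have "\<tau> * \<dots> \<le> \<tau> * (lam n / real (q n))"
      proof (intro mult_left_mono)
        show "sqrt (real n) / real n \<le> lam n / real (q n)"
          using grow_n q_pos n1 by (simp add: x_def divide_simps mult_ac)
      qed (use \<tau> in auto)
      finally show ?thesis unfolding s_def by (intro real_le_rsqrt) (simp add: power2_eq_square)
    qed
    then have volume: "exp (- h n) \<le> (2 * s) ^ q n"
      using inverse_power_ge_exp[of n 1 "2 * s" "q n"] n1 s by (simp add: h_def)
    show ?case
    proof
      fix \<omega> assume \<omega>: "\<omega> \<in> space M - E n"
      let ?G = "\<lambda>b. G_bar n (k n) (\<lambda>i. Z i \<omega>) (sieve_fun \<phi> (q n) b)"
      let ?W = "\<lambda>b. (norm_w P (\<lambda>x. sieve_fun \<phi> (q n) b x - g0 x))\<^sup>2"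
      have dev: "\<bar>?G b - ?W b\<bar> \<le> \<tau> * lam n" if "\<And>i. i \<in> {1..q n} \<Longrightarrow> \<bar>b i\<bar> \<le> R n" for b
        using elim(7) \<omega> that by blast
      have Gm: "?G \<in> borel_measurable (lebesgue_coeff (q n))"
        using measurable_compose[OF measurable_Pair1'[of \<omega> M "lebesgue_coeff (q n)"]
            G_bar_sieve_measurable[of Z M "q n" \<phi> n "k n", OF Z_measurable]] \<omega> \<phi>
        by simp
      have away: "(c - \<tau>) * lam n \<le> ?G b"
        if b: "b \<in> ?A n" and bR: "\<And>i. i \<in> {1..q n} \<Longrightarrow> \<bar>b i\<bar> \<le> R n" for b
      proof -
        have "\<epsilon> < norm_s P (\<lambda>x. sieve_fun \<phi> (q n) b x - g0 x)"
          using b dist_Theta_le[OF g0_identified, of "sieve_fun \<phi> (q n) b"] by simp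
        then have "\<epsilon>\<^sup>2 \<le> (norm_s P (\<lambda>x. sieve_fun \<phi> (q n) b x - g0 x))\<^sup>2" using \<epsilon> by (intro power_mono) auto
        also have "\<dots> = (\<Sum>i=1..q n. (b i - bstar i)\<^sup>2) + (?e n)\<^sup>2"
          by (rule sieve_pythagoras[OF q_pos projection])
        finally have far: "\<epsilon>\<^sup>2 / 2 \<le> (\<Sum>i=1..q n. (b i - bstar i)\<^sup>2)" using bias_n by linarith
        have "c * lam n = C1 * (lam n * (\<epsilon>\<^sup>2 / 2))" by (simp add: c_def)
        also have "\<dots> \<le> C1 * (lam n * (\<Sum>i=1..q n. (b i - bstar i)\<^sup>2))"
          using far C1 l_pos by (intro mult_left_mono) auto
        also have "\<dots> \<le> ?W b"
          unfolding lam_def by (rule weak_norm_lower[OF q_pos projection C1])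
        finally show ?thesis using dev[of b, OF bR] by (simp add: algebra_simps abs_le_iff)
      qed
      have near: "?G b \<le> 5 * \<tau> * lam n \<and> L2_set b {1..q n} \<le> D + 1" if b: "b \<in> coeff_cube (q n) bstar s" for b
      proof
        note close = cube_near_coefficients[OF b less_imp_le[OF s]]
        show N: "L2_set b {1..q n} \<le> D + 1" using close(2) bstar[of "q n"] qs1 by linarith
        have bR: "\<bar>b i\<bar> \<le> R n" if "i \<in> {1..q n}" for i
          using abs_le_L2_set[OF that, of b] N RD by linarith
        have "?W b \<le> 2 * (\<Sum>i=1..q n. (b i - bstar i)\<^sup>2) + 2 * (C2 * (lam n * (?e n)\<^sup>2))"
          unfolding lam_def by (rule weak_norm_upper[OF q_pos projection C2])
        moreover have "C2 * (lam n * (?e n)\<^sup>2) \<le> \<tau> * lam n"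
        proof -
          have "C2 * (?e n)\<^sup>2 * lam n \<le> \<tau> * lam n" using bias_n l_pos by (intro mult_right_mono) auto
          then show ?thesis by (simp add: mult_ac)
        qed
        ultimately show "?G b \<le> 5 * \<tau> * lam n" using close(1) dev[of b, OF bR] unfolding qs by linarith
      qed
      have cube: "AE b in lebesgue_coeff (q n). b \<in> coeff_cube (q n) bstar s \<longrightarrow>
          exp (- K2 * h n) \<le> \<pi> n b \<and> ?G b \<le> 5 * \<tau> * lam n"
        using elim(6)
        by eventually_elim (use near in blast)
      have total: "(\<integral>\<^sup>+b. ennreal (\<pi> n b) \<partial>lebesgue_coeff (q n)) \<le> ennreal (exp (K1 * h n))"
        and tail: "(\<integral>\<^sup>+b. ennreal (\<pi> n b) * indicator {b. \<exists>i\<in>{1..q n}. \<bar>b i\<bar> > R n} b \<partial>lebesgue_coeff (q n))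
          \<le> ennreal (exp (K1 * h n - x n))" using elim(5) by auto
      note ratio = posterior_ratio_bound[where l = "(c - \<tau>) * lam n" and R = "R n" and A = "?A n" and G = ?G,
          OF \<pi> Gm G_bar_nonneg A total exp_ge_zero tail exp_ge_zero cube exp_gt_zero s away,
          of n]
      \<comment> \<open>The logarithmic cost of the denominator: prior density, volume of the cube, criterion.\<close>
      let ?z = "(K2 + 1) * h n + 5 / 2 * (\<tau> * x n)"
      have "exp (- ?z) = exp (- K2 * h n) * exp (- h n) * exp (- (real n / 2) * (5 * \<tau> * lam n))"
        by (simp add: exp_add[symmetric] x_def algebra_simps)
      also have "\<dots> \<le> exp (- K2 * h n) * (2 * s) ^ q n * exp (- (real n / 2) * (5 * \<tau> * lam n))"
        by (intro mult_right_mono mult_left_mono volume) auto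
      finally have den: "exp (- ?z) \<le> \<dots>" .
      have T: "?T n \<omega> \<le> (exp (K1 * h n) * exp (- (real n / 2) * ((c - \<tau>) * lam n)) + exp (K1 * h n - x n))
          / (exp (- K2 * h n) * (2 * s) ^ q n * exp (- (real n / 2) * (5 * \<tau> * lam n)))"
        using ratio(2) unfolding quasi_posterior_def .
      also have "\<dots> \<le> (exp (K1 * h n) * exp (- (real n / 2) * ((c - \<tau>) * lam n)) + exp (K1 * h n - x n)) / exp (- ?z)"
        using den by (intro divide_left_mono mult_pos_pos) (use s in \<open>auto intro: add_nonneg_nonneg\<close>)
      also have "\<dots> = exp (K1 * h n - (c - \<tau>) * x n / 2 + ?z) + exp (K1 * h n - x n + ?z)"
      proof -
        have e: "- (real n / 2) * ((c - \<tau>) * lam n) = - ((c - \<tau>) * x n / 2)" by (simp add: x_def)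
        have "(exp a * exp (- b) + exp d) / exp (- z) = exp (a - b + z) + exp (d + z)" for a b d z :: real
          by (simp add: exp_add exp_diff exp_minus divide_inverse distrib_right)
        then show ?thesis unfolding e .
      qed
      also have "\<dots> \<le> bound n"
      proof -
        have xn: "x n \<ge> 0" using l_pos by (simp add: x_def)
        have "\<tau> * x n \<le> c / 12 * x n" "\<tau> * x n \<le> 1 / 5 * x n" by (intro mult_right_mono \<tau> xn)+
        then have "K1 * h n - (c - \<tau>) * x n / 2 + ?z \<le> K * h n - c / 4 * x n"
          "K1 * h n - x n + ?z \<le> K * h n - x n / 2"
          by (simp_all add: K_def algebra_simps)
        then show ?thesis unfolding bound_def by (intro add_mono) auto
      qed
      finally show "0 \<le> ?T n \<omega> \<and> ?T n \<omega> \<le> bound n"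
        using ratio(1) unfolding quasi_posterior_def by simp
    qed
  qed
  have x_top: "filterlim x at_top sequentially"
  proof -
    have "filterlim (\<lambda>n. sqrt (real n)) at_top sequentially"
      by (rule filterlim_compose[OF sqrt_at_top filterlim_real_sequentially])
    moreover have "\<forall>\<^sub>F n in sequentially. sqrt (real n) \<le> x n"
      using grow q1
    proof eventually_elim
      case (elim n)
      have "1 * sqrt (real n) \<le> real (q n) * sqrt (real n)" using elim by (intro mult_right_mono) auto
      then show ?case using elim by simp
    qed
    ultimately show ?thesis by (rule filterlim_at_top_mono)
  qed
  have bound0: "bound \<longlonglongrightarrow> 0"
  proof (rule tendsto_sandwich[where f = "\<lambda>_. 0" and h = "\<lambda>n. exp (- (c / 8 * x n)) + exp (- (1 / 4 * x n))"])
    have exp0: "(\<lambda>n. exp (- (y * x n))) \<longlonglongrightarrow> 0" if "y > 0" for y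
      by (intro filterlim_compose[OF exp_at_bot] filterlim_compose[OF filterlim_uminus_at_bot_at_top]
          filterlim_tendsto_pos_mult_at_top[OF tendsto_const that x_top])
    show "(\<lambda>n. exp (- (c / 8 * x n)) + exp (- (1 / 4 * x n))) \<longlonglongrightarrow> 0"
      using tendsto_add[OF exp0[of "c / 8"] exp0[of "1 / 4"]] c by simp
    define y where "y = min (c / 8) (1 / 4)"
    have y: "y > 0" "y \<le> c / 8" "y \<le> 1 / 4" using c by (auto simp: y_def)
    have K: "K > 0" using K1 K2 by (simp add: K_def)
    have "(\<lambda>n. ln (real n) / real n powr (1 / 2)) \<longlonglongrightarrow> 0" by (rule lim_ln_over_power) simp
    then have "\<forall>\<^sub>F n in sequentially. ln (real n) / real n powr (1 / 2) < y / K"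
      by (rule order_tendstoD) (use y K in auto)
    then show "\<forall>\<^sub>F n in sequentially. bound n \<le> exp (- (c / 8 * x n)) + exp (- (1 / 4 * x n))"
      using grow n_ge[of 1]
    proof eventually_elim
      case (elim n)
      have "K * ln (real n) \<le> y * sqrt (real n)"
        using elim K by (simp add: powr_half_sqrt field_simps)
      then have "real (q n) * (K * ln (real n)) \<le> real (q n) * (y * sqrt (real n))" by (intro mult_left_mono) auto
      also have "\<dots> \<le> y * x n" using elim y mult_left_mono[of "real (q n) * sqrt (real n)" "x n" y] by (simp add: mult_ac)
      finally have Kh: "K * h n \<le> y * x n" by (simp add: h_def mult_ac)
      have "0 \<le> real (q n) * sqrt (real n)" by simp
      then have "x n \<ge> 0" using elim by linarith
      then have "y * x n \<le> c / 8 * x n" "y * x n \<le> 1 / 4 * x n" by (intro mult_right_mono y; assumption)+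
      then show ?case using Kh unfolding bound_def by (intro add_mono) (auto simp: )
    qed
  qed (simp_all add: bound_def add_nonneg_nonneg)
  show ?thesis
    unfolding op_one_def
  proof (intro conjI allI impI meas)
    fix \<delta> :: real assume \<delta>: "\<delta> > 0"
    show "(\<lambda>n. measure M {\<omega> \<in> space M. \<bar>?T n \<omega>\<bar> > \<delta>}) \<longlonglongrightarrow> 0"
    proof (rule tendsto_sandwich[OF _ _ tendsto_const E(2)])
      show "\<forall>\<^sub>F n in sequentially. measure M {\<omega> \<in> space M. \<bar>?T n \<omega>\<bar> > \<delta>} \<le> measure M (E n)"
        using key order_tendstoD(2)[OF bound0 \<delta>]
      proof eventually_elim
        case (elim n)
        have "{\<omega> \<in> space M. \<bar>?T n \<omega>\<bar> > \<delta>} \<subseteq> E n"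
        proof (rule subsetI, rule ccontr)
          fix \<omega> assume "\<omega> \<in> {\<omega> \<in> space M. \<bar>?T n \<omega>\<bar> > \<delta>}" "\<omega> \<notin> E n"
          then have "\<bar>?T n \<omega>\<bar> > \<delta>" "0 \<le> ?T n \<omega> \<and> ?T n \<omega> \<le> bound n" using elim by auto
          then show False using elim by simp
        qed
        then show ?case using E(1) by (intro sample.finite_measure_mono)
      qed
    qed simp
  qed
qed

end

theorem theorem4p3:
  fixes M :: "'o measure"
    and Z :: "nat \<Rightarrow> 'o \<Rightarrow> ('x::euclidean_space, 'd::finite) obs"
    and P :: "('x, 'd) obs measure"
    and \<phi> :: "nat \<Rightarrow> 'x \<Rightarrow> real"
    and q k :: "nat \<Rightarrow> nat"
    and B :: "nat \<Rightarrow> real"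
    and g0 :: "'x \<Rightarrow> real"
    and bstar \<eta> :: "nat \<Rightarrow> real"
    and varphi :: "real \<Rightarrow> real"
    and prior :: prior_family
    and d :: real
  defines "d \<equiv> real CARD('d)"
  assumes model: "npiv_model P"
    and basis: "orthonormal_basis_L2X P \<phi>"
    and q: "filterlim q at_top sequentially"
    and k: "filterlim k at_top sequentially"
    and B: "filterlim B at_top sequentially"
    and N1: "iid_sample M Z P"
    and N2: "balanced_cells P k"
    and N3: "regular_cond_moments P \<phi> q"
    and N4: "sieve_approximation P \<phi> q g0 bstar \<eta>"
    and N5: "square_integrable_density_ratio P"
    and N6: "link_condition P \<phi> q g0 bstar \<eta> varphi"
    and prior: "valid_prior prior"
    and truncated: "truncated_prior prior \<Longrightarrow>
        (\<lambda>n. (real (q n))\<^sup>2 * (B n)\<^sup>2) \<in> o(\<lambda>n. real n powr (1 / (3 * d + 2))) \<and>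
        (\<lambda>n. (real (q n))\<^sup>2 * (B n)\<^sup>2
              * (real (k n) powr (3 * d / 2) / sqrt (real n) + 1 / real (k n)))
          \<in> o(\<lambda>n. varphi ((\<eta> (q n))\<^sup>2))"
    and thin_tail: "\<And>r \<beta>. prior = Thin_Tail r \<beta> \<Longrightarrow>
        r > 6 * d + 4 \<and>
        (\<lambda>n. real (q n)) \<in> o(\<lambda>n. real n powr (1 / (6 * d + 4) - 1 / r)) \<and>
        (\<lambda>n. real n powr (2 / (r - 2)) * real (q n) powr (2 * r / (r - 2))
              * (real (k n) powr (3 * d / 2) / sqrt (real n) + 1 / real (k n)) powr (r / (r - 2)))
          \<in> o(\<lambda>n. varphi ((\<eta> (q n))\<^sup>2))"
    and eps: "\<epsilon> > 0"
  shows "op_one M (\<lambda>n \<omega>.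
           quasi_posterior (prior_density prior (q n) (B n)) \<phi> (q n) (k n) n (\<lambda>i. Z i \<omega>)
             {b. dist_Theta P (sieve_fun \<phi> (q n) b) > \<epsilon>})"
proof -
  have law: "observation_law P"
    using model by (simp add: npiv_model_def observation_law_def observation_law_axioms_def)
  have unit: "AE z in P. instrument z \<in> cbox 0 1" using model by (simp add: npiv_model_def)
  interpret observation_law P by (rule law)
  obtain fW :: "(real, 'd) vec \<Rightarrow> real" where fW: "distributed P lborel instrument (\<lambda>w. ennreal (fW w))"
    using N5 unfolding square_integrable_density_ratio_def by blast
  have g0: "g0 \<in> Theta_I P" and projection: "\<And>n i. i \<in> {1..q n} \<Longrightarrow> innerX P (\<lambda>x. g0 x - sieve_fun \<phi> (q n) bstar x) (\<phi> i) = 0"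
    and sum_bstar: "summable (\<lambda>i. (bstar (Suc i))\<^sup>2)"
    and eta: "\<And>j. j \<ge> 1 \<Longrightarrow> 0 < \<eta> j \<and> \<eta> (Suc j) < \<eta> j" and eta0: "\<eta> \<longlonglongrightarrow> 0"
    and approx: "(\<lambda>n. norm_s P (\<lambda>x. sieve_fun \<phi> (q n) bstar x - g0 x)) \<in> O(\<lambda>n. \<eta> (q n))"
    using N4 unfolding sieve_approximation_def by blast+
  have vmono: "mono_on {0<..} varphi" and vpos: "\<And>t. t > 0 \<Longrightarrow> varphi t > 0"
    and v0: "(varphi \<longlongrightarrow> 0) (at_right 0)"
    using N6 unfolding link_condition_def by blast+
  obtain C1 where C1: "C1 > 0" "\<And>g. g \<in> L2X P \<Longrightarrow> (norm_w P (\<lambda>x. g x - g0 x))\<^sup>2 \<ge>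
        C1 * (\<Sum>j. varphi ((\<eta> (Suc j))\<^sup>2) * \<bar>innerX P (\<lambda>x. g x - g0 x) (\<phi> (Suc j))\<bar>\<^sup>2)"
    using N6 unfolding link_condition_def by blast
  obtain C2 where C2: "C2 > 0" "\<And>n. (norm_w P (\<lambda>x. sieve_fun \<phi> (q n) bstar x - g0 x))\<^sup>2 \<le>
        C2 * (\<Sum>j. varphi ((\<eta> (Suc j))\<^sup>2)
                   * \<bar>innerX P (\<lambda>x. g0 x - sieve_fun \<phi> (q n) bstar x) (\<phi> (Suc j))\<bar>\<^sup>2)"
    using N6 unfolding link_condition_def by blast
  have "iid_observations P M Z"
    using N1 law by (simp add: iid_sample_def iid_observations_def iid_observations_axioms_def)
  moreover have "sieve_geometry P \<phi> g0 \<eta> varphi"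
    using law basis g0 eta vmono vpos
    by (simp add: sieve_geometry_def sieve_geometry_axioms_def Theta_I_def)
  moreover have "sieve_sample_axioms P g0"
    using g0 unit AE_sum_indicator_cells[OF _ unit fW] by (simp add: sieve_sample_axioms_def)
  ultimately interpret sieve_sample P M Z \<phi> g0 bstar \<eta> varphi
    by (simp add: sieve_sample_def)
  define lam where "lam n = varphi ((\<eta> (q n))\<^sup>2)" for n
  have q1: "\<forall>\<^sub>F n in sequentially. q n \<ge> 1" using q by (simp add: filterlim_at_top)
  have eta_q: "(\<lambda>n. \<eta> (q n)) \<longlonglongrightarrow> 0" by (rule filterlim_compose[OF eta0 q])
  have lam_pos: "\<forall>\<^sub>F n in sequentially. lam n > 0"
    using q1 by eventually_elim (simp add: lam_def link_weight_pos)
  have lam0: "lam \<longlonglongrightarrow> 0"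
    unfolding lam_def
  proof (rule filterlim_compose[OF v0])
    show "filterlim (\<lambda>n. (\<eta> (q n))\<^sup>2) (at_right 0) sequentially"
      unfolding filterlim_at
    proof
      show "\<forall>\<^sub>F n in sequentially. (\<eta> (q n))\<^sup>2 \<in> {0<..} \<and> (\<eta> (q n))\<^sup>2 \<noteq> 0"
        using q1 by eventually_elim (use eta in force)
      show "(\<lambda>n. (\<eta> (q n))\<^sup>2) \<longlonglongrightarrow> 0" using tendsto_power[OF eta_q, of 2] by simp
    qed
  qed
  have lam1: "\<forall>\<^sub>F n in sequentially. lam n \<le> 1"
    using order_tendstoD(2)[OF lam0 zero_less_one] by eventually_elim simp
  have bias: "(\<lambda>n. norm_s P (\<lambda>x. sieve_fun \<phi> (q n) bstar x - g0 x)) \<longlonglongrightarrow> 0"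
  proof -
    have "(\<lambda>n. \<eta> (q n)) \<in> o(\<lambda>_. 1)" by (rule smalloI_tendsto) (use eta_q in auto)
    from smalloD_tendsto[OF landau_o.big_small_trans[OF approx this]] show ?thesis by simp
  qed
  have bstar: "L2_set bstar {1..m} \<le> sqrt (\<Sum>i. (bstar (Suc i))\<^sup>2)" for m
  proof -
    have "(\<Sum>i=1..m. (bstar i)\<^sup>2) = (\<Sum>i<m. (bstar (Suc i))\<^sup>2)"
      by (rule sum.reindex_bij_witness[where i = Suc and j = "\<lambda>j. j - 1"]) auto
    also have "\<dots> \<le> (\<Sum>i. (bstar (Suc i))\<^sup>2)" by (rule sum_le_suminf[OF sum_bstar]) auto
    finally show ?thesis unfolding L2_set_def by (rule real_sqrt_le_mono)
  qed
  have "\<exists>R. admissible_prior_sequence (\<lambda>n. prior_density prior (q n) (B n)) q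
      (\<lambda>n. approx_rate n (k n) (real CARD('d))) lam R"
  proof (cases "truncated_prior prior")
    case True
    show ?thesis
      using truncated[OF True]
      by (intro exI[of _ B] truncated_prior_admissible[OF prior True q k B lam_pos lam1])
        (simp_all add: approx_rate_def d_def lam_def)
  next
    case False
    then obtain r \<beta> where thin: "prior = Thin_Tail r \<beta>" by (cases prior) auto
    have r: "r > 2" using thin_tail[OF thin] by (simp add: d_def)
    show ?thesis
      using thin_tail[OF thin] prior unfolding thin
      by (intro thin_tail_prior_admissible[OF r _ q k lam_pos lam1])
        (simp_all add: approx_rate_def d_def lam_def)
  qed
  then obtain R where R: "admissible_prior_sequence (\<lambda>n. prior_density prior (q n) (B n)) q
      (\<lambda>n. approx_rate n (k n) (real CARD('d))) lam R" ..
  show ?thesis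
    by (rule posterior_consistency[OF prior_density_measurable prior_density_nonneg[OF prior]
          R[unfolded lam_def] lam0[unfolded lam_def] N2 N3 q k projection bias bstar C1 C2 eps])
qed

end
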